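(* Let $k$ be a field of characteristic zero, let $X=X_0\cup X_1=\{1,x_1,\dots,x_n\}$ be a set of even and odd generators (with $1$ even), linearly ordered by $1<x_1<\dots<x_n$, and let $JB$ be the free unital superalgebra of Jordan brackets over $k$ generated by $X$ (with $1$ as unit). Then the set $U$ of ordered monomials defined in the context is a basis of $JB$ (as a vector space over $k$).
   Context: A unital superalgebra of Jordan brackets is a $\mathbb{Z}_2$-graded vector space with two even bilinear products: an associative supercommutative product $\cdot$ with (even) unit $1$, and a superanticommutative bracket $\{,\}$, i.e. $\{a,b\}=-(-1)^{|a||b|}\{b,a\}$, such that for homogeneous $a,b,c$, with $D(a)=\{a,1\}$, $$\{a,bc\}=\{a,b\}c+(-1)^{|a||b|}b\{a,c\}-D(a)bc,$$ $$\{a,\{b,c\}\}=\{\{a,b\},c\}+(-1)^{|a||b|}\{b,\{a,c\}\}+D(a)\{b,c\}+(-1)^{|a|(|b|+|c|)}D(b)\{c,a\}+(-1)^{|c|(|a|+|b|)}D(c)\{a,b\}.$$ $JB=D_X/I$, where $D_X$ is the free non-associative superalgebra with two multiplications $\cdot$ and $\{,\}$ on the generators $X=\{1,x_1,\dots,x_n\}$, and $I$ is the ideal generated by all the relations expressing that $\cdot$ is associative and supercommutative, that $1\cdot a=a$, that $\{,\}$ is superanticommutative, and that the two displayed identities hold. Good words in the alphabet $X$ (note that the letter $1$ is included) are bracket words defined recursively. All elements of $X$ are good words. A word $w$ of length at least $2$ is good if: 1) $w=\{u,v\}$ with $u,v$ good words and $u>v$; and 2) if $w=\{\{u_1,u_2\},v\}$,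 then $u_2\le v$. Let $M=\{u,\{v,v\} \mid u,v \text{ good words in } X,\ v \text{ odd}\}$. The linear order on $M$ (used also for good words) is: on $X$ the given order; $u>v$ if $\deg u>\deg v$ ($\deg$ = number of letters); if $\deg u=\deg v\geq 2$, $u=\{u_1,u_2\}$, $v=\{v_1,v_2\}$, then $u>v$ if $u_1>v_1$, or if $u_1=v_1$ and $u_2>v_2$. The elements of $M$ are denoted $e_i$, with $e_i<e_j$ if $i<j$. Finally, $$U=\{e_{i_1}^{k_1}\cdots e_{i_r}^{k_r}\mid r\ge 1,\ e_{i_m}\in M,\ i_1<\dots<i_r,\ e_{i_1}\ne 1,\ k_j\ge 1,\ k_j=1 \text{ if } e_{i_j}\text{ is odd}\}\cup\{1\},$$ where the products are with respect to $\cdot$ and elements are identified with their images in $JB$. *)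

theory Defs
  imports "Jordan_Normal_Form.VS_Connect" "HOL-Library.Poly_Mapping" "HOL-Library.Z2"
begin

section \<open>Non-associative words with two multiplications\<close>

text \<open>
  The alphabet is \<open>X = {1, x\<^sub>1, \<dots>, x\<^sub>n}\<close>: the letter \<open>1\<close> is \<open>One\<close>, and \<open>x\<^sub>1 < \<dots> < x\<^sub>n\<close> are the
  elements of an arbitrary finite linearly ordered type, embedded by \<open>Gen\<close>. The parity
  \<open>par x\<close> of a generator is an element of \<open>\<int>\<^sub>2\<close>, with \<open>1\<close> for odd.
\<close>

datatype 'x nword =
    One
  | Gen 'x
  | Mul "'x nword" "'x nword"
  | Br "'x nword" "'x nword"

fun parity :: "('x \<Rightarrow> bit) \<Rightarrow> 'x nword \<Rightarrow> bit" where
  "parity par One = 0"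
| "parity par (Gen x) = par x"
| "parity par (Mul u v) = parity par u + parity par v"
| "parity par (Br u v) = parity par u + parity par v"

fun deg :: "'x nword \<Rightarrow> nat" where
  "deg One = 1"
| "deg (Gen x) = 1"
| "deg (Mul u v) = deg u + deg v"
| "deg (Br u v) = deg u + deg v"

text \<open>The order is only meaningful on words without \<open>Mul\<close>, on which it is linear.\<close>

fun word_less :: "'x::linorder nword \<Rightarrow> 'x nword \<Rightarrow> bool" (infix \<open>\<prec>\<close> 50) where
  "Gen x \<prec> Gen y \<longleftrightarrow> x < y"
| "One \<prec> Gen y \<longleftrightarrow> True"
| "Br u1 u2 \<prec> Br v1 v2 \<longleftrightarrow>
     deg (Br u1 u2) < deg (Br v1 v2) \<or>
     deg (Br u1 u2) = deg (Br v1 v2) \<and> (u1 \<prec> v1 \<or> u1 = v1 \<and> u2 \<prec> v2)"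
| "u \<prec> v \<longleftrightarrow> deg u < deg v"

abbreviation word_le :: "'x::linorder nword \<Rightarrow> 'x nword \<Rightarrow> bool" (infix \<open>\<preceq>\<close> 50) where
  "u \<preceq> v \<equiv> u \<prec> v \<or> u = v"

fun good :: "'x::linorder nword \<Rightarrow> bool" where
  "good One \<longleftrightarrow> True"
| "good (Gen x) \<longleftrightarrow> True"
| "good (Mul u v) \<longleftrightarrow> False"
| "good (Br u v) \<longleftrightarrow> good u \<and> good v \<and> v \<prec> u \<and>
     (case u of Br u1 u2 \<Rightarrow> u2 \<preceq> v | _ \<Rightarrow> True)"

definition M_words :: "('x::linorder \<Rightarrow> bit) \<Rightarrow> 'x nword set" where
  "M_words par = {u. good u} \<union> {Br v v | v. good v \<and> parity par v = 1}"

section \<open>The free non-associative superalgebra\<close>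

text \<open>\<open>D\<^sub>X\<close> is the space of finitely supported functions on the words.\<close>

type_synonym ('x, 'k) free_alg = "'x nword \<Rightarrow>\<^sub>0 'k"

definition word :: "'x nword \<Rightarrow> ('x, 'k::field) free_alg" where
  "word w = Poly_Mapping.single w 1"

definition scale :: "'k::field \<Rightarrow> ('x, 'k) free_alg \<Rightarrow> ('x, 'k) free_alg" where
  "scale c p = Poly_Mapping.map (\<lambda>d. c * d) p"

definition bilinear_ext ::
  "('x nword \<Rightarrow> 'x nword \<Rightarrow> 'x nword) \<Rightarrow>
   ('x, 'k::field) free_alg \<Rightarrow> ('x, 'k) free_alg \<Rightarrow> ('x, 'k) free_alg" where
  "bilinear_ext f p q =
     (\<Sum>u\<in>Poly_Mapping.keys p. \<Sum>v\<in>Poly_Mapping.keys q.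
        Poly_Mapping.single (f u v) (Poly_Mapping.lookup p u * Poly_Mapping.lookup q v))"

definition mul :: "('x, 'k::field) free_alg \<Rightarrow> ('x, 'k) free_alg \<Rightarrow> ('x, 'k) free_alg" where
  "mul = bilinear_ext Mul"

definition br :: "('x, 'k::field) free_alg \<Rightarrow> ('x, 'k) free_alg \<Rightarrow> ('x, 'k) free_alg" where
  "br = bilinear_ext Br"

lemma lookup_scale: "Poly_Mapping.lookup (scale c p) w = c * Poly_Mapping.lookup p w"
  by (simp add: scale_def Poly_Mapping.map.rep_eq when_def)

lemma scale_simps [simp]:
  "scale c (p + q) = scale c p + scale c q"
  "scale c (p - q) = scale c p - scale c q"
  "scale (c + d) p = scale c p + scale d p"
  "scale c (scale d p) = scale (c * d) p"
  "scale 1 p = p"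
  "scale c 0 = 0"
  by (rule poly_mapping_eqI; simp add: lookup_scale lookup_add lookup_minus algebra_simps)+

lemma scale_minus_one: "scale (- 1) p = - p"
  by (rule poly_mapping_eqI) (simp add: lookup_scale)

lemma bilinear_ext_superset:
  assumes "finite P" "Poly_Mapping.keys p \<subseteq> P" "finite Q" "Poly_Mapping.keys q \<subseteq> Q"
  shows "bilinear_ext f p q =
    (\<Sum>u\<in>P. \<Sum>v\<in>Q.
        Poly_Mapping.single (f u v) (Poly_Mapping.lookup p u * Poly_Mapping.lookup q v))"
  unfolding bilinear_ext_def using assms
  by (intro sum.mono_neutral_cong_left sum.cong ballI)
     (auto simp: in_keys_iff intro!: sum.neutral)

lemma bilinear_ext_add_left: "bilinear_ext f (p + p') q = bilinear_ext f p q + bilinear_ext f p' q"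
proof -
  let ?P = "Poly_Mapping.keys p \<union> Poly_Mapping.keys p'"
  have "Poly_Mapping.keys (p + p') \<subseteq> ?P" by (rule Poly_Mapping.keys_add)
  then show ?thesis
    by (simp add: bilinear_ext_superset[of ?P _ "Poly_Mapping.keys q"] lookup_add
        distrib_right single_add sum.distrib)
qed

lemma bilinear_ext_add_right: "bilinear_ext f p (q + q') = bilinear_ext f p q + bilinear_ext f p q'"
proof -
  let ?Q = "Poly_Mapping.keys q \<union> Poly_Mapping.keys q'"
  have "Poly_Mapping.keys (q + q') \<subseteq> ?Q" by (rule Poly_Mapping.keys_add)
  then show ?thesis
    by (simp add: bilinear_ext_superset[of "Poly_Mapping.keys p" _ ?Q] lookup_add
        distrib_left single_add sum.distrib)
qed

lemma bilinear_ext_diff: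
  "bilinear_ext f (p - p') q = bilinear_ext f p q - bilinear_ext f p' q"
  "bilinear_ext f p (q - q') = bilinear_ext f p q - bilinear_ext f p q'"
  using bilinear_ext_add_left[of f "p - p'" p' q] bilinear_ext_add_right[of f p "q - q'" q']
  by (simp_all add: algebra_simps)

definition homogeneous :: "('x \<Rightarrow> bit) \<Rightarrow> bit \<Rightarrow> ('x, 'k::field) free_alg set" where
  "homogeneous par s = {p. \<forall>w\<in>Poly_Mapping.keys p. parity par w = s}"

section \<open>The free unital superalgebra of Jordan brackets\<close>

definition sg :: "bit \<Rightarrow> 'k::field" where
  "sg s = (if s = 0 then 1 else - 1)"

definition D_op :: "('x, 'k::field) free_alg \<Rightarrow> ('x, 'k) free_alg" where
  "D_op a = br a (word One)"

inductive_set JB_relations :: "('x \<Rightarrow> bit) \<Rightarrow> ('x, 'k::field) free_alg set"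
  for par :: "'x \<Rightarrow> bit" where
  assoc: "mul (mul a b) c - mul a (mul b c) \<in> JB_relations par"
| supercomm:
    "a \<in> homogeneous par s \<Longrightarrow> b \<in> homogeneous par t \<Longrightarrow>
     mul a b - scale (sg (s * t)) (mul b a) \<in> JB_relations par"
| unit: "mul (word One) a - a \<in> JB_relations par"
| superanticomm:
    "a \<in> homogeneous par s \<Longrightarrow> b \<in> homogeneous par t \<Longrightarrow>
     br a b - (- scale (sg (s * t)) (br b a)) \<in> JB_relations par"
| leibniz:
    "a \<in> homogeneous par s \<Longrightarrow> b \<in> homogeneous par t \<Longrightarrow> c \<in> homogeneous par r \<Longrightarrow>
     br a (mul b c) -
       (mul (br a b) c + scale (sg (s * t)) (mul b (br a c)) - mul (mul (D_op a) b) c)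
     \<in> JB_relations par"
| jacobi:
    "a \<in> homogeneous par s \<Longrightarrow> b \<in> homogeneous par t \<Longrightarrow> c \<in> homogeneous par r \<Longrightarrow>
     br a (br b c) -
       (br (br a b) c + scale (sg (s * t)) (br b (br a c)) + mul (D_op a) (br b c)
        + scale (sg (s * (t + r))) (mul (D_op b) (br c a))
        + scale (sg (r * (s + t))) (mul (D_op c) (br a b)))
     \<in> JB_relations par"

inductive_set JB_ideal :: "('x \<Rightarrow> bit) \<Rightarrow> ('x, 'k::field) free_alg set"
  for par :: "'x \<Rightarrow> bit" where
  rel: "p \<in> JB_relations par \<Longrightarrow> p \<in> JB_ideal par"
| zero: "0 \<in> JB_ideal par"
| add: "p \<in> JB_ideal par \<Longrightarrow> q \<in> JB_ideal par \<Longrightarrow> p + q \<in> JB_ideal par"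
| scale: "p \<in> JB_ideal par \<Longrightarrow> scale c p \<in> JB_ideal par"
| mul_left: "p \<in> JB_ideal par \<Longrightarrow> mul a p \<in> JB_ideal par"
| mul_right: "p \<in> JB_ideal par \<Longrightarrow> mul p a \<in> JB_ideal par"
| br_left: "p \<in> JB_ideal par \<Longrightarrow> br a p \<in> JB_ideal par"
| br_right: "p \<in> JB_ideal par \<Longrightarrow> br p a \<in> JB_ideal par"

definition JB_cong :: "('x \<Rightarrow> bit) \<Rightarrow> (('x, 'k::field) free_alg \<times> ('x, 'k) free_alg) set" where
  "JB_cong par = {(p, q). p - q \<in> JB_ideal par}"

abbreviation JB_class ::
  "('x \<Rightarrow> bit) \<Rightarrow> ('x, 'k::field) free_alg \<Rightarrow> ('x, 'k) free_alg set" where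
  "JB_class par p \<equiv> JB_cong par `` {p}"

record ('a, 'b) bracket_module = "('a, 'b) module" +
  bracket :: "'b \<Rightarrow> 'b \<Rightarrow> 'b"

definition JB ::
  "('x \<Rightarrow> bit) \<Rightarrow> ('k::field, ('x, 'k) free_alg set) bracket_module" where
  "JB par =
    \<lparr> carrier = UNIV // JB_cong par,
      monoid.mult = (\<lambda>A B. \<Union>p\<in>A. \<Union>q\<in>B. JB_class par (mul p q)),
      one = JB_class par (word One),
      ring.zero = JB_class par 0,
      add = (\<lambda>A B. \<Union>p\<in>A. \<Union>q\<in>B. JB_class par (p + q)),
      smult = (\<lambda>c A. \<Union>p\<in>A. JB_class par (scale c p)),
      bracket = (\<lambda>A B. \<Union>p\<in>A. \<Union>q\<in>B. JB_class par (br p q)) \<rparr>"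

lemma JB_ideal_uminus: "p \<in> JB_ideal par \<Longrightarrow> - p \<in> JB_ideal par"
  using JB_ideal.scale[of p par "- 1"] by (simp add: scale_minus_one)

lemma JB_ideal_diff: "p \<in> JB_ideal par \<Longrightarrow> q \<in> JB_ideal par \<Longrightarrow> p - q \<in> JB_ideal par"
  using JB_ideal.add[OF _ JB_ideal_uminus] by fastforce

lemma equiv_JB_cong: "equiv UNIV (JB_cong par)"
proof (rule equivI)
  show "refl (JB_cong par)" by (simp add: refl_on_def JB_cong_def JB_ideal.zero)
  show "sym (JB_cong par)"
    unfolding sym_def JB_cong_def using JB_ideal_uminus by fastforce
  show "trans (JB_cong par)"
    unfolding trans_def JB_cong_def using JB_ideal.add by fastforce
qed simp

lemma JB_class_eq_iff: "JB_class par p = JB_class par q \<longleftrightarrow> p - q \<in> JB_ideal par"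
  using eq_equiv_class_iff[OF equiv_JB_cong, of p q par] by (simp add: JB_cong_def)

text \<open>The operations of \<open>JB\<close> are well defined: they are computed on representatives.\<close>

lemma JB_class_lift2:
  fixes f :: "('x, 'k::field) free_alg \<Rightarrow> ('x, 'k) free_alg \<Rightarrow> ('x, 'k) free_alg"
  assumes "\<And>p q p' q'. p - p' \<in> JB_ideal par \<Longrightarrow> q - q' \<in> JB_ideal par \<Longrightarrow>
    f p q - f p' q' \<in> JB_ideal par"
  shows "(\<Union>p'\<in>JB_class par p. \<Union>q'\<in>JB_class par q. JB_class par (f p' q')) = JB_class par (f p q)"
proof (rule UN_equiv_class2[OF equiv_JB_cong equiv_JB_cong])
  show "congruent2 (JB_cong par) (JB_cong par) (\<lambda>p q. JB_class par (f p q))"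
  proof (rule congruent2I')
    fix p p' q q' :: "('x, 'k) free_alg" assume "(p, p') \<in> JB_cong par" "(q, q') \<in> JB_cong par"
    then have "f p q - f p' q' \<in> JB_ideal par"
      by (intro assms) (simp_all add: JB_cong_def)
    then show "JB_class par (f p q) = JB_class par (f p' q')"
      by (simp only: JB_class_eq_iff)
  qed
qed simp_all

lemma JB_mult_class:
  "JB_class par p \<otimes>\<^bsub>JB par\<^esub> JB_class par q = JB_class par (mul p q)"
proof -
  have "mul p q - mul p' q' \<in> JB_ideal par"
    if "p - p' \<in> JB_ideal par" "q - q' \<in> JB_ideal par" for p q p' q'
  proof -
    have "mul p q - mul p' q' = mul (p - p') q + mul p' (q - q')"
      by (simp add: mul_def bilinear_ext_diff)
    then show ?thesis using that by (simp add: JB_ideal.add JB_ideal.mul_left JB_ideal.mul_right)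
  qed
  then show ?thesis by (simp add: JB_def) (rule JB_class_lift2)
qed

lemma JB_bracket_class:
  "bracket (JB par) (JB_class par p) (JB_class par q) = JB_class par (br p q)"
proof -
  have "br p q - br p' q' \<in> JB_ideal par"
    if "p - p' \<in> JB_ideal par" "q - q' \<in> JB_ideal par" for p q p' q'
  proof -
    have "br p q - br p' q' = br (p - p') q + br p' (q - q')"
      by (simp add: br_def bilinear_ext_diff)
    then show ?thesis using that by (simp add: JB_ideal.add JB_ideal.br_left JB_ideal.br_right)
  qed
  then show ?thesis by (simp add: JB_def) (rule JB_class_lift2)
qed

lemma JB_add_class:
  "JB_class par p \<oplus>\<^bsub>JB par\<^esub> JB_class par q = JB_class par (p + q)"
proof -
  have "(p + q) - (p' + q') \<in> JB_ideal par"
    if "p - p' \<in> JB_ideal par" "q - q' \<in> JB_ideal par" for p q p' q'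
    using JB_ideal.add[OF that] by (simp add: algebra_simps)
  then show ?thesis by (simp add: JB_def) (rule JB_class_lift2)
qed

lemma JB_smult_class:
  "c \<odot>\<^bsub>JB par\<^esub> JB_class par p = JB_class par (scale c p)"
proof -
  have "congruent (JB_cong par) (\<lambda>p. JB_class par (scale c p))"
    by (rule congruentI)
       (metis (mono_tags) JB_class_eq_iff JB_cong_def JB_ideal.scale case_prodD mem_Collect_eq
         scale_simps(2))
  then show ?thesis using UN_equiv_class[OF equiv_JB_cong] by (fastforce simp: JB_def)
qed

lemma JB_carrierE:
  assumes "A \<in> carrier (JB par)" obtains p where "A = JB_class par p"
  using assms by (auto simp: JB_def elim: quotientE)

lemma JB_class_carrier: "JB_class par p \<in> carrier (JB par)"
  by (simp add: JB_def quotientI)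

lemma JB_zero: "\<zero>\<^bsub>JB par\<^esub> = JB_class par 0"
  by (simp add: JB_def)

lemma vectorspace_JB: "vectorspace (class_ring :: 'k::field ring) (JB par)"
proof -
  have grp: "abelian_group (JB par)"
  proof (rule abelian_groupI)
    fix A assume "A \<in> carrier (JB par)"
    then obtain p where "A = JB_class par p" by (rule JB_carrierE)
    then show "\<exists>B\<in>carrier (JB par). B \<oplus>\<^bsub>JB par\<^esub> A = \<zero>\<^bsub>JB par\<^esub>"
      by (intro bexI[of _ "JB_class par (- p)"]) (simp_all add: JB_add_class JB_zero JB_class_carrier)
  qed (auto elim!: JB_carrierE simp: JB_add_class JB_zero JB_class_carrier add_ac)
  have "module (class_ring :: 'k ring) (JB par)"
    by (rule moduleI)
       (auto elim!: JB_carrierE intro: grp class_cring.cring_axioms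
         simp: JB_add_class JB_smult_class JB_class_carrier)
  then show ?thesis
    by (intro vectorspace.intro class_field.field_axioms)
qed

section \<open>The ordered monomials\<close>

text \<open>
  The list \<open>[(e\<^sub>1, k\<^sub>1), \<dots>, (e\<^sub>r, k\<^sub>r)]\<close> stands for the monomial with factors \<open>e\<^sub>i\<close> to the power \<open>k\<^sub>i\<close>;
  the empty list stands for the monomial \<open>1\<close>.
\<close>

definition monomial_exponents :: "('x::linorder \<Rightarrow> bit) \<Rightarrow> ('x nword \<times> nat) list set" where
  "monomial_exponents par =
    {es. sorted_wrt (\<prec>) (map fst es) \<and>
         (es \<noteq> [] \<longrightarrow> fst (hd es) \<noteq> One) \<and>
         (\<forall>(e, k)\<in>set es. e \<in> M_words par \<and> 1 \<le> k \<and> (parity par e = 1 \<longrightarrow> k = 1))}"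

definition JB_monomial ::
  "('x \<Rightarrow> bit) \<Rightarrow> ('x nword \<times> nat) list \<Rightarrow> ('x, 'k::field) free_alg set" where
  "JB_monomial par es =
    foldr (\<lambda>(e, k) A. (JB_class par (word e) [^]\<^bsub>JB par\<^esub> k) \<otimes>\<^bsub>JB par\<^esub> A) es \<one>\<^bsub>JB par\<^esub>"

definition U_monomials :: "('x::linorder \<Rightarrow> bit) \<Rightarrow> ('x, 'k::field) free_alg set set" where
  "U_monomials par = JB_monomial par ` monomial_exponents par"

end

theory Submission
  imports Defs "HOL-Library.Product_Plus"
begin

text \<open>
  For the spanning part, Hall's rewriting of brackets of basis words works modulo products of words
  of smaller degree: the terms with \<open>D\<close> in the Jacobi identity are such products.

  For the independence, let \<open>e\<close> be the letter \<open>1\<close> and \<open>L\<close> the free Lie superalgebra on \<open>X\<close>, with \<open>e\<close>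
  as an ordinary generator. A Jordan bracket amounts to a contact bracket, hence to a Poisson bracket
  of degree \<open>-1\<close> in which \<open>e\<close> is a distinguished element of degree \<open>1\<close>; so the free object is
  \<open>S(L) / (e - 1)\<close>. As \<open>S(L)\<close> we take the associated graded algebra of the free associative
  superalgebra \<open>k\<langle>X\<rangle>\<close>: in the Rees algebra inside \<open>k\<langle>X\<rangle>[t, 1/t]\<close> the bracket is the supercommutator
  divided by \<open>t\<close>, so that the quotient by \<open>t\<close> is a Poisson superalgebra for free.
  The ordered products of Lie words in \<open>M\<close> are independent there, because in each degree they span
  the words of that length and there are at most as many of them. Finally, up to a nonzero scalar
  and powers of \<open>e\<close>, every word of \<open>M\<close> other than \<open>1\<close> evaluates to its Lie word plus products of at
  least two Lie words different from \<open>e\<close>, so that the terms with the fewest factors of a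
  relation between ordered monomials have to vanish.
\<close>


section \<open>Words\<close>

text \<open>The squares \<open>{v, v}\<close> of odd good words distinguish the super case from
  Hall's. In an ordered monomial an odd \<open>v\<close> occurs at most once while its even square
  may be repeated, so together they encode any multiplicity of \<open>v\<close> by its remainder and
  quotient modulo 2; and a multiset of good words is determined by the letters of its nondecreasing
  arrangement. This bounds the count.

  The rewriting is needed twice, in \<open>D_X\<close> modulo the ideal and in the free associative
  superalgebra, hence it is stated for brackets that obey the Lie identities only modulo neglected
  subspaces. It divides by 2 for even squares and by 3 for odd cubes.

  The element \<open>e\<close> is neither inverted nor set equal to 1. Words keep their degree,
  evaluated words are filled up with powers of \<open>e\<close> to a common degree, and the Jordan
  bracket on the Poisson side depends on the degrees of its arguments. The contact bracket behind it
  obeys the plain Jacobi identity; the correction \<open>a [b, 1] - [a, 1] b\<close> creates the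
  terms with \<open>D\<close>, and the factor 2 avoids fractions and makes
  \<open>D(a) = [a, 1]\<close>.\<close>

fun mulfree :: "'x nword \<Rightarrow> bool" where
  "mulfree One \<longleftrightarrow> True"
| "mulfree (Gen x) \<longleftrightarrow> True"
| "mulfree (Mul u v) \<longleftrightarrow> False"
| "mulfree (Br u v) \<longleftrightarrow> mulfree u \<and> mulfree v"

lemma deg_pos [simp]: "0 < deg w"
  by (induct w) auto

lemma deg_neq_0 [simp]: "deg w \<noteq> 0"
  using deg_pos[of w] by linarith

lemma deg_add_gt [simp]: "Suc 0 < deg u + deg v" "Suc 0 \<le> deg u + deg v"
  using deg_pos[of u] deg_pos[of v] by linarith+

lemma word_less_irrefl [simp]: "\<not> w \<prec> w"
  by (induct w) auto

lemma word_less_deg: "u \<prec> v \<Longrightarrow> deg u \<le> deg v"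
  by (induct u v rule: word_less.induct) auto

lemma word_less_if_deg: "mulfree u \<Longrightarrow> mulfree v \<Longrightarrow> deg u < deg v \<Longrightarrow> u \<prec> v"
  by (cases u; cases v) auto

lemma word_less_total: "mulfree u \<Longrightarrow> mulfree v \<Longrightarrow> u \<prec> v \<or> u = v \<or> v \<prec> u"
proof (induct u v rule: word_less.induct)
  case (3 u1 u2 v1 v2)
  then show ?case by (auto simp: not_less le_less)
qed (auto, (case_tac u; simp)?)

lemma word_less_trans: "u \<prec> v \<Longrightarrow> v \<prec> w \<Longrightarrow> mulfree u \<Longrightarrow> mulfree v \<Longrightarrow> mulfree w \<Longrightarrow> u \<prec> w"
proof (induct u arbitrary: v w)
  case One
  then show ?case by (cases v; cases w) auto
next
  case (Gen x)
  then show ?case by (cases v; cases w) auto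
next
  case (Mul u1 u2)
  then show ?case by simp
next
  case (Br u1 u2)
  then obtain v1 v2 where v: "v = Br v1 v2"
    by (cases v) (use Br.prems in \<open>auto dest: word_less_deg\<close>)
  obtain w1 w2 where w: "w = Br w1 w2"
    using Br.prems v by (cases w) (auto dest: word_less_deg)
  have IH: "u1 \<prec> v1 \<Longrightarrow> v1 \<prec> w1 \<Longrightarrow> u1 \<prec> w1" "u2 \<prec> v2 \<Longrightarrow> v2 \<prec> w2 \<Longrightarrow> u2 \<prec> w2"
    using Br.hyps Br.prems(3-5) v w by auto
  have "deg u1 + deg u2 < deg v1 + deg v2 \<or>
      deg u1 + deg u2 = deg v1 + deg v2 \<and> (u1 \<prec> v1 \<or> u1 = v1 \<and> u2 \<prec> v2)"
    "deg v1 + deg v2 < deg w1 + deg w2 \<or>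
      deg v1 + deg v2 = deg w1 + deg w2 \<and> (v1 \<prec> w1 \<or> v1 = w1 \<and> v2 \<prec> w2)"
    using Br.prems(1,2) v w by simp_all
  then have "deg u1 + deg u2 < deg w1 + deg w2 \<or>
      deg u1 + deg u2 = deg w1 + deg w2 \<and> (u1 \<prec> w1 \<or> u1 = w1 \<and> u2 \<prec> w2)"
    using IH less_trans[of "deg u1 + deg u2"] by metis
  then show ?case using w by simp
qed

lemma One_least: "mulfree w \<Longrightarrow> w \<noteq> One \<Longrightarrow> One \<prec> w"
  using word_less_total[of One w] by (cases w) auto

lemma good_mulfree: "good w \<Longrightarrow> mulfree w"
  by (induct w) auto

lemma M_words_iff: "w \<in> M_words par \<longleftrightarrow> good w \<or> (\<exists>v. w = Br v v \<and> good v \<and> parity par v = 1)"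
  by (auto simp: M_words_def)

lemma M_words_mulfree: "w \<in> M_words par \<Longrightarrow> mulfree w"
  by (auto simp: M_words_iff good_mulfree)

lemma good_in_M: "good w \<Longrightarrow> w \<in> M_words par"
  by (simp add: M_words_iff)

text \<open>In the rewriting a square \<open>Br v v\<close> behaves like its root \<open>v\<close>,
  so factors are compared through their bases.\<close>

definition base :: "'x nword \<Rightarrow> 'x nword" where
  "base w = (case w of Br a b \<Rightarrow> if a = b then a else w | _ \<Rightarrow> w)"

lemma base_good [simp]: "good w \<Longrightarrow> base w = w"
  by (auto simp: base_def split: nword.splits)

lemma base_square [simp]: "base (Br v v) = v"
  by (simp add: base_def)

lemma good_base: "w \<in> M_words par \<Longrightarrow> good (base w)"
  by (auto simp: M_words_iff)

lemma deg_base_le: "deg (base w) \<le> deg w"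
  by (cases w) (auto simp: base_def)

lemma finite_deg_le: "finite {w :: 'x::finite nword. deg w \<le> n}"
proof (induct n)
  case 0
  show ?case by simp
next
  case (Suc n)
  let ?S = "{w :: 'x nword. deg w \<le> n}"
  have "{w :: 'x nword. deg w \<le> Suc n} \<subseteq>
    {One} \<union> range Gen \<union> (\<lambda>(u, v). Mul u v) ` (?S \<times> ?S) \<union> (\<lambda>(u, v). Br u v) ` (?S \<times> ?S)"
  proof
    fix w :: "'x nword" assume w: "w \<in> {w. deg w \<le> Suc n}"
    show "w \<in> {One} \<union> range Gen \<union> (\<lambda>(u, v). Mul u v) ` (?S \<times> ?S) \<union> (\<lambda>(u, v). Br u v) ` (?S \<times> ?S)"
    proof (cases w)
      case (Mul u v)
      then have "deg u + deg v \<le> Suc n" using w by simp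
      then have "u \<in> ?S" "v \<in> ?S" using deg_pos[of u] deg_pos[of v] unfolding mem_Collect_eq by linarith+
      then show ?thesis using Mul by auto
    next
      case (Br u v)
      then have "deg u + deg v \<le> Suc n" using w by simp
      then have "u \<in> ?S" "v \<in> ?S" using deg_pos[of u] deg_pos[of v] unfolding mem_Collect_eq by linarith+
      then show ?thesis using Br by auto
    qed auto
  qed
  moreover have "finite ({One} \<union> range Gen \<union> (\<lambda>(u, v). Mul u v) ` (?S \<times> ?S) \<union> (\<lambda>(u, v). Br u v) ` (?S \<times> ?S))"
    using Suc by simp
  ultimately show ?case by (rule finite_subset)
qed

section \<open>Sorting modulo a subgroup\<close>

text \<open>Insertion sort for a map that changes only by a sign and an element of \<open>N\<close>
  when neighbours are exchanged. Signs are not tracked, since only membership in spans matters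
  later. The hypotheses concern lists with multiset \<open>A\<close> only, so that length and total
  degree are available when they are verified.\<close>

lemma sort_mod_subgroup:
  fixes f :: "'a list \<Rightarrow> 'v::ab_group_add"
  assumes N0: "0 \<in> N" and Nadd: "\<And>x y. x \<in> N \<Longrightarrow> y \<in> N \<Longrightarrow> x + y \<in> N"
    and Nneg: "\<And>x. x \<in> N \<Longrightarrow> - x \<in> N"
    and total: "\<And>a b. a \<in> K \<Longrightarrow> b \<in> K \<Longrightarrow> lt a b \<or> a = b \<or> lt b a"
    and trans: "\<And>a b c. a \<in> K \<Longrightarrow> b \<in> K \<Longrightarrow> c \<in> K \<Longrightarrow> lt a b \<Longrightarrow> lt b c \<Longrightarrow> lt a c"
    and swap: "\<And>xs a b ys. set (xs @ a # b # ys) \<subseteq> K \<Longrightarrow> mset (xs @ a # b # ys) = A \<Longrightarrow>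
      f (xs @ a # b # ys) - f (xs @ b # a # ys) \<in> N \<or> f (xs @ a # b # ys) + f (xs @ b # a # ys) \<in> N"
    and dup: "\<And>xs a ys. set (xs @ a # a # ys) \<subseteq> K \<Longrightarrow> mset (xs @ a # a # ys) = A \<Longrightarrow> od a \<Longrightarrow>
      f (xs @ a # a # ys) \<in> N"
    and xs: "set xs \<subseteq> K" "mset xs = A"
  shows "f xs \<in> N \<or> (\<exists>ys. mset ys = A \<and> sorted_wrt (\<lambda>a b. lt a b \<or> a = b \<and> \<not> od a) ys \<and>
    (f xs - f ys \<in> N \<or> f xs + f ys \<in> N))"
proof -
  define R where "R = (\<lambda>x y. x - y \<in> N \<or> x + y \<in> N)"
  define S where "S = sorted_wrt (\<lambda>a b. lt a b \<or> a = b \<and> \<not> od a)"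
  have R_refl: "R x x" for x using N0 by (simp add: R_def)
  have R_trans: "R x z" if "R x y" "R y z" for x y z
  proof -
    have eqs: "x - z = (x - y) + (y - z)" "x + z = (x - y) + (y + z)"
      "x + z = (x + y) + - (y - z)" "x - z = (x + y) + - (y + z)" by simp_all
    show ?thesis using that unfolding R_def by (metis eqs Nadd Nneg)
  qed
  have R_N: "x \<in> N" if "R x y" "y \<in> N" for x y
  proof -
    have eqs: "x = (x - y) + y" "x = (x + y) + - y" by simp_all
    show ?thesis using that unfolding R_def by (metis eqs Nadd Nneg)
  qed
  \<comment> \<open>The prefix is carried along because \<open>swap\<close> and \<open>dup\<close>
    speak about whole lists with multiset \<open>A\<close>.\<close>
  have insert: "f (pre @ a # ys) \<in> N \<or> (\<exists>zs. mset zs = mset (a # ys) \<and> S zs \<and> R (f (pre @ a # ys)) (f (pre @ zs)))"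
    if "S ys" "set (pre @ a # ys) \<subseteq> K" "mset (pre @ a # ys) = A" for ys pre a
    using that
  proof (induct ys arbitrary: pre)
    case Nil
    then show ?case by (intro disjI2 exI[of _ "[a]"]) (simp add: S_def R_refl)
  next
    case (Cons b ys)
    have K: "a \<in> K" "b \<in> K" "set ys \<subseteq> K" using Cons.prems by auto
    consider "lt a b" | "a = b" "od a" | "a = b" "\<not> od a" | "lt b a" using total K by blast
    then show ?case
    proof cases
      case 1
      have "S (a # b # ys)" using Cons.prems(1) 1 trans[OF K(1,2) _ 1] K by (auto simp: S_def)
      then show ?thesis using R_refl by (intro disjI2 exI[of _ "a # b # ys"]) simp
    next
      case 2
      then show ?thesis using dup[of pre a ys] Cons.prems by simp
    next
      case 3
      have "S (a # b # ys)" using Cons.prems(1) 3 by (auto simp: S_def)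
      then show ?thesis using R_refl by (intro disjI2 exI[of _ "a # b # ys"]) simp
    next
      case 4
      have R1: "R (f (pre @ a # b # ys)) (f (pre @ b # a # ys))"
        using swap[of pre a b ys] Cons.prems by (simp add: R_def)
      have "f ((pre @ [b]) @ a # ys) \<in> N \<or>
        (\<exists>zs. mset zs = mset (a # ys) \<and> S zs \<and> R (f ((pre @ [b]) @ a # ys)) (f ((pre @ [b]) @ zs)))"
        using Cons.prems by (intro Cons.hyps) (auto simp: S_def)
      then show ?thesis
      proof
        assume "f ((pre @ [b]) @ a # ys) \<in> N"
        then show ?thesis using R_N[OF R1] by simp
      next
        assume "\<exists>zs. mset zs = mset (a # ys) \<and> S zs \<and> R (f ((pre @ [b]) @ a # ys)) (f ((pre @ [b]) @ zs))"
        then obtain zs where zs: "mset zs = mset (a # ys)" "S zs"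
          "R (f (pre @ b # a # ys)) (f (pre @ b # zs))" by auto
        have "set zs = insert a (set ys)" using zs(1) by (metis list.set(2) set_mset_mset)
        then have "S (b # zs)" using zs(2) 4 Cons.prems(1) by (auto simp: S_def)
        then show ?thesis using zs R_trans[OF R1 zs(3)]
          by (intro disjI2 exI[of _ "b # zs"]) (simp add: add_mset_commute)
      qed
    qed
  qed
  have "f (pre @ xs) \<in> N \<or> (\<exists>zs. mset zs = mset xs \<and> S zs \<and> R (f (pre @ xs)) (f (pre @ zs)))"
    if "set (pre @ xs) \<subseteq> K" "mset (pre @ xs) = A" for pre xs
    using that
  proof (induct xs arbitrary: pre)
    case Nil
    then show ?case by (intro disjI2 exI[of _ "[]"]) (simp add: S_def R_refl)
  next
    case (Cons a xs)
    have "f ((pre @ [a]) @ xs) \<in> N \<or> (\<exists>zs. mset zs = mset xs \<and> S zs \<and> R (f ((pre @ [a]) @ xs)) (f ((pre @ [a]) @ zs)))"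
      using Cons.prems by (intro Cons.hyps) auto
    then show ?case
    proof
      assume "\<exists>zs. mset zs = mset xs \<and> S zs \<and> R (f ((pre @ [a]) @ xs)) (f ((pre @ [a]) @ zs))"
      then obtain zs where zs: "mset zs = mset xs" "S zs" "R (f (pre @ a # xs)) (f (pre @ a # zs))" by auto
      have "set zs = set xs" using zs(1) by (metis set_mset_mset)
      then have "f (pre @ a # zs) \<in> N \<or> (\<exists>ws. mset ws = mset (a # zs) \<and> S ws \<and> R (f (pre @ a # zs)) (f (pre @ ws)))"
        using Cons.prems zs by (intro insert) auto
      then show ?thesis using R_N[OF zs(3)] R_trans[OF zs(3)] zs(1) by auto
    qed simp
  qed
  from this[of "[]" xs] show ?thesis using xs by (simp add: R_def S_def)
qed

section \<open>Counting ordered monomials\<close>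

definition word_rel :: "('x::linorder nword \<Rightarrow> bool) \<Rightarrow> 'x nword \<Rightarrow> 'x nword \<Rightarrow> bool" where
  "word_rel od a b \<longleftrightarrow> a \<prec> b \<or> a = b \<and> \<not> od a"

definition sorted_M :: "('x::linorder \<Rightarrow> bit) \<Rightarrow> 'x nword list set" where
  "sorted_M par = {ws. set ws \<subseteq> M_words par \<and> sorted_wrt (word_rel (\<lambda>a. parity par a = 1)) ws}"

definition total_deg :: "'x nword list \<Rightarrow> nat" where
  "total_deg ws = sum_list (map deg ws)"

lemma total_deg_simps [simp]:
  "total_deg [] = 0" "total_deg (w # ws) = deg w + total_deg ws"
  "total_deg (vs @ ws) = total_deg vs + total_deg ws"
  by (simp_all add: total_deg_def)

lemma total_deg_mset: "mset vs = mset ws \<Longrightarrow> total_deg vs = total_deg ws"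
  unfolding total_deg_def by (metis mset_map sum_mset_sum_list)


lemma word_rel_eq: "word_rel od = (\<lambda>a b. a \<prec> b \<or> a = b \<and> \<not> od a)"
  by (intro ext) (simp add: word_rel_def)

lemma sort_M_words:
  fixes f :: "'x::linorder nword list \<Rightarrow> 'v::ab_group_add"
  assumes "0 \<in> N" "\<And>x y. x \<in> N \<Longrightarrow> y \<in> N \<Longrightarrow> x + y \<in> N" "\<And>x. x \<in> N \<Longrightarrow> - x \<in> N"
    and "\<And>us a b vs. set (us @ a # b # vs) \<subseteq> M_words par \<Longrightarrow> mset (us @ a # b # vs) = mset ws \<Longrightarrow>
      f (us @ a # b # vs) - f (us @ b # a # vs) \<in> N \<or> f (us @ a # b # vs) + f (us @ b # a # vs) \<in> N"
    and "\<And>us a vs. set (us @ a # a # vs) \<subseteq> M_words par \<Longrightarrow> mset (us @ a # a # vs) = mset ws \<Longrightarrow>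
      parity par a = 1 \<Longrightarrow> f (us @ a # a # vs) \<in> N"
    and ws: "set ws \<subseteq> M_words par"
  shows "f ws \<in> N \<or> (\<exists>vs\<in>sorted_M par. mset vs = mset ws \<and> (f ws - f vs \<in> N \<or> f ws + f vs \<in> N))"
proof -
  have "f ws \<in> N \<or> (\<exists>vs. mset vs = mset ws \<and>
      sorted_wrt (\<lambda>a b. a \<prec> b \<or> a = b \<and> \<not> parity par a = 1) vs \<and> (f ws - f vs \<in> N \<or> f ws + f vs \<in> N))"
  proof (rule sort_mod_subgroup[where K = "M_words par"])
    show "a \<prec> b \<or> a = b \<or> b \<prec> a" if "a \<in> M_words par" "b \<in> M_words par" for a b
      using that by (intro word_less_total M_words_mulfree)
    show "a \<prec> c" if "a \<in> M_words par" "b \<in> M_words par" "c \<in> M_words par" "a \<prec> b" "b \<prec> c" for a b c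
      using that M_words_mulfree word_less_trans by blast
  qed (use assms in auto)
  moreover have "vs \<in> sorted_M par"
    if "mset vs = mset ws" "sorted_wrt (\<lambda>a b. a \<prec> b \<or> a = b \<and> \<not> parity par a = 1) vs" for vs
    using ws mset_eq_setD[OF that(1)] that(2) by (simp add: sorted_M_def word_rel_eq)
  ultimately show ?thesis by blast
qed

lemma sorted_words_unique:
  assumes "sorted_wrt (word_rel od) ws" "sorted_wrt (word_rel od') vs" "mset ws = mset vs"
    "\<forall>w\<in>set ws. mulfree w"
  shows "ws = vs"
  using assms
proof (induct ws arbitrary: vs)
  case Nil
  then show ?case by simp
next
  case (Cons a ws)
  obtain b us where vs: "vs = b # us" using Cons.prems(3) by (metis list.exhaust mset.simps(1) mset_zero_iff list.distinct(1))
  have "a = b"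
  proof (rule ccontr)
    assume ne: "a \<noteq> b"
    have "set (a # ws) = set (b # us)" using mset_eq_setD[OF Cons.prems(3)] vs by simp
    then have mem: "a \<in> set us" "b \<in> set ws" using ne by auto
    have "word_rel od a b" "word_rel od' b a"
      using Cons.prems(1,2) mem vs by simp_all
    then have "a \<prec> b" "b \<prec> a" using ne by (auto simp: word_rel_def)
    moreover have "mulfree a" "mulfree b" using Cons.prems(4) mem by simp_all
    ultimately show False using word_less_trans[of a b a] by simp
  qed
  then show ?case using Cons.prems(1-4) Cons.hyps[of us] vs by simp
qed

lemma ex_sorted_words:
  fixes ws :: "'a::linorder nword list"
  assumes "\<forall>w\<in>set ws. mulfree w"
  shows "\<exists>vs. mset vs = mset ws \<and> sorted_wrt (word_rel (\<lambda>_. False)) vs"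
proof -
  have sub: "set ws \<subseteq> Collect mulfree" using assms by auto
  \<comment> \<open>With the constant map 1 and \<open>N = {0}\<close> the first alternative is
    impossible, and what remains is the bare existence of a sorted permutation.\<close>
  have "1 \<in> {0 :: int} \<or> (\<exists>vs. mset vs = mset ws \<and>
      sorted_wrt (\<lambda>a b. a \<prec> b \<or> a = b \<and> \<not> False) vs \<and> (1 - 1 \<in> {0 :: int} \<or> 1 + 1 \<in> {0 :: int}))"
    by (rule sort_mod_subgroup[where K = "Collect mulfree" and xs = ws and f = "\<lambda>_. 1 :: int"])
      (use sub in \<open>simp_all add: word_less_total, blast intro: word_less_trans\<close>)
  moreover have "word_rel (\<lambda>_. False) = (\<lambda>a b :: 'a nword. a \<preceq> b)" by (intro ext) (simp add: word_rel_def)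
  ultimately show ?thesis by auto
qed

section \<open>Unique factorization of a word into nondecreasing good words\<close>

fun foliage :: "'x nword \<Rightarrow> 'x option list" where
  "foliage One = [None]"
| "foliage (Gen x) = [Some x]"
| "foliage (Mul u v) = foliage u @ foliage v"
| "foliage (Br u v) = foliage u @ foliage v"

lemma length_foliage: "length (foliage w) = deg w"
  by (induct w) auto

fun push :: "'x::linorder nword \<Rightarrow> 'x nword list \<Rightarrow> 'x nword list" where
  "push x [] = [x]"
| "push x (y # S) = (if y \<prec> x then push (Br x y) S else x # y # S)"

definition letter_word :: "'x option \<Rightarrow> 'x nword" where
  "letter_word a = (case a of None \<Rightarrow> One | Some x \<Rightarrow> Gen x)"

definition parse :: "'x::linorder option list \<Rightarrow> 'x nword list \<Rightarrow> 'x nword list" where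
  "parse ls S = foldr (\<lambda>a. push (letter_word a)) ls S"

text \<open>
  Reading a word from right to left and merging a letter with its right neighbour as long as
  this produces a good word recovers an increasing sequence of good words from its concatenation.
\<close>

lemma parse_good:
  assumes "good h" "sorted_wrt (word_rel (\<lambda>_. False)) S" "\<forall>s\<in>set S. good s"
    "\<And>a b s S'. h = Br a b \<Longrightarrow> S = s # S' \<Longrightarrow> b \<preceq> s"
  shows "parse (foliage h) S = push h S"
  using assms
proof (induct h arbitrary: S)
  case (Br u v)
  have g: "good u" "good v" "v \<prec> u" using Br.prems(1) by auto
  \<comment> \<open>The right factor of \<open>v\<close> is shorter than \<open>v\<close>, hence
    below every \<open>s\<close> with \<open>v \<preceq> s\<close>. So the hypothesis on the top of
    the stack passes from \<open>Br u v\<close> to \<open>v\<close>.\<close>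
  have deg2: "b \<prec> v" if "v = Br a b" for a b
    using g(2) that by (intro word_less_if_deg) (auto intro: good_mulfree)
  have v: "parse (foliage v) S = push v S"
  proof (rule Br.hyps(2)[OF g(2) Br.prems(2,3)])
    fix a b s S' assume *: "v = Br a b" "S = s # S'"
    then have "mulfree b" "mulfree s" using g(2) Br.prems(3) by (auto intro: good_mulfree)
    then show "b \<preceq> s" using Br.prems(4)[OF refl *(2)] deg2[OF *(1)] word_less_trans[of b v s]
      good_mulfree[OF g(2)] by blast
  qed
  have pv: "push v S = v # S"
  proof (cases S)
    case (Cons s S')
    then have "v \<preceq> s" using Br.prems(4) by blast
    moreover have "mulfree s" using Br.prems(3) Cons good_mulfree by auto
    ultimately have "\<not> s \<prec> v" using word_less_trans[of v s v] good_mulfree[OF g(2)] by auto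
    then show ?thesis using Cons by simp
  qed simp
  have "sorted_wrt (word_rel (\<lambda>_. False)) (v # S)"
  proof (cases S)
    case (Cons s S')
    then have vs: "v \<preceq> s" using Br.prems(4) by blast
    have m: "mulfree v" "mulfree s" "\<forall>x\<in>set S'. mulfree x"
      using Br.prems(3) Cons good_mulfree g(2) by auto
    have "word_rel (\<lambda>_. False) v x" if "x \<in> set S" for x
    proof -
      have "s \<preceq> x" using that Br.prems(2) Cons by (auto simp: word_rel_def)
      then show ?thesis using vs m that Cons word_less_trans[of v s x] by (auto simp: word_rel_def)
    qed
    then show ?thesis using Br.prems(2) by simp
  qed simp
  \<comment> \<open>Now \<open>v\<close> is the top of the stack, and condition 2 in the goodness of
    \<open>Br u v\<close> is exactly the hypothesis needed to parse \<open>u\<close> on it. Pushing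
    \<open>u\<close> then merges it with \<open>v\<close> because
    \<open>v \<prec> u\<close>.\<close>
  then have "parse (foliage u) (v # S) = push u (v # S)"
    using g Br.prems(1,3) by (intro Br.hyps(1)) auto
  then show ?case using v pv g by (simp add: parse_def)
qed (simp_all add: parse_def letter_word_def)

text \<open>Supplies the left inverse for the count: concatenating the letters of a nondecreasing
  sequence of good words loses no information. No merge happens across two members of the sequence,
  because a merge needs a strict descent.\<close>

lemma parse_sorted_good:
  assumes "sorted_wrt (word_rel (\<lambda>_. False)) S" "\<forall>s\<in>set S. good s"
  shows "parse (concat (map foliage S)) [] = S"
  using assms
proof (induct S)
  case (Cons h S)
  have hs: "h \<preceq> s" "mulfree s" if "S = s # S'" for s S'
    using Cons.prems that good_mulfree by (auto simp: word_rel_def)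
  have h: "good h" "mulfree h" using Cons.prems good_mulfree by auto
  have "parse (foliage h) S = push h S"
  proof (rule parse_good)
    fix a b s S' assume *: "h = Br a b" "S = s # S'"
    have "mulfree b" "b \<prec> h"
      using h *(1) by (auto intro!: word_less_if_deg)
    then show "b \<preceq> s" using hs[OF *(2)] h word_less_trans[of b h s] by auto
  qed (use Cons.prems in auto)
  also have "push h S = h # S"
  proof (cases S)
    case (Cons s S')
    then show ?thesis using hs[OF Cons] h word_less_trans[of s h s] by auto
  qed simp
  finally show ?case using Cons by (simp add: parse_def)
qed (simp add: parse_def)

section \<open>Odd squares and the counting injection\<close>

definition unsquare :: "'x nword \<Rightarrow> 'x nword list" where
  "unsquare w = (if base w = w then [w] else [base w, base w])"

lemma count_expand:
  assumes "set ws \<subseteq> M_words par" "good v"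
  shows "count (mset (concat (map unsquare ws))) v =
    count (mset ws) v + (if parity par v = 1 then 2 * count (mset ws) (Br v v) else 0)"
  using assms(1)
proof (induct ws)
  case (Cons w ws)
  have "\<not> good (Br v v)" for v :: "'a nword" by simp
  then show ?case using Cons assms(2)
    by (auto simp: M_words_iff unsquare_def)
qed simp

text \<open>Replacing each square by two copies of its root is injective on sorted lists: an odd
  good \<open>v\<close> occurs there at most once, so the new multiplicity of \<open>v\<close>
  determines the old one by its remainder modulo 2 and that of \<open>Br v v\<close> by its half.
  Sorting the result and reading off its letters is injective by \<open>parse_sorted_good\<close>,
  and both steps preserve the total degree.\<close>

lemma sorted_M_inj:
  fixes par :: "'x::linorder \<Rightarrow> bit"
  shows "\<exists>\<phi> :: 'x nword list \<Rightarrow> 'x option list. inj_on \<phi> (sorted_M par) \<and>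
    (\<forall>ws\<in>sorted_M par. length (\<phi> ws) = total_deg ws)"
proof -
  let ?e = "\<lambda>ws. concat (map unsquare ws)"
  have "\<exists>vs. mset vs = mset (?e ws) \<and> sorted_wrt (word_rel (\<lambda>_. False)) vs" if "ws \<in> sorted_M par" for ws
    using that by (intro ex_sorted_words)
      (auto simp: sorted_M_def unsquare_def intro: good_mulfree good_base M_words_mulfree split: if_splits)
  then obtain \<sigma> where \<sigma>: "mset (\<sigma> ws) = mset (?e ws)" "sorted_wrt (word_rel (\<lambda>_. False)) (\<sigma> ws)"
    if "ws \<in> sorted_M par" for ws by metis
  have gd: "good s" if "ws \<in> sorted_M par" "s \<in> set (\<sigma> ws)" for ws s
  proof -
    have "s \<in> set (?e ws)" using that \<sigma>(1) by (metis set_mset_mset)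
    then obtain w where "w \<in> set ws" "s \<in> set (unsquare w)" by auto
    then show ?thesis using that(1) good_base[of w par]
      by (auto simp: sorted_M_def unsquare_def split: if_splits)
  qed
  define \<phi> where "\<phi> ws = concat (map foliage (\<sigma> ws))" for ws
  have "inj_on \<phi> (sorted_M par)"
  proof (rule inj_onI)
    fix ws vs assume ws: "ws \<in> sorted_M par" and vs: "vs \<in> sorted_M par" and eq: "\<phi> ws = \<phi> vs"
    have "\<sigma> ws = parse (\<phi> ws) []" "\<sigma> vs = parse (\<phi> vs) []"
      unfolding \<phi>_def using parse_sorted_good[OF \<sigma>(2)] gd ws vs by metis+
    then have "mset (?e ws) = mset (?e vs)" using eq \<sigma>(1) ws vs by metis
    then have cnt: "count (mset ws) v + (if parity par v = 1 then 2 * count (mset ws) (Br v v) else 0) =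
      count (mset vs) v + (if parity par v = 1 then 2 * count (mset vs) (Br v v) else 0)" if "good v" for v
      using count_expand[OF _ that, of ws par] count_expand[OF _ that, of vs par] ws vs
      unfolding sorted_M_def by (metis (no_types, lifting) mem_Collect_eq)
    have le1: "count (mset us) v \<le> 1" if "us \<in> sorted_M par" "parity par v = 1" for us v
    proof -
      have "sorted_wrt (word_rel (\<lambda>a. parity par a = 1)) us" using that by (simp add: sorted_M_def)
      then show ?thesis using that(2)
      proof (induct us)
        case (Cons a us)
        have "v \<notin> set us" if "a = v" using Cons.prems that by (auto simp: word_rel_def)
        then show ?case using Cons by (auto simp: count_eq_zero_iff)
      qed simp
    qed
    have "count (mset ws) w = count (mset vs) w" for w
    proof -
      consider "good w" "parity par w = 1" | "good w" "parity par w \<noteq> 1" |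
          v where "w = Br v v" "good v" "parity par v = 1" | "w \<notin> M_words par"
        unfolding M_words_iff by blast
      then show ?thesis
      proof cases
        case 1
        then show ?thesis using cnt[OF 1(1)] le1[OF ws 1(2)] le1[OF vs 1(2)] by presburger
      next
        case 2
        then show ?thesis using cnt[OF 2(1)] by simp
      next
        case 3
        then show ?thesis using cnt[OF 3(2)] le1[OF ws 3(3)] le1[OF vs 3(3)] by presburger
      next
        case 4
        then have "w \<notin> set ws" "w \<notin> set vs" using ws vs by (auto simp: sorted_M_def)
        then show ?thesis by (metis count_eq_zero_iff set_mset_mset)
      qed
    qed
    then have "mset ws = mset vs" by (rule multiset_eqI)
    then show "ws = vs" using ws vs
      by (intro sorted_words_unique) (auto simp: sorted_M_def intro: M_words_mulfree)
  qed
  moreover have "length (\<phi> ws) = total_deg ws" if "ws \<in> sorted_M par" for ws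
  proof -
    have "length (\<phi> ws) = total_deg (\<sigma> ws)"
      by (simp add: \<phi>_def length_concat total_deg_def comp_def length_foliage)
    also have "\<dots> = total_deg (?e ws)" using \<sigma>(1)[OF that] by (rule total_deg_mset)
    also have "\<dots> = total_deg ws"
    proof -
      have "set ws \<subseteq> M_words par" using that by (simp add: sorted_M_def)
      then show ?thesis by (induct ws) (auto simp: unsquare_def M_words_iff)
    qed
    finally show ?thesis .
  qed
  ultimately show ?thesis by blast
qed


section \<open>The free algebra as a vector space\<close>

interpretation FA: vector_space "scale :: 'k::field \<Rightarrow> ('x, 'k) free_alg \<Rightarrow> ('x, 'k) free_alg"
  by unfold_locales simp_all

lemma free_alg_eq_sum:
  "p = (\<Sum>w\<in>Poly_Mapping.keys p. scale (Poly_Mapping.lookup p w) (word w))"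
proof (rule poly_mapping_eqI)
  fix v
  show "Poly_Mapping.lookup p v = Poly_Mapping.lookup
    (\<Sum>w\<in>Poly_Mapping.keys p. scale (Poly_Mapping.lookup p w) (word w)) v"
    by (simp add: lookup_sum lookup_scale word_def lookup_single when_def in_keys_iff
        if_distrib[where f = "\<lambda>x. _ * x"] cong: if_cong)
qed

lemma free_alg_in_span: "p \<in> FA.span (word ` Poly_Mapping.keys p)"
  by (subst free_alg_eq_sum, intro FA.span_sum FA.span_scale FA.span_base imageI)

lemma free_alg_in_span_UNIV: "p \<in> FA.span (range word)"
  using free_alg_in_span[of p] FA.span_mono[of "word ` Poly_Mapping.keys p" "range word"] by blast

lemma bilinear_ext_word [simp]: "bilinear_ext f (word u) (word v) = word (f u v)"
  by (simp add: bilinear_ext_def word_def)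

lemma bilinear_ext_scale:
  "bilinear_ext f (scale c p) q = scale c (bilinear_ext f p q)"
  "bilinear_ext f p (scale c q) = scale c (bilinear_ext f p q)"
proof -
  have s: "scale c (Poly_Mapping.single u d) = Poly_Mapping.single u (c * d)" for u and d :: 'b
    by (rule poly_mapping_eqI) (simp add: lookup_scale lookup_single when_def)
  have k: "Poly_Mapping.keys (scale c p) \<subseteq> Poly_Mapping.keys p" for p :: "('a, 'b) free_alg"
    by (auto simp: in_keys_iff lookup_scale)
  show "bilinear_ext f (scale c p) q = scale c (bilinear_ext f p q)"
    by (subst bilinear_ext_superset[OF _ k _ subset_refl])
      (simp_all add: lookup_scale bilinear_ext_def FA.scale_sum_right s mult.assoc)
  show "bilinear_ext f p (scale c q) = scale c (bilinear_ext f p q)"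
    by (subst bilinear_ext_superset[OF _ subset_refl _ k])
      (simp_all add: lookup_scale bilinear_ext_def FA.scale_sum_right s mult.left_commute)
qed

lemma bilinear_ext_zero [simp]: "bilinear_ext f 0 q = 0" "bilinear_ext f p 0 = 0"
  by (simp_all add: bilinear_ext_def)

lemmas mul_simps = bilinear_ext_add_left[of Mul, folded mul_def]
  bilinear_ext_add_right[of Mul, folded mul_def] bilinear_ext_diff[of Mul, folded mul_def]
  bilinear_ext_scale[of Mul, folded mul_def] bilinear_ext_word[of Mul, folded mul_def]
  bilinear_ext_zero[of Mul, folded mul_def]

lemmas br_simps = bilinear_ext_add_left[of Br, folded br_def]
  bilinear_ext_add_right[of Br, folded br_def] bilinear_ext_diff[of Br, folded br_def]
  bilinear_ext_scale[of Br, folded br_def] bilinear_ext_word[of Br, folded br_def]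
  bilinear_ext_zero[of Br, folded br_def]

lemma subspace_br_left: "FA.subspace S \<Longrightarrow> FA.subspace {p. br p q \<in> S}"
  by (auto simp: FA.subspace_def br_simps)

lemma subspace_br_right: "FA.subspace S \<Longrightarrow> FA.subspace {q. br p q \<in> S}"
  by (auto simp: FA.subspace_def br_simps)

lemma subspace_mul_left: "FA.subspace S \<Longrightarrow> FA.subspace {p. mul p q \<in> S}"
  by (auto simp: FA.subspace_def mul_simps)

lemma subspace_mul_right: "FA.subspace S \<Longrightarrow> FA.subspace {q. mul p q \<in> S}"
  by (auto simp: FA.subspace_def mul_simps)

lemma sg_cases: "sg s = (1 :: 'k::field) \<or> sg s = (- 1 :: 'k)"
  by (simp add: sg_def)

lemma sg_simps [simp]: "sg 0 = 1" "sg 1 = - 1" "sg s * sg s = 1"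
  by (simp_all add: sg_def)


section \<open>Hall's rewriting of brackets of basis words\<close>

text \<open>The predicate \<open>P\<close> carries side information about the words that occur,
  namely a strict lower bound for their bases; without it the induction on bases could not
  proceed.\<close>

definition hall_span ::
  "('x::linorder \<Rightarrow> bit) \<Rightarrow> (nat \<Rightarrow> ('x, 'k::field) free_alg set) \<Rightarrow> nat \<Rightarrow> ('x nword \<Rightarrow> bool) \<Rightarrow>
   ('x, 'k) free_alg set" where
  "hall_span par N m P = FA.span (word ` {w \<in> M_words par. deg w = m \<and> P w} \<union> N m)"

lemma hall_span_word: "w \<in> M_words par \<Longrightarrow> deg w = m \<Longrightarrow> P w \<Longrightarrow> word w \<in> hall_span par N m P"
  unfolding hall_span_def by (intro FA.span_base) auto

lemma hall_span_N: "p \<in> N m \<Longrightarrow> p \<in> hall_span par N m P"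
  unfolding hall_span_def by (intro FA.span_base) auto

lemma subspace_hall_span: "FA.subspace (hall_span par N m P)"
  unfolding hall_span_def by simp

lemma hall_span_weaken: "p \<in> hall_span par N m P \<Longrightarrow>
    (\<And>w. w \<in> M_words par \<Longrightarrow> deg w = m \<Longrightarrow> P w \<Longrightarrow> Q w) \<Longrightarrow> p \<in> hall_span par N m Q"
  unfolding hall_span_def by (rule subsetD[OF FA.span_mono]) auto

text \<open>
  The subspace \<open>N m\<close> consists of the elements that are neglected in degree \<open>m\<close>. The bracket only
  has to satisfy the Lie identities modulo \<open>N\<close>, and only in total degree \<open>n\<close>; the locale is one
  step of an induction on \<open>n\<close>.
\<close>

locale hall_step =
  fixes par :: "'x::{finite,linorder} \<Rightarrow> bit"
    and N :: "nat \<Rightarrow> ('x, 'k::field_char_0) free_alg set"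
    and n :: nat
  assumes subN: "FA.subspace (N m)"
    and anti: "\<lbrakk>u \<in> M_words par; v \<in> M_words par; deg u + deg v = n\<rbrakk> \<Longrightarrow>
      word (Br u v) + scale (sg (parity par u * parity par v)) (word (Br v u)) \<in> N n"
    and jac: "\<lbrakk>a \<in> M_words par; b \<in> M_words par; c \<in> M_words par; deg a + deg b + deg c = n\<rbrakk> \<Longrightarrow>
      word (Br a (Br b c)) - word (Br (Br a b) c)
      - scale (sg (parity par a * parity par b)) (word (Br b (Br a c))) \<in> N n"
    and compat: "\<lbrakk>p \<in> N m; 2 \<le> m; v \<in> M_words par; m + deg v = n\<rbrakk> \<Longrightarrow> br p (word v) \<in> N n"
      "\<lbrakk>p \<in> N m; 2 \<le> m; v \<in> M_words par; m + deg v = n\<rbrakk> \<Longrightarrow> br (word v) p \<in> N n"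
    and IH: "\<lbrakk>u \<in> M_words par; v \<in> M_words par; deg u + deg v < n\<rbrakk> \<Longrightarrow>
      word (Br u v) \<in> hall_span par N (deg u + deg v) (\<lambda>_. True)"
begin

abbreviation "T m \<equiv> hall_span par N m (\<lambda>_. True)"

lemmas T_scale = FA.subspace_scale[OF subspace_hall_span[of par N n "\<lambda>_. True"]]
lemmas T_add = FA.subspace_add[OF subspace_hall_span[of par N n "\<lambda>_. True"]]
lemmas T_diff = FA.subspace_diff[OF subspace_hall_span[of par N n "\<lambda>_. True"]]

lemma T_N: "p \<in> N n \<Longrightarrow> p \<in> T n"
  by (rule hall_span_N)

lemma anti_mem:
  assumes "u \<in> M_words par" "v \<in> M_words par" "deg u + deg v = n" "word (Br v u) \<in> T n"
  shows "word (Br u v) \<in> T n"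
  using T_diff[OF T_N[OF anti[OF assms(1-3)]]
      T_scale[OF assms(4), of "sg (parity par u * parity par v)"]] by simp

lemma jac_left:
  assumes "a \<in> M_words par" "b \<in> M_words par" "c \<in> M_words par" "deg a + deg b + deg c = n"
    "word (Br a (Br b c)) \<in> T n" "word (Br b (Br a c)) \<in> T n"
  shows "word (Br (Br a b) c) \<in> T n"
  using T_diff[OF T_diff[OF assms(5) T_scale[OF assms(6), of "sg (parity par a * parity par b)"]]
      T_N[OF jac[OF assms(1-4)]]] by simp

lemma jac_right:
  assumes "a \<in> M_words par" "b \<in> M_words par" "c \<in> M_words par" "deg a + deg b + deg c = n"
    "word (Br (Br a b) c) \<in> T n" "word (Br b (Br a c)) \<in> T n"
  shows "word (Br a (Br b c)) \<in> T n"
  using T_add[OF T_add[OF T_N[OF jac[OF assms(1-4)]]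
      T_scale[OF assms(6), of "sg (parity par a * parity par b)"]] assms(5)] by simp

lemma br_hall_span:
  assumes p: "p \<in> hall_span par N m P" and v: "v \<in> M_words par" "m + deg v = n" "2 \<le> m"
  shows "(\<And>w. w \<in> M_words par \<Longrightarrow> deg w = m \<Longrightarrow> P w \<Longrightarrow> word (Br w v) \<in> T n) \<Longrightarrow> br p (word v) \<in> T n"
    and "(\<And>w. w \<in> M_words par \<Longrightarrow> deg w = m \<Longrightarrow> P w \<Longrightarrow> word (Br v w) \<in> T n) \<Longrightarrow> br (word v) p \<in> T n"
proof -
  show "br p (word v) \<in> T n"
    if *: "\<And>w. w \<in> M_words par \<Longrightarrow> deg w = m \<Longrightarrow> P w \<Longrightarrow> word (Br w v) \<in> T n"
  proof -
    have "hall_span par N m P \<subseteq> {p. br p (word v) \<in> T n}"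
      unfolding hall_span_def[of par N m P]
      by (rule FA.span_minimal[OF _ subspace_br_left[OF subspace_hall_span]])
        (use * compat(1)[OF _ v(3,1,2)] in \<open>auto simp: br_simps T_N\<close>)
    then show ?thesis using p by blast
  qed
  show "br (word v) p \<in> T n"
    if *: "\<And>w. w \<in> M_words par \<Longrightarrow> deg w = m \<Longrightarrow> P w \<Longrightarrow> word (Br v w) \<in> T n"
  proof -
    have "hall_span par N m P \<subseteq> {p. br (word v) p \<in> T n}"
      unfolding hall_span_def[of par N m P]
      by (rule FA.span_minimal[OF _ subspace_br_right[OF subspace_hall_span]])
        (use * compat(2)[OF _ v(3,1,2)] in \<open>auto simp: br_simps T_N\<close>)
    then show ?thesis using p by blast
  qed
qed

lemma deg2: "2 \<le> deg u + deg v"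
  using deg_add_gt[of u v] by linarith

lemma word_Br_Br_right:
  assumes "a \<in> M_words par" "b \<in> M_words par" "c \<in> M_words par" "deg a + deg b + deg c = n"
    "word (Br b c) \<in> hall_span par N (deg b + deg c) P"
    "\<And>w. w \<in> M_words par \<Longrightarrow> deg w = deg b + deg c \<Longrightarrow> P w \<Longrightarrow> word (Br a w) \<in> T n"
  shows "word (Br a (Br b c)) \<in> T n"
proof -
  have "deg b + deg c + deg a = n" using assms(4) by simp
  then have "br (word a) (word (Br b c)) \<in> T n"
    using assms(6) by (rule br_hall_span(2)[OF assms(5,1) _ deg2])
  then show ?thesis by (simp add: br_simps)
qed

text \<open>If the bracket is not good, then \<open>u\<close> is below the right factor of
  \<open>x\<close>, so \<open>deg u < deg x\<close>; any word of degree
  \<open>deg x + deg u\<close>, even a square after passing to its root, then has a base longer than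
  \<open>u\<close>. If it is good, it is its own base and longer than \<open>u\<close>.\<close>

lemma bracket_refined:
  assumes "good x" "good u" "u \<prec> x" "deg x + deg u < n"
  shows "word (Br x u) \<in> hall_span par N (deg x + deg u) (\<lambda>w. u \<prec> base w)"
proof (cases "good (Br x u)")
  case True
  have "u \<prec> Br x u" using assms by (intro word_less_if_deg) (auto intro: good_mulfree)
  then show ?thesis using True by (intro hall_span_word) (auto simp: good_in_M)
next
  case False
  then obtain x1 x2 where x: "x = Br x1 x2" "\<not> x2 \<preceq> u"
    using assms by (cases x) auto
  then have "u \<prec> x2"
    using word_less_total[of u x2] assms good_mulfree by auto
  have "deg x = deg x1 + deg x2" using x by simp
  then have less: "deg u < deg x" using word_less_deg[OF \<open>u \<prec> x2\<close>] deg_pos[of x1] by linarith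
  have "word (Br x u) \<in> T (deg x + deg u)"
    using assms by (intro IH good_in_M)
  then show ?thesis
  proof (rule hall_span_weaken)
    fix w assume w: "w \<in> M_words par" "deg w = deg x + deg u"
    then consider "good w" | y where "w = Br y y" "good y" by (auto simp: M_words_iff)
    then have "deg u < deg (base w)" using w less by cases auto
    then show "u \<prec> base w"
      using good_base[OF w(1)] assms(2) good_mulfree by (intro word_less_if_deg) auto
  qed
qed

text \<open>The base of a word of \<open>M\<close> has at least half its degree.\<close>

lemma base_gt_if_deg:
  assumes "w \<in> M_words par" "good z" "2 * deg z < deg w"
  shows "z \<prec> base w"
proof -
  consider "good w" | y where "w = Br y y" "good y" using assms(1) by (auto simp: M_words_iff)
  then have "deg z < deg (base w)" using assms(3) by cases auto
  then show ?thesis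
    using good_base[OF assms(1)] assms(2) good_mulfree by (intro word_less_if_deg) auto
qed

lemma square_odd: "Br v v \<in> M_words par \<Longrightarrow> parity par v = 1 \<and> good v"
  by (auto simp: M_words_iff)

lemma even_square:
  assumes "v \<in> M_words par" "deg v + deg v = n" "parity par v = 0"
  shows "word (Br v v) \<in> T n"
proof -
  have "word (Br v v) + word (Br v v) \<in> N n"
    using anti[of v v] assms by simp
  then have "scale (1 / 2) (word (Br v v) + word (Br v v)) \<in> N n"
    by (rule FA.subspace_scale[OF subN])
  moreover have "scale (1 / 2) (word (Br v v) + word (Br v v)) = (word (Br v v) :: ('x, 'k) free_alg)"
    by (rule poly_mapping_eqI) (simp add: lookup_add lookup_scale)
  ultimately show ?thesis by (simp add: T_N)
qed

text \<open>For odd \<open>y\<close> the Jacobi identity and antisymmetry add up to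
  \<open>3 {y, {y, y}}\<close>, which is therefore neglected.\<close>

lemma odd_cube:
  assumes "Br y y \<in> M_words par" "deg y + deg y + deg y = n"
  shows "word (Br y (Br y y)) \<in> T n"
proof -
  have y: "good y" "parity par y = 1" "y \<in> M_words par"
    using square_odd[OF assms(1)] by (auto simp: good_in_M)
  have "word (Br (Br y y) y) + word (Br y (Br y y)) \<in> N n"
    using anti[of "Br y y" y] assms y by simp
  moreover have "word (Br y (Br y y)) - word (Br (Br y y) y) + word (Br y (Br y y)) \<in> N n"
    using jac[of y y y] y assms by (simp add: scale_minus_one)
  ultimately have "(word (Br (Br y y) y) + word (Br y (Br y y))) +
    (word (Br y (Br y y)) - word (Br (Br y y) y) + word (Br y (Br y y))) \<in> N n"
    by (rule FA.subspace_add[OF subN])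
  then have "scale (1 / 3) ((word (Br (Br y y) y) + word (Br y (Br y y))) +
    (word (Br y (Br y y)) - word (Br (Br y y) y) + word (Br y (Br y y)))) \<in> N n"
    by (rule FA.subspace_scale[OF subN])
  moreover have "scale (1 / 3) ((word (Br (Br y y) y) + word (Br y (Br y y))) +
    (word (Br y (Br y y)) - word (Br (Br y y) y) + word (Br y (Br y y)))) =
    (word (Br y (Br y y)) :: ('x, 'k) free_alg)"
    by (rule poly_mapping_eqI) (simp add: lookup_add lookup_minus lookup_scale)
  ultimately show ?thesis by (simp add: T_N)
qed

text \<open>The induction is on the smaller of the bases of the two factors, downwards.\<close>

lemma bracket_base:
  assumes "u \<in> M_words par" "v \<in> M_words par" "deg u + deg v = n" "base u = z" "z \<preceq> base v"
  shows "word (Br u v) \<in> T n"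
  using assms
proof (induct "card {y. good y \<and> deg y \<le> n \<and> z \<prec> y}" arbitrary: z u v rule: less_induct)
  case less
  have gz: "good z" "mulfree z" using good_base[OF less.prems(1)] less.prems(4) good_mulfree by auto
  \<comment> \<open>The induction hypothesis in usable form: if both bases are above
    \<open>z\<close>, then fewer good words of degree at most \<open>n\<close> lie above the smaller
    base than above \<open>z\<close>.\<close>
  have big: "word (Br a b) \<in> T n"
    if "a \<in> M_words par" "b \<in> M_words par" "deg a + deg b = n" "z \<prec> base a" "z \<prec> base b" for a b
  proof -
    have card: "card {y. good y \<and> deg y \<le> n \<and> base w \<prec> y} < card {y. good y \<and> deg y \<le> n \<and> z \<prec> y}"
      if w: "w \<in> M_words par" "deg w \<le> n" "z \<prec> base w" for w
    proof (rule psubset_card_mono)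
      show "finite {y :: 'x nword. good y \<and> deg y \<le> n \<and> z \<prec> y}"
        by (rule finite_subset[OF _ finite_deg_le[of n]]) auto
      have "base w \<in> {y. good y \<and> deg y \<le> n \<and> z \<prec> y}"
        using w good_base deg_base_le[of w] by auto
      moreover have "{y. good y \<and> deg y \<le> n \<and> base w \<prec> y} \<subseteq> {y. good y \<and> deg y \<le> n \<and> z \<prec> y}"
        using w gz good_base[OF w(1)] word_less_trans[of z "base w"] good_mulfree by blast
      ultimately show "{y. good y \<and> deg y \<le> n \<and> base w \<prec> y} \<subset> {y. good y \<and> deg y \<le> n \<and> z \<prec> y}"
        using word_less_irrefl by blast
    qed
    have "mulfree (base a)" "mulfree (base b)" using that good_base good_mulfree by blast+
    then consider "base a \<preceq> base b" | "base b \<preceq> base a" using word_less_total by blast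
    then show ?thesis
    proof cases
      case 1
      show ?thesis
        by (rule less.hyps[OF card that(1-3) refl 1]) (use that in auto)
    next
      case 2
      show ?thesis
        by (rule anti_mem[OF that(1-3)], rule less.hyps[OF card that(2,1) _ refl 2]) (use that in auto)
    qed
  qed
  consider (gg) "good u" "good v" | (gs) y where "good u" "v = Br y y" | (sg) "u = Br z z" "good v"
    | (ss) y where "u = Br z z" "v = Br y y"
    using less.prems(1,2,4) by (auto simp: M_words_iff)
  then show ?case
  proof cases
    case gg
    then have z: "z = u" "u \<preceq> v" using less.prems(4,5) by auto
    show ?thesis
    proof (cases "u = v")
      case True
      show ?thesis
      proof (cases "parity par v = 1")
        case odd: True
        then show ?thesis using gg True less.prems(3) by (intro hall_span_word) (auto simp: M_words_iff)
      next
        case False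
        then show ?thesis using even_square[of v] less.prems True by simp
      qed
    next
      case False
      then have uv: "u \<prec> v" using z by auto
      show ?thesis
      proof (rule anti_mem[OF less.prems(1-3)], cases "good (Br v u)")
        case True
        then show "word (Br v u) \<in> T n" using less.prems(3) by (intro hall_span_word) (auto simp: good_in_M)
      next
        case bad: False
        then obtain v1 v2 where v: "v = Br v1 v2" "\<not> v2 \<preceq> u" using gg uv by (cases v) auto
        have gv: "good v1" "good v2" "v2 \<prec> v1" using gg v by auto
        then have uv2: "u \<prec> v2" using v word_less_total[of u v2] gg good_mulfree by auto
        then have uv1: "u \<prec> v1" using word_less_trans[OF _ gv(3)] gv gg good_mulfree by blast
        have M: "v1 \<in> M_words par" "v2 \<in> M_words par" "u \<in> M_words par"
          using gv gg by (auto simp: good_in_M)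
        have d: "deg v1 + deg v2 + deg u = n" using less.prems(3) v by simp
        \<comment> \<open>Here \<open>u \<prec> v2 \<prec> v1\<close>. The Jacobi identity moves
          \<open>u\<close> into an inner bracket, which \<open>bracket_refined\<close> expands into
          words with bases above \<open>u\<close>; the outer brackets then have both bases above
          \<open>u\<close> and are settled by \<open>big\<close>.\<close>
        show "word (Br v u) \<in> T n" unfolding v(1)
        proof (rule jac_left[OF M d])
          show "word (Br v1 (Br v2 u)) \<in> T n"
          proof (rule word_Br_Br_right[OF M d])
            show "word (Br v2 u) \<in> hall_span par N (deg v2 + deg u) (\<lambda>w. u \<prec> base w)"
              using gv gg uv2 d deg_pos[of v1] by (intro bracket_refined) linarith+
            show "word (Br v1 w) \<in> T n" if "w \<in> M_words par" "deg w = deg v2 + deg u" "u \<prec> base w" for w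
              using that M d uv1 gv z by (intro big) auto
          qed
          show "word (Br v2 (Br v1 u)) \<in> T n"
          proof (rule word_Br_Br_right[OF M(2,1,3)])
            show "word (Br v1 u) \<in> hall_span par N (deg v1 + deg u) (\<lambda>w. u \<prec> base w)"
              using gv gg uv1 d deg_pos[of v2] by (intro bracket_refined) linarith+
            show "word (Br v2 w) \<in> T n" if "w \<in> M_words par" "deg w = deg v1 + deg u" "u \<prec> base w" for w
              using that M d uv2 gv z by (intro big) auto
          qed (use d in simp)
        qed
      qed
    qed
  next
    case gs
    have zu: "z = u" using less.prems(4) gs(1) by simp
    have uy: "u \<preceq> y" using less.prems(5) gs(2) zu by simp
    have "parity par y = 1 \<and> good y" by (rule square_odd) (use less.prems(2) gs(2) in simp)
    then have y: "good y" "y \<in> M_words par" by (simp_all add: good_in_M)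
    have d: "deg u + deg y + deg y = n" using less.prems(3) gs by simp
    show ?thesis
    proof (cases "u = y")
      case True
      then show ?thesis using odd_cube[of y] less.prems(2) d gs by simp
    next
      case False
      then have uy: "u \<prec> y" using uy by blast
      have M: "y \<in> M_words par" "y \<in> M_words par" "u \<in> M_words par" using y less.prems(1) by auto
      have d': "deg y + deg y + deg u = n" using d by simp
      \<comment> \<open>In the Jacobi identity for \<open>{{y, y}, u}\<close> both nested brackets
        are equal to this one.\<close>
      have "word (Br y (Br y u)) \<in> T n"
      proof (rule word_Br_Br_right[OF M d'])
        show "word (Br y u) \<in> hall_span par N (deg y + deg u) (\<lambda>w. u \<prec> base w)"
          using y gs uy d deg_pos[of y] by (intro bracket_refined) linarith+
        show "word (Br y w) \<in> T n" if "w \<in> M_words par" "deg w = deg y + deg u" "u \<prec> base w" for w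
          using that M d uy y zu by (intro big) auto
      qed
      then have "word (Br v u) \<in> T n" unfolding gs(2) using jac_left[OF M d'] by blast
      then show ?thesis by (rule anti_mem[OF less.prems(1-3)])
    qed
  next
    case sg
    have z: "z \<preceq> v" using less.prems(5) sg by simp
    have odd: "z \<in> M_words par" using gz good_in_M by blast
    have d: "deg z + deg z + deg v = n" using less.prems(3) sg by simp
    show ?thesis
    proof (rule anti_mem[OF less.prems(1-3)])
      show "word (Br v u) \<in> T n"
      proof (cases "v = z")
        case True
        then show ?thesis using odd_cube[of z] less.prems(1) sg d by simp
      next
        case False
        then have zv: "z \<prec> v" using z by auto
        show ?thesis
        proof (cases "good (Br v z)")
          case True
          have deg: "deg z < deg (Br v z)" by simp
          \<comment> \<open>Expanding \<open>{v, {z, z}}\<close> leaves \<open>z\<close> as an outer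
            factor, so \<open>big\<close> is of no help. But \<open>{{v, z}, z}\<close> is already
            good, its inner right factor being \<open>z\<close> again.\<close>
          have good: "good (Br (Br v z) z)"
            using True gz deg by (auto intro!: word_less_if_deg good_mulfree)
          have T1: "word (Br (Br v z) z) \<in> T n"
            using good d by (intro hall_span_word) (auto simp: good_in_M)
          have T2: "word (Br z (Br v z)) \<in> T n"
            by (rule anti_mem[OF odd good_in_M[OF True] _ T1]) (use d in simp)
          show ?thesis unfolding sg(1)
            by (rule jac_right[OF less.prems(2) odd odd _ T1 T2]) (use d in simp)
        next
          case bad: False
          then obtain v1 v2 where v: "v = Br v1 v2" "\<not> v2 \<preceq> z" using sg gz zv by (cases v) auto
          have gv: "good v1" "good v2" "v2 \<prec> v1" using sg v by auto
          then have zv2: "z \<prec> v2" using v word_less_total[of z v2] gz good_mulfree by auto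
          then have zv1: "z \<prec> v1" using word_less_trans[OF _ gv(3)] gv gz good_mulfree by blast
          have M: "v1 \<in> M_words par" "v2 \<in> M_words par" "u \<in> M_words par"
            using gv less.prems(1) by (auto simp: good_in_M)
          have d': "deg v1 + deg v2 + deg u = n" using less.prems(3) v by simp
          have du: "deg u = deg z + deg z" using sg by simp
          \<comment> \<open>Since \<open>u\<close> alone has degree \<open>2 * deg z\<close>, every
            inner bracket has larger degree, and \<open>base_gt_if_deg\<close> replaces the refined
            expansion.\<close>
          show ?thesis unfolding v(1)
          proof (rule jac_left[OF M d'])
            show "word (Br v1 (Br v2 u)) \<in> T n"
            proof (rule word_Br_Br_right[OF M d'])
              show "word (Br v2 u) \<in> T (deg v2 + deg u)"
                using M d' deg_pos[of v1] by (intro IH) linarith+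
              show "word (Br v1 w) \<in> T n" if "w \<in> M_words par" "deg w = deg v2 + deg u" for w
                using that M d' zv1 gv gz du deg_pos[of v2] base_gt_if_deg[of w z] by (intro big) auto
            qed
            show "word (Br v2 (Br v1 u)) \<in> T n"
            proof (rule word_Br_Br_right[OF M(2,1,3)])
              show "word (Br v1 u) \<in> T (deg v1 + deg u)"
                using M d' deg_pos[of v2] by (intro IH) linarith+
              show "word (Br v2 w) \<in> T n" if "w \<in> M_words par" "deg w = deg v1 + deg u" for w
                using that M d' zv2 gv gz du deg_pos[of v1] base_gt_if_deg[of w z] by (intro big) auto
            qed (use d' in simp)
          qed
        qed
      qed
    qed
  next
    case ss
    have zy: "z \<preceq> y" using less.prems(5) ss by simp
    have "parity par y = 1 \<and> good y" by (rule square_odd) (use less.prems(2) ss(2) in simp)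
    then have y: "good y" "y \<in> M_words par" by (simp_all add: good_in_M)
    have d: "deg y + deg y + deg u = n" using less.prems(3) ss by simp
    show ?thesis
    proof (cases "z = y")
      case True
      then show ?thesis using even_square[of v] less.prems(2,3) ss by simp
    next
      case False
      then have zy: "z \<prec> y" using zy by auto
      have M: "y \<in> M_words par" "y \<in> M_words par" "u \<in> M_words par" using y less.prems(1) by auto
      have du: "deg u = deg z + deg z" using ss by simp
      have "word (Br y (Br y u)) \<in> T n"
      proof (rule word_Br_Br_right[OF M d])
        show "word (Br y u) \<in> T (deg y + deg u)"
          using M d deg_pos[of y] by (intro IH) linarith+
        show "word (Br y w) \<in> T n" if "w \<in> M_words par" "deg w = deg y + deg u" for w
          using that M d zy y gz du deg_pos[of y] base_gt_if_deg[of w z] by (intro big) auto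
      qed
      then have "word (Br v u) \<in> T n" unfolding ss(2) using jac_left[OF M d] by blast
      then show ?thesis by (rule anti_mem[OF less.prems(1-3)])
    qed
  qed
qed

theorem bracket_in_hall_span:
  assumes "u \<in> M_words par" "v \<in> M_words par" "deg u + deg v = n"
  shows "word (Br u v) \<in> T n"
proof -
  have "mulfree (base u)" "mulfree (base v)" using assms good_base good_mulfree by blast+
  then consider "base u \<preceq> base v" | "base v \<preceq> base u" using word_less_total by blast
  then show ?thesis
  proof cases
    case 1
    then show ?thesis by (rule bracket_base[OF assms refl])
  next
    case 2
    then have "word (Br v u) \<in> T n"
      using assms by (intro bracket_base[of v u "base v"]) auto
    then show ?thesis by (rule anti_mem[OF assms])
  qed
qed

end


section \<open>The ordered monomials span\<close>

lemma word_homogeneous [simp]: "word w \<in> homogeneous par (parity par w)"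
  by (simp add: homogeneous_def word_def)

definition prod_word :: "'x nword list \<Rightarrow> 'x nword" where
  "prod_word ws = foldr Mul ws One"

lemma prod_word_simps [simp]:
  "prod_word [] = One" "prod_word (w # ws) = Mul w (prod_word ws)"
  by (simp_all add: prod_word_def)

lemma ideal_unit: "word (Mul One w) - word w \<in> JB_ideal par"
  using JB_ideal.rel[OF JB_relations.unit[of "word w" par]] by (simp add: mul_simps)

lemma ideal_assoc: "word (Mul (Mul a b) c) - word (Mul a (Mul b c)) \<in> JB_ideal par"
  using JB_ideal.rel[OF JB_relations.assoc[of "word a" "word b" "word c" par]] by (simp add: mul_simps)

lemma ideal_comm:
  "word (Mul a b) - scale (sg (parity par a * parity par b)) (word (Mul b a)) \<in> JB_ideal par"
  using JB_ideal.rel[OF JB_relations.supercomm[of "word a" par "parity par a" "word b" "parity par b"]]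
  by (simp add: mul_simps)

lemma ideal_anti:
  "word (Br a b) + scale (sg (parity par a * parity par b)) (word (Br b a)) \<in> JB_ideal par"
  using JB_ideal.rel[OF JB_relations.superanticomm[of "word a" par "parity par a" "word b" "parity par b"]]
  by (simp add: br_simps)

lemma ideal_leibniz:
  "word (Br a (Mul b c)) - (word (Mul (Br a b) c)
    + scale (sg (parity par a * parity par b)) (word (Mul b (Br a c)))
    - word (Mul (Mul (Br a One) b) c)) \<in> JB_ideal par"
  using JB_ideal.rel[OF JB_relations.leibniz[of "word a" par "parity par a" "word b" "parity par b"
    "word c" "parity par c"]]
  by (simp add: br_simps mul_simps D_op_def)

lemma ideal_jacobi:
  fixes par a b c
  defines "s \<equiv> parity par a" and "t \<equiv> parity par b" and "r \<equiv> parity par c"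
  shows "word (Br a (Br b c)) - (word (Br (Br a b) c) + scale (sg (s * t)) (word (Br b (Br a c)))
    + word (Mul (Br a One) (Br b c))
    + scale (sg (s * (t + r))) (word (Mul (Br b One) (Br c a)))
    + scale (sg (r * (s + t))) (word (Mul (Br c One) (Br a b)))) \<in> JB_ideal par"
  using JB_ideal.rel[OF JB_relations.jacobi[of "word a" par s "word b" t "word c" r]]
  by (simp add: br_simps mul_simps D_op_def s_def t_def r_def)

lemma ideal_mul_left:
  "(word u - word v :: ('x, 'k::field) free_alg) \<in> JB_ideal par \<Longrightarrow>
    (word (Mul w u) - word (Mul w v) :: ('x, 'k) free_alg) \<in> JB_ideal par"
  using JB_ideal.mul_left[of "word u - word v" par "word w"] by (simp add: mul_simps)

lemma ideal_mul_right:
  "(word u - word v :: ('x, 'k::field) free_alg) \<in> JB_ideal par \<Longrightarrow>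
    (word (Mul u w) - word (Mul v w) :: ('x, 'k) free_alg) \<in> JB_ideal par"
  using JB_ideal.mul_right[of "word u - word v" par "word w"] by (simp add: mul_simps)

lemma ideal_trans: "p - q \<in> JB_ideal par \<Longrightarrow> q - r \<in> JB_ideal par \<Longrightarrow> p - r \<in> JB_ideal par"
  using JB_ideal.add[of "p - q" par "q - r"] by simp

lemma ideal_sym: "p - q \<in> JB_ideal par \<Longrightarrow> q - p \<in> JB_ideal par"
  using JB_ideal_uminus[of "p - q" par] by simp

lemma ideal_unit_right: "word (Mul w One) - word w \<in> JB_ideal par"
  using ideal_trans[OF _ ideal_unit] ideal_comm[of w One par] by simp

lemma ideal_prod_append:
  "word (Mul (prod_word vs) (prod_word ws)) - word (prod_word (vs @ ws)) \<in> JB_ideal par"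
proof (induct vs)
  case Nil
  then show ?case by (simp add: ideal_unit)
next
  case (Cons v vs)
  then show ?case using ideal_trans[OF ideal_assoc ideal_mul_left[OF Cons]] by simp
qed

text \<open>The preimage in \<open>D_X\<close> of the unital subalgebra of \<open>JB\<close> that
  \<open>A\<close> generates under the product.\<close>

definition poly_span :: "('x \<Rightarrow> bit) \<Rightarrow> 'x nword set \<Rightarrow> ('x, 'k::field) free_alg set" where
  "poly_span par A = FA.span (JB_ideal par \<union> {word (prod_word ws) | ws. set ws \<subseteq> A})"

lemma subspace_poly_span [simp]: "FA.subspace (poly_span par A)"
  by (simp add: poly_span_def)

lemma poly_span_ideal: "p \<in> JB_ideal par \<Longrightarrow> p \<in> poly_span par A"
  unfolding poly_span_def by (intro FA.span_base) simp

lemma poly_span_prod: "set ws \<subseteq> A \<Longrightarrow> word (prod_word ws) \<in> poly_span par A"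
  unfolding poly_span_def by (intro FA.span_base) blast

lemma poly_span_mono: "A \<subseteq> B \<Longrightarrow> poly_span par A \<subseteq> poly_span par B"
  unfolding poly_span_def by (intro FA.span_mono) blast

lemma poly_span_cong:
  assumes "p - q \<in> JB_ideal par" "q \<in> poly_span par A" shows "p \<in> poly_span par A"
  using FA.subspace_add[OF subspace_poly_span poly_span_ideal[OF assms(1)] assms(2)] by simp

lemma poly_span_One: "word One \<in> poly_span par A"
  using poly_span_prod[of "[]" A par] by simp

lemma poly_span_word:
  assumes "w \<in> A" shows "word w \<in> poly_span par A"
proof -
  have "word (Mul w One) \<in> poly_span par A" using poly_span_prod[of "[w]" A par] assms by simp
  then show ?thesis by (rule poly_span_cong[OF ideal_sym[OF ideal_unit_right]])
qed

lemma poly_span_induct: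
  assumes "p \<in> poly_span par A" "FA.subspace S" "JB_ideal par \<subseteq> S"
    "\<And>ws. set ws \<subseteq> A \<Longrightarrow> word (prod_word ws) \<in> S"
  shows "p \<in> S"
  using FA.span_minimal[of "JB_ideal par \<union> {word (prod_word ws) | ws. set ws \<subseteq> A}" S] assms
  unfolding poly_span_def by blast

lemma poly_span_mul:
  assumes p: "p \<in> poly_span par A" and q: "q \<in> poly_span par A"
  shows "mul p q \<in> poly_span par A"
proof -
  have 1: "mul (word (prod_word ws)) q \<in> poly_span par A" if ws: "set ws \<subseteq> A" for ws
  proof -
    have "q \<in> {q. mul (word (prod_word ws)) q \<in> poly_span par A}"
    proof (rule poly_span_induct[OF q subspace_mul_right[OF subspace_poly_span]])
      fix vs assume "set vs \<subseteq> A"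
      then have "word (prod_word (ws @ vs)) \<in> poly_span par A" using ws by (intro poly_span_prod) simp
      then show "word (prod_word vs) \<in> {q. mul (word (prod_word ws)) q \<in> poly_span par A}"
        using poly_span_cong[OF ideal_prod_append] by (simp add: mul_simps)
    qed (auto intro: poly_span_ideal JB_ideal.mul_left)
    then show ?thesis by simp
  qed
  have "p \<in> {p. mul p q \<in> poly_span par A}"
    by (rule poly_span_induct[OF p subspace_mul_left[OF subspace_poly_span]])
      (auto intro: poly_span_ideal JB_ideal.mul_right 1)
  then show ?thesis by simp
qed

lemma poly_span_Mul:
  "(word u :: ('x, 'k::field) free_alg) \<in> poly_span par A \<Longrightarrow> (word v :: ('x, 'k) free_alg) \<in> poly_span par A \<Longrightarrow>
    (word (Mul u v) :: ('x, 'k) free_alg) \<in> poly_span par A"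
  using poly_span_mul[of "word u" par A "word v"] by (simp add: mul_simps)

lemmas poly_span_closed = FA.subspace_add[OF subspace_poly_span]
  FA.subspace_diff[OF subspace_poly_span] FA.subspace_scale[OF subspace_poly_span]

lemma poly_span_anti:
  assumes "(word (Br b a) :: ('x, 'k::field) free_alg) \<in> poly_span par A"
  shows "(word (Br a b) :: ('x, 'k) free_alg) \<in> poly_span par A"
proof (rule poly_span_cong)
  show "word (Br a b) - (- scale (sg (parity par a * parity par b)) (word (Br b a) :: ('x, 'k) free_alg)) \<in> JB_ideal par"
    using ideal_anti[of a b par] by simp
  show "- scale (sg (parity par a * parity par b)) (word (Br b a) :: ('x, 'k) free_alg) \<in> poly_span par A"
    using assms by (intro FA.subspace_neg[OF subspace_poly_span] poly_span_closed)
qed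

lemma poly_span_leibniz:
  fixes A par
  defines "S \<equiv> poly_span par A :: ('x, 'k::field) free_alg set"
  assumes "word b \<in> S" "word c \<in> S" "word (Br a b) \<in> S" "word (Br a c) \<in> S" "word (Br a One) \<in> S"
  shows "word (Br a (Mul b c)) \<in> S"
  unfolding S_def
  by (rule poly_span_cong[OF ideal_leibniz]) (intro poly_span_closed poly_span_Mul assms(2-)[unfolded S_def])

lemma poly_span_Br_prod:
  fixes A par
  defines "S \<equiv> poly_span par A :: ('x, 'k::field) free_alg set"
  assumes "\<And>u. u \<in> set ws \<Longrightarrow> word u \<in> S \<and> word (Br a u) \<in> S" "word (Br a One) \<in> S"
  shows "word (Br a (prod_word ws)) \<in> S"
proof -
  have "word (prod_word ws) \<in> S \<and> word (Br a (prod_word ws)) \<in> S"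
    using assms(2)
  proof (induct ws)
    case Nil
    then show ?case using assms(3) by (simp add: poly_span_One S_def)
  next
    case (Cons u ws)
    then show ?case unfolding S_def by (auto intro!: poly_span_Mul poly_span_leibniz assms(3)[unfolded S_def])
  qed
  then show ?thesis ..
qed

lemma hall_span_poly_span:
  fixes par :: "'x::linorder \<Rightarrow> bit" and p :: "('x, 'k::field) free_alg"
  assumes "p \<in> hall_span par (\<lambda>m. poly_span par {w \<in> M_words par. deg w < m}) m (\<lambda>_. True)" "m < n"
  shows "p \<in> poly_span par {w \<in> M_words par. deg w < n}"
proof -
  have mono: "poly_span par {w \<in> M_words par. deg w < m}
      \<subseteq> (poly_span par {w \<in> M_words par. deg w < n} :: ('x, 'k) free_alg set)"
    using assms(2) by (intro poly_span_mono) auto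
  have "hall_span par (\<lambda>m. poly_span par {w \<in> M_words par. deg w < m}) m (\<lambda>_. True)
      \<subseteq> (poly_span par {w \<in> M_words par. deg w < n} :: ('x, 'k) free_alg set)"
    unfolding hall_span_def using mono assms(2)
    by (intro FA.span_minimal) (auto intro!: poly_span_word)
  then show ?thesis using assms(1) by blast
qed

lemma bracket_poly_span:
  fixes par :: "'x::{finite,linorder} \<Rightarrow> bit"
  assumes "u \<in> M_words par" "v \<in> M_words par" "deg u + deg v = n"
  shows "(word (Br u v) :: ('x, 'k::field_char_0) free_alg) \<in>
    hall_span par (\<lambda>m. poly_span par {w \<in> M_words par. deg w < m}) n (\<lambda>_. True)"
  using assms
proof (induct n arbitrary: u v rule: less_induct)
  case (less n)
  let ?W = "\<lambda>m. poly_span par {w \<in> M_words par. deg w < m} :: ('x, 'k) free_alg set"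
  have IH: "word (Br a b) \<in> ?W m"
    if "a \<in> M_words par" "b \<in> M_words par" "deg a + deg b < n" "deg a + deg b < m" for a b m
    using hall_span_poly_span[OF less.hyps[OF that(3,1,2) refl] that(4)] .
  have One: "One \<in> M_words par" by (simp add: M_words_iff)
  have compat: "word (Br v (prod_word ws)) \<in> ?W n"
    if "2 \<le> m" "v \<in> M_words par" "m + deg v = n" "set ws \<subseteq> {w \<in> M_words par. deg w < m}" for m v ws
  proof (rule poly_span_Br_prod)
    \<comment> \<open>The Leibniz rule produces \<open>D(v) = {v, 1}\<close>. Its degree
      \<open>deg v + 1\<close> is below \<open>n = m + deg v\<close> exactly because
      \<open>2 \<le> m\<close>, which is why \<open>hall_step\<close> asks for compatibility only
      from degree 2 on.\<close>
    show "word (Br v One) \<in> ?W n" using that One by (intro IH) auto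
    show "word u \<in> ?W n \<and> word (Br v u) \<in> ?W n" if "u \<in> set ws" for u
      using that \<open>2 \<le> m\<close> \<open>v \<in> M_words par\<close> \<open>m + deg v = n\<close> \<open>set ws \<subseteq> _\<close>
      by (intro conjI poly_span_word IH) auto
  qed
  interpret hall_step par ?W n
  proof
    show "FA.subspace (?W m)" for m by simp
    show "word (Br a b) + scale (sg (parity par a * parity par b)) (word (Br b a)) \<in> ?W n" for a b
      by (intro poly_span_ideal ideal_anti)
    show "word (Br a b) \<in> hall_span par ?W (deg a + deg b) (\<lambda>_. True)"
      if "a \<in> M_words par" "b \<in> M_words par" "deg a + deg b < n" for a b
      using less.hyps[OF that(3,1,2) refl] .
    show "word (Br a (Br b c)) - word (Br (Br a b) c)
        - scale (sg (parity par a * parity par b)) (word (Br b (Br a c))) \<in> ?W n"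
      if M: "a \<in> M_words par" "b \<in> M_words par" "c \<in> M_words par" and d: "deg a + deg b + deg c = n" for a b c
    proof -
      \<comment> \<open>Both factors have degree below \<open>n\<close>: the first since
        \<open>y\<close> and \<open>z\<close> together have degree at least 2, the second since
        \<open>x\<close> has degree at least 1.\<close>
      have D: "word (Mul (Br x One) (Br y z)) \<in> ?W n"
        if "x \<in> M_words par" "y \<in> M_words par" "z \<in> M_words par" "deg x + deg y + deg z = n" for x y z
        using that One deg_pos[of x] deg_pos[of y] deg_pos[of z]
        by (intro poly_span_Mul IH) (simp_all del: deg_pos)
      let ?X = "word (Mul (Br a One) (Br b c))
        + scale (sg (parity par a * (parity par b + parity par c))) (word (Mul (Br b One) (Br c a)))
        + scale (sg (parity par c * (parity par a + parity par b))) (word (Mul (Br c One) (Br a b))) :: ('x, 'k) free_alg"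
      have "?X \<in> ?W n" using M d by (intro poly_span_closed D) auto
      moreover have "word (Br a (Br b c)) - word (Br (Br a b) c)
        - scale (sg (parity par a * parity par b)) (word (Br b (Br a c))) - ?X \<in> JB_ideal par"
        using ideal_jacobi[of a b c par] by (simp add: algebra_simps)
      ultimately show ?thesis by (rule poly_span_cong[rotated])
    qed
    fix p m v assume p: "p \<in> ?W m" and m: "2 \<le> m" "v \<in> M_words par" "m + deg v = n"
    have "p \<in> {p. br p (word v) \<in> ?W n}"
      by (rule poly_span_induct[OF p subspace_br_left[OF subspace_poly_span]])
        (use compat[OF m] in \<open>auto intro: poly_span_ideal JB_ideal.br_right poly_span_anti simp: br_simps\<close>)
    then show "br p (word v) \<in> ?W n" by simp
    have "p \<in> {p. br (word v) p \<in> ?W n}"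
      by (rule poly_span_induct[OF p subspace_br_right[OF subspace_poly_span]])
        (use compat[OF m] in \<open>auto intro: poly_span_ideal JB_ideal.br_left simp: br_simps\<close>)
    then show "br (word v) p \<in> ?W n" by simp
  qed
  show ?case using less.prems by (rule bracket_in_hall_span)
qed

text \<open>The span contains the letters and is closed under both operations; a bracket of two
  products is reduced to brackets of words by the Leibniz rule in each argument.\<close>

lemma poly_span_M_UNIV:
  fixes par :: "'x::{finite,linorder} \<Rightarrow> bit"
  shows "(p :: ('x, 'k::field_char_0) free_alg) \<in> poly_span par (M_words par)"
proof -
  let ?W = "poly_span par (M_words par) :: ('x, 'k) free_alg set"
  have One: "One \<in> M_words par" by (simp add: M_words_iff)
  have 0: "word (Br u v) \<in> ?W" if "u \<in> M_words par" "v \<in> M_words par" for u v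
    using hall_span_poly_span[OF bracket_poly_span[OF that refl] lessI]
      poly_span_mono[of "{w \<in> M_words par. deg w < Suc (deg u + deg v)}" "M_words par" par] by blast
  have 1: "word (Br u (prod_word ws)) \<in> ?W" if "u \<in> M_words par" "set ws \<subseteq> M_words par" for u ws
    using that One by (intro poly_span_Br_prod) (auto intro: poly_span_word 0)
  have 2: "word (Br (prod_word vs) (prod_word ws)) \<in> ?W" if "set vs \<subseteq> M_words par" "set ws \<subseteq> M_words par" for vs ws
    using that One by (intro poly_span_Br_prod) (auto intro: poly_span_word poly_span_anti 1)
  have br: "br p q \<in> ?W" if p: "p \<in> ?W" and q: "q \<in> ?W" for p q
  proof -
    have "q \<in> {q. br (word (prod_word ws)) q \<in> ?W}" if "set ws \<subseteq> M_words par" for ws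
      by (rule poly_span_induct[OF q subspace_br_right[OF subspace_poly_span]])
        (auto intro: poly_span_ideal JB_ideal.br_left 2[OF that] simp: br_simps)
    then have "p \<in> {p. br p q \<in> ?W}"
      by (intro poly_span_induct[OF p subspace_br_left[OF subspace_poly_span]])
        (auto intro: poly_span_ideal JB_ideal.br_right)
    then show ?thesis by simp
  qed
  have "word w \<in> ?W" for w
  proof (induct w)
    case One
    then show ?case by (rule poly_span_One)
  next
    case (Gen x)
    then show ?case by (intro poly_span_word) (simp add: M_words_iff)
  next
    case (Mul u v)
    then show ?case by (rule poly_span_Mul)
  next
    case (Br u v)
    then show ?case using br[of "word u" "word v"] by (simp add: br_simps)
  qed
  then have "FA.span (range word) \<subseteq> ?W" by (intro FA.span_minimal) auto
  then show ?thesis using free_alg_in_span_UNIV by blast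
qed

section \<open>Sorting products modulo the ideal\<close>

lemma ideal_prod_prefix:
  assumes "word (prod_word vs) - scale c (word (prod_word ws)) \<in> JB_ideal par"
  shows "word (prod_word (us @ vs)) - scale c (word (prod_word (us @ ws))) \<in> JB_ideal par"
proof (induct us)
  case (Cons u us)
  then show ?case
    using JB_ideal.mul_left[OF Cons, of "word u"] by (simp add: mul_simps)
qed (use assms in simp)

lemma ideal_swap:
  "word (prod_word (us @ a # b # vs)) - scale (sg (parity par a * parity par b)) (word (prod_word (us @ b # a # vs)))
    \<in> JB_ideal par"
proof (rule ideal_prod_prefix)
  let ?s = "sg (parity par a * parity par b)" and ?P = "word (prod_word vs)"
  have "word (Mul (Mul a b) (prod_word vs)) - scale ?s (word (Mul (Mul b a) (prod_word vs))) \<in> JB_ideal par"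
    using JB_ideal.mul_right[OF ideal_comm[of a b par], of ?P] by (simp add: mul_simps)
  moreover have "word (Mul a (Mul b (prod_word vs))) - word (Mul (Mul a b) (prod_word vs)) \<in> JB_ideal par"
    by (rule ideal_sym[OF ideal_assoc])
  moreover have "scale ?s (word (Mul (Mul b a) (prod_word vs))) - scale ?s (word (Mul b (Mul a (prod_word vs)))) \<in> JB_ideal par"
    using JB_ideal.scale[OF ideal_assoc[of b a "prod_word vs" par], of ?s] by simp
  ultimately show "word (prod_word (a # b # vs)) - scale ?s (word (prod_word (b # a # vs))) \<in> JB_ideal par"
    unfolding prod_word_simps by (meson ideal_trans)
qed

lemma prod_word_sorted:
  fixes par :: "'x::linorder \<Rightarrow> bit"
  assumes "set ws \<subseteq> M_words par"
  shows "(word (prod_word ws) :: ('x, 'k::field_char_0) free_alg) \<in>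
    FA.span (JB_ideal par \<union> (\<lambda>ws. word (prod_word ws)) ` sorted_M par)"
proof -
  let ?f = "\<lambda>ws. word (prod_word ws) :: ('x, 'k) free_alg" and ?I = "JB_ideal par :: ('x, 'k) free_alg set"
  let ?S = "FA.span (?I \<union> (\<lambda>ws. word (prod_word ws)) ` sorted_M par)"
  have "?f ws \<in> ?I \<or> (\<exists>vs\<in>sorted_M par. mset vs = mset ws \<and> (?f ws - ?f vs \<in> ?I \<or> ?f ws + ?f vs \<in> ?I))"
  proof (rule sort_M_words)
    show "?f (xs @ a # b # ys) - ?f (xs @ b # a # ys) \<in> ?I \<or> ?f (xs @ a # b # ys) + ?f (xs @ b # a # ys) \<in> ?I"
      for xs ys a b
    proof -
      obtain s :: 'k where "s = 1 \<or> s = - 1" "?f (xs @ a # b # ys) - scale s (?f (xs @ b # a # ys)) \<in> ?I"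
        using ideal_swap[of xs a b ys par] sg_cases by blast
      then show ?thesis by (auto simp: scale_minus_one)
    qed
    show "?f (xs @ a # a # ys) \<in> ?I" if "parity par a = 1" for xs ys a
    proof -
      have "?f (xs @ a # a # ys) + ?f (xs @ a # a # ys) \<in> ?I"
        using ideal_swap[of xs a a ys par] that by (simp add: scale_minus_one)
      then have "scale (1 / 2) (?f (xs @ a # a # ys) + ?f (xs @ a # a # ys)) \<in> ?I"
        by (rule JB_ideal.scale)
      moreover have "scale (1 / 2) (p + p) = p" for p :: "('x, 'k) free_alg"
        by (rule poly_mapping_eqI) (simp add: lookup_add lookup_scale)
      ultimately show ?thesis by simp
    qed
  qed (use assms in \<open>auto intro: JB_ideal.zero JB_ideal.add JB_ideal_uminus\<close>)
  then show ?thesis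
  proof (elim disjE bexE conjE)
    assume "?f ws \<in> ?I" then show ?thesis by (intro FA.span_base) simp
  next
    fix vs assume "vs \<in> sorted_M par"
    then have v: "?f vs \<in> ?S" by (intro FA.span_base) blast
    {
      assume "?f ws - ?f vs \<in> ?I"
      then have "?f ws - ?f vs \<in> ?S" by (intro FA.span_base) simp
      from FA.span_add[OF this v] show ?thesis by simp
    next
      assume "?f ws + ?f vs \<in> ?I"
      then have "?f ws + ?f vs \<in> ?S" by (intro FA.span_base) simp
      from FA.span_diff[OF this v] show ?thesis by simp
    }
  qed
qed

section \<open>From sorted lists to monomials with exponents\<close>

lemma ideal_drop_One:
  "word (prod_word ws) - word (prod_word (filter (\<lambda>w. w \<noteq> One) ws)) \<in> JB_ideal par"
proof (induct ws)
  case (Cons w ws)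
  then show ?case using ideal_mul_left[OF Cons, of w] ideal_trans[OF ideal_unit Cons] by auto
qed (simp add: JB_ideal.zero)

text \<open>Flattening identifies \<open>monomial_exponents\<close> with the lists in
  \<open>sorted_M\<close> that avoid \<open>One\<close>: see \<open>expand_sorted\<close>,
  \<open>inj_expand\<close> and \<open>expand_surj\<close>. The arguments work with such lists and
  return to exponents only at the end.\<close>

definition expand :: "('x nword \<times> nat) list \<Rightarrow> 'x nword list" where
  "expand es = concat (map (\<lambda>(e, k). replicate k e) es)"

lemma expand_simps [simp]: "expand [] = []" "expand ((e, k) # es) = replicate k e @ expand es"
  by (simp_all add: expand_def)

lemma set_expand: "w \<in> set (expand es) \<Longrightarrow> w \<in> fst ` set es"
  by (force simp: expand_def split: if_splits)

lemma monomial_exponents_Cons: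
  fixes par :: "'x::linorder \<Rightarrow> bit"
  shows "(e, k) # es \<in> monomial_exponents par \<longleftrightarrow>
    e \<in> M_words par \<and> e \<noteq> One \<and> 1 \<le> k \<and> (parity par e = 1 \<longrightarrow> k = 1) \<and>
    (\<forall>f\<in>fst ` set es. e \<prec> f) \<and> es \<in> monomial_exponents par"
proof -
  have "fst (hd es) \<noteq> One" if "e \<prec> fst (hd es)" "mulfree e" "e \<noteq> One"
    using that One_least[of e] word_less_trans[of One e One] by auto
  then show ?thesis by (cases es) (auto simp: monomial_exponents_def M_words_mulfree)
qed

lemma expand_sorted:
  fixes par :: "'x::linorder \<Rightarrow> bit"
  assumes "es \<in> monomial_exponents par"
  shows "expand es \<in> sorted_M par" "One \<notin> set (expand es)"
proof -
  have "expand es \<in> sorted_M par \<and> One \<notin> set (expand es)" using assms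
  proof (induct es)
    case (Cons p es)
    obtain e k where p: "p = (e, k)" by (cases p)
    have e: "e \<in> M_words par" "e \<noteq> One" "parity par e = 1 \<longrightarrow> k = 1" "\<forall>f\<in>fst ` set es. e \<prec> f"
      "es \<in> monomial_exponents par"
      using Cons.prems unfolding p monomial_exponents_Cons by auto
    have "sorted_wrt (word_rel (\<lambda>a. parity par a = 1)) (replicate k e)"
      using e(3) by (cases "parity par e = 1") (auto simp: sorted_wrt_iff_nth_less word_rel_def)
    then show ?case using Cons.hyps[OF e(5)] e set_expand[of _ es] unfolding p
      by (auto simp: sorted_M_def sorted_wrt_append word_rel_def)
  qed (simp add: sorted_M_def)
  then show "expand es \<in> sorted_M par" "One \<notin> set (expand es)" by auto
qed

lemma inj_expand: "inj_on expand (monomial_exponents (par :: 'x::linorder \<Rightarrow> bit))"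
proof (rule inj_onI)
  fix es fs assume "es \<in> monomial_exponents par" "fs \<in> monomial_exponents par" "expand es = expand fs"
  then show "es = fs"
  proof (induct es arbitrary: fs)
    case Nil
    then show ?case by (cases fs) (auto simp: monomial_exponents_Cons)
  next
    case (Cons p es)
    obtain e k where p: "p = (e, k)" by (cases p)
    obtain f l gs where fs: "fs = (f, l) # gs"
      using Cons.prems unfolding p by (cases fs) (auto simp: monomial_exponents_Cons)
    have k: "1 \<le> k" "1 \<le> l" using Cons.prems unfolding p fs monomial_exponents_Cons by auto
    have ef: "e = f" using Cons.prems(3) k unfolding p fs by (cases k; cases l) auto
    have "e \<notin> fst ` set es" "e \<notin> fst ` set gs"
      using Cons.prems(1,2) ef word_less_irrefl unfolding p fs monomial_exponents_Cons by blast+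
    then have notin: "e \<notin> set (expand es)" "e \<notin> set (expand gs)"
      using set_expand by blast+
    have "count (mset (expand ((e, k) # es))) e = count (mset (expand ((f, l) # gs))) e"
      using Cons.prems(3) unfolding p fs by simp
    then have kl: "k = l" using notin ef by (simp add: not_in_iff[THEN iffD1])
    have "expand es = expand gs" using Cons.prems(3) kl ef unfolding p fs by simp
    then have "es = gs" using Cons.prems(1,2) unfolding p fs monomial_exponents_Cons
      by (intro Cons.hyps) auto
    then show ?case using p fs ef kl by simp
  qed
qed

lemma expand_surj:
  fixes par :: "'x::linorder \<Rightarrow> bit"
  assumes "ws \<in> sorted_M par" "One \<notin> set ws"
  shows "\<exists>es\<in>monomial_exponents par. expand es = ws"
  using assms
proof (induct ws)
  case Nil
  then show ?case by (intro bexI[of _ "[]"]) (auto simp: monomial_exponents_def)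
next
  case (Cons w ws)
  have w: "w \<in> M_words par" "w \<noteq> One" "\<forall>v\<in>set ws. word_rel (\<lambda>a. parity par a = 1) w v"
    using Cons.prems by (auto simp: sorted_M_def)
  obtain es where es: "es \<in> monomial_exponents par" "expand es = ws"
    using Cons by (auto simp: sorted_M_def)
  show ?case
  proof (cases es)
    case Nil
    then show ?thesis using w es
      by (intro bexI[of _ "[(w, 1)]"]) (auto simp: monomial_exponents_def)
  next
    case (Cons p fs)
    obtain e k where p: "p = (e, k)" by (cases p)
    have e: "e \<in> M_words par" "e \<noteq> One" "1 \<le> k" "\<forall>f\<in>fst ` set fs. e \<prec> f" "fs \<in> monomial_exponents par"
      using es(1) unfolding Cons p monomial_exponents_Cons by auto
    have "e \<in> set ws" using es(2) e(3) unfolding Cons p by (cases k) auto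
    then have "word_rel (\<lambda>a. parity par a = 1) w e" using w by simp
    then consider "w \<prec> e" | "w = e" "parity par e \<noteq> 1" by (auto simp: word_rel_def)
    then show ?thesis
    proof cases
      case 1
      have m: "mulfree f" if "f \<in> fst ` set fs" for f
        using e(5) that M_words_mulfree by (fastforce simp: monomial_exponents_def)
      have "w \<prec> f" if "f \<in> fst ` set fs" for f
        using word_less_trans[OF 1, of f] e(1,4) that m[OF that] w(1) M_words_mulfree by blast
      then have "(w, 1) # es \<in> monomial_exponents par"
        using w es(1) 1 unfolding monomial_exponents_Cons by (auto simp: Cons p)
      then show ?thesis using es(2) by (intro bexI[of _ "(w, 1) # es"]) auto
    next
      case 2
      have "(w, Suc k) # fs \<in> monomial_exponents par"
        using 2 e unfolding monomial_exponents_Cons by auto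
      then show ?thesis using es(2) 2 unfolding Cons p by (intro bexI[of _ "(w, Suc k) # fs"]) auto
    qed
  qed
qed

text \<open>Powers are bracketed to the left, as \<open>[^]\<close> is, so that
  \<open>JB_monomial\<close> is literally the class of \<open>mon_word\<close>.\<close>

primrec pow_word :: "'x nword \<Rightarrow> nat \<Rightarrow> 'x nword" where
  "pow_word e 0 = One"
| "pow_word e (Suc k) = Mul (pow_word e k) e"

definition mon_word :: "('x nword \<times> nat) list \<Rightarrow> 'x nword" where
  "mon_word es = foldr (\<lambda>(e, k) w. Mul (pow_word e k) w) es One"

lemma mon_word_simps [simp]:
  "mon_word [] = One" "mon_word ((e, k) # es) = Mul (pow_word e k) (mon_word es)"
  by (simp_all add: mon_word_def)

lemma ideal_pow_word:
  "(word (pow_word e k) - word (prod_word (replicate k e)) :: ('x, 'k::field) free_alg) \<in> JB_ideal par"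
proof (induct k)
  case (Suc k)
  have a: "(word (Mul (pow_word e k) e) - word (Mul (prod_word (replicate k e)) e) :: ('x, 'k) free_alg)
      \<in> JB_ideal par"
    by (rule ideal_mul_right[OF Suc])
  have b: "(word (Mul (prod_word (replicate k e)) e) - word (Mul (prod_word (replicate k e)) (prod_word [e])) :: ('x, 'k) free_alg)
      \<in> JB_ideal par"
    using ideal_mul_left[OF ideal_sym[OF ideal_unit_right]] by simp
  have c: "(word (Mul (prod_word (replicate k e)) (prod_word [e])) - word (prod_word (replicate k e @ [e])) :: ('x, 'k) free_alg)
      \<in> JB_ideal par"
    by (rule ideal_prod_append)
  show ?case using ideal_trans[OF a ideal_trans[OF b c]] by (simp add: replicate_append_same)
qed (simp add: JB_ideal.zero)

lemma ideal_mon_word: "word (mon_word es) - word (prod_word (expand es)) \<in> JB_ideal par"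
proof (induct es)
  case (Cons p es)
  obtain e k where p: "p = (e, k)" by (cases p)
  show ?case unfolding p
    using ideal_trans[OF ideal_mul_right[OF ideal_pow_word]
      ideal_trans[OF ideal_mul_left[OF Cons] ideal_prod_append]] by simp
qed (simp add: JB_ideal.zero)

theorem mon_words_span:
  fixes par :: "'x::{finite,linorder} \<Rightarrow> bit"
  shows "(p :: ('x, 'k::field_char_0) free_alg) \<in>
    FA.span (JB_ideal par \<union> (\<lambda>es. word (mon_word es)) ` monomial_exponents par)"
proof -
  let ?S = "FA.span (JB_ideal par \<union> (\<lambda>es. word (mon_word es)) ` monomial_exponents par) :: ('x, 'k) free_alg set"
  have cong: "p \<in> ?S" if "p - q \<in> JB_ideal par" "q \<in> ?S" for p q
  proof -
    have "p - q \<in> ?S" using that(1) by (intro FA.span_base) simp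
    from FA.span_add[OF this that(2)] show ?thesis by simp
  qed
  have "word (prod_word ws) \<in> ?S" if "ws \<in> sorted_M par" for ws
  proof -
    let ?vs = "filter (\<lambda>w. w \<noteq> One) ws"
    have "?vs \<in> sorted_M par" using that by (auto simp: sorted_M_def sorted_wrt_filter)
    then obtain es where es: "es \<in> monomial_exponents par" "expand es = ?vs"
      using expand_surj[of ?vs par] by auto
    have "word (mon_word es) \<in> ?S" using es(1) by (intro FA.span_base) blast
    then have "word (prod_word ?vs) \<in> ?S"
      using cong[OF ideal_sym[OF ideal_mon_word[of es par]]] es(2) by simp
    then show ?thesis by (rule cong[OF ideal_drop_One])
  qed
  then have sorted: "FA.span (JB_ideal par \<union> (\<lambda>ws. word (prod_word ws)) ` sorted_M par) \<subseteq> ?S"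
    by (intro FA.span_minimal) (auto intro: FA.span_base)
  have "poly_span par (M_words par) \<subseteq> ?S"
    unfolding poly_span_def using prod_word_sorted[of _ par, where 'k = 'k] sorted
    by (intro FA.span_minimal) (auto intro: FA.span_base)
  then show ?thesis using poly_span_M_UNIV by blast
qed


section \<open>Laurent polynomials over a free associative superalgebra\<close>

text \<open>With concatenation as addition of keys, the convolution product of
  \<open>poly_mapping\<close> becomes the product of the free associative algebra, and pairs of keys
  add componentwise.\<close>

instantiation list :: (type) monoid_add
begin
definition "0 = []"
definition "xs + ys = xs @ ys"
instance by standard (simp_all add: zero_list_def plus_list_def)
end

text \<open>
  The letter \<open>(y, i)\<close> has parity \<open>i\<close>; keeping the parity inside the letter makes the bracket
  independent of any parameter. The monomial \<open>(n, l)\<close> is \<open>t\<^sup>n l\<close> with a central even variable \<open>t\<close>.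
\<close>

type_synonym ('y, 'k) laurent = "(int \<times> ('y \<times> bit) list) \<Rightarrow>\<^sub>0 'k"

lemma poly_mapping_single_induct [case_names zero add single]:
  assumes "P 0" "\<And>f g. P f \<Longrightarrow> P g \<Longrightarrow> P (f + g)" "\<And>k c. P (Poly_Mapping.single k c)"
  shows "P (f :: 'a \<Rightarrow>\<^sub>0 'b::comm_monoid_add)"
proof -
  have "f = (\<Sum>k\<in>Poly_Mapping.keys f. Poly_Mapping.single k (Poly_Mapping.lookup f k))"
    by (rule poly_mapping_eqI) (simp add: lookup_sum lookup_single when_def in_keys_iff)
  moreover have "P (\<Sum>k\<in>K. Poly_Mapping.single k (Poly_Mapping.lookup f k))" if "finite K" for K
    using that by (induct K) (auto intro: assms)
  ultimately show ?thesis by (metis finite_keys)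
qed

abbreviation cst :: "'k::field \<Rightarrow> ('y, 'k) laurent" where
  "cst c \<equiv> Poly_Mapping.single 0 c"

definition tpow :: "int \<Rightarrow> ('y, 'k::field) laurent" where
  "tpow n = Poly_Mapping.single (n, []) 1"

text \<open>Each letter carries one factor \<open>t\<close>. A bracket of two elements with exponent
  1 has exponent 1 again after the division by \<open>t\<close>, so for products of Lie words the
  exponent counts the factors (\<open>bigraded_lie_prod\<close>).\<close>

definition letter :: "'y \<times> bit \<Rightarrow> ('y, 'k::field) laurent" where
  "letter l = Poly_Mapping.single (1, [l]) 1"

lemma zero_key: "0 = (0 :: int, [] :: 'a list)"
  by (simp add: zero_prod_def zero_list_def)

declare plus_list_def [simp] zero_list_def [simp]

lemma cst_commute: "f * cst c = cst c * f"
  by (induct f rule: poly_mapping_single_induct) (simp_all add: algebra_simps mult_single)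

lemma tpow_commute: "f * tpow n = tpow n * f"
proof (induct f rule: poly_mapping_single_induct)
  case (single k c)
  then show ?case by (cases k) (simp add: tpow_def mult_single add.commute)
qed (simp_all add: algebra_simps)

lemma cst_pull: "f * (cst c * g) = cst c * (f * g)"
  by (metis cst_commute mult.assoc)

lemma tpow_pull: "f * (tpow n * g) = tpow n * (f * g)"
  by (metis tpow_commute mult.assoc)

lemma tpow_add: "tpow m * tpow n = tpow (m + n)"
  by (simp add: tpow_def mult_single)

lemma tpow_add_assoc: "tpow m * (tpow n * f) = tpow (m + n) * f"
  by (simp add: tpow_add flip: mult.assoc)

lemma tpow_0 [simp]: "tpow 0 = 1"
  by (simp add: tpow_def flip: zero_key del: zero_list_def)

lemma cst_simps [simp]: "cst 0 = 0" "cst 1 = 1" "cst (a + b) = cst a + cst b" "cst (- a) = - cst a"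
  by (simp_all add: single_add single_uminus)

lemma cst_mult: "cst (a * b) = cst a * cst b"
  by (simp add: mult_single)

lemma lookup_cst_mult: "Poly_Mapping.lookup (cst c * f) k = c * Poly_Mapping.lookup f k"
  by (simp add: mult_map_scale_conv_mult[symmetric] Poly_Mapping.map.rep_eq when_def)

interpretation CV: vector_space "\<lambda>c f. cst c * f :: ('y, 'k::field) laurent"
  by unfold_locales (simp_all add: algebra_simps cst_mult)

lemma subspace_preimage:
  assumes "CV.subspace S" "\<And>f g. h (f + g) = h f + h g" "\<And>c f. h (cst c * f) = cst c * h f"
  shows "CV.subspace {f. h f \<in> S}"
proof -
  have "h 0 = 0" using assms(2)[of 0 0] by simp
  then show ?thesis using assms by (auto simp: CV.subspace_def)
qed

lemma span_image_subset:
  assumes "f \<in> CV.span A" "CV.subspace S" "\<And>f g. h (f + g) = h f + h g" "\<And>c f. h (cst c * f) = cst c * h f"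
    "\<And>a. a \<in> A \<Longrightarrow> h a \<in> S"
  shows "h f \<in> S"
proof -
  have "CV.span A \<subseteq> {f. h f \<in> S}"
    by (rule CV.span_minimal[OF _ subspace_preimage[OF assms(2-4)]]) (use assms(5) in auto)
  then show ?thesis using assms(1) by blast
qed

section \<open>Parity and the supercommutator divided by t\<close>

definition key_parity :: "int \<times> ('y \<times> bit) list \<Rightarrow> bit" where
  "key_parity k = sum_list (map snd (snd k))"

lemma key_parity_add: "key_parity (k + l) = key_parity k + key_parity l"
  by (cases k; cases l) (simp add: key_parity_def)

definition od :: "('y, 'k::field) laurent \<Rightarrow> ('y, 'k) laurent" where
  "od f = Poly_Mapping.mapp (\<lambda>k c. if key_parity k = 1 then c else 0) f"

lemma lookup_od: "Poly_Mapping.lookup (od f) k = (if key_parity k = 1 then Poly_Mapping.lookup f k else 0)"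
  by (simp add: od_def lookup_mapp when_def in_keys_iff)

lemma od_add [simp]: "od (f + g) = od f + od g"
  by (rule poly_mapping_eqI) (simp add: lookup_od lookup_add)

lemma od_single: "od (Poly_Mapping.single k c) = (if key_parity k = 1 then Poly_Mapping.single k c else 0)"
  by (rule poly_mapping_eqI) (auto simp: lookup_od lookup_single when_def)

lemma od_cst_mult [simp]: "od (cst c * f) = cst c * od f"
  by (rule poly_mapping_eqI) (simp add: lookup_od lookup_cst_mult)

lemma od_tpow_mult [simp]: "od (tpow n * f) = tpow n * od f"
proof (induct f rule: poly_mapping_single_induct)
  case zero
  then show ?case by (simp add: od_def mapp_def Poly_Mapping.mapp.rep_eq poly_mapping_eq_iff lookup_od[unfolded od_def])
next
  case (single k c)
  have "key_parity ((n, []) + k) = key_parity k" by (simp add: key_parity_add key_parity_def)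
  then show ?case by (simp add: tpow_def mult_single od_single)
qed (simp add: algebra_simps)

definition homog :: "bit \<Rightarrow> ('y, 'k::field) laurent set" where
  "homog i = {f. \<forall>k\<in>Poly_Mapping.keys f. key_parity k = i}"

lemma homog_lookup: "f \<in> homog i \<longleftrightarrow> (\<forall>k. key_parity k \<noteq> i \<longrightarrow> Poly_Mapping.lookup f k = 0)"
  by (auto simp: homog_def in_keys_iff)

lemma od_hom: "f \<in> homog i \<Longrightarrow> od f = (if i = 1 then f else 0)"
  by (rule poly_mapping_eqI) (auto simp: lookup_od homog_lookup)

lemma homog_add [intro]: "f \<in> homog i \<Longrightarrow> g \<in> homog i \<Longrightarrow> f + g \<in> homog i"
  by (simp add: homog_lookup lookup_add)

lemma homog_diff [intro]: "f \<in> homog i \<Longrightarrow> g \<in> homog i \<Longrightarrow> f - g \<in> homog i"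
  by (simp add: homog_lookup lookup_minus)

lemma homog_cst_mult [intro]: "f \<in> homog i \<Longrightarrow> cst c * f \<in> homog i"
  by (simp add: homog_lookup lookup_cst_mult)

lemma homog_mult [intro]: "f \<in> homog i \<Longrightarrow> g \<in> homog j \<Longrightarrow> f * g \<in> homog (i + j)"
  unfolding homog_def
proof (intro CollectI ballI)
  fix k assume fg: "f \<in> {f. \<forall>k\<in>Poly_Mapping.keys f. key_parity k = i}"
    "g \<in> {f. \<forall>k\<in>Poly_Mapping.keys f. key_parity k = j}" and "k \<in> Poly_Mapping.keys (f * g)"
  then obtain a b where "k = a + b" "a \<in> Poly_Mapping.keys f" "b \<in> Poly_Mapping.keys g"
    using keys_mult[of f g] by blast
  then show "key_parity k = i + j" using fg by (simp only: key_parity_add mem_Collect_eq)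
qed

lemma homog_tpow [simp]: "tpow n \<in> homog 0"
  by (simp add: homog_def tpow_def key_parity_def)

lemma homog_one [simp]: "1 \<in> homog 0"
  using homog_tpow[of 0] by simp

lemma homog_letter [simp]: "letter l \<in> homog (snd l)"
  by (simp add: homog_def letter_def key_parity_def)

lemma homog_tpow_mult [intro]: "f \<in> homog i \<Longrightarrow> tpow n * f \<in> homog i"
  using homog_mult[OF homog_tpow, of f i n] unfolding add_0 .

text \<open>The summand with odd parts turns the commutator into the supercommutator.\<close>

definition sbr :: "('y, 'k::field) laurent \<Rightarrow> ('y, 'k) laurent \<Rightarrow> ('y, 'k) laurent" where
  "sbr f g = tpow (- 1) * (f * g - g * f + (od g * od f + od g * od f))"

lemma sbr_hom_eq:
  assumes "f \<in> homog i" "g \<in> homog j"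
  shows "sbr f g = tpow (- 1) * (f * g - cst (sg (i * j)) * (g * f))"
  by (cases i; cases j) (simp_all add: sbr_def od_hom[OF assms(1)] od_hom[OF assms(2)])

lemma sbr_add: "sbr (f + f') g = sbr f g + sbr f' g" "sbr f (g + g') = sbr f g + sbr f g'"
  by (simp_all add: sbr_def algebra_simps)

lemma sbr_cst: "sbr (cst c * f) g = cst c * sbr f g" "sbr f (cst c * g) = cst c * sbr f g"
  by (simp_all only: sbr_def od_cst_mult cst_pull mult.assoc distrib_left right_diff_distrib)

lemma sbr_tpow: "sbr (tpow n * f) g = tpow n * sbr f g" "sbr f (tpow n * g) = tpow n * sbr f g"
  by (simp_all only: sbr_def od_tpow_mult tpow_pull[of _ n] mult.assoc distrib_left
      right_diff_distrib)

lemma sbr_hom [intro]: "f \<in> homog i \<Longrightarrow> g \<in> homog j \<Longrightarrow> sbr f g \<in> homog (i + j)"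
proof -
  assume f: "f \<in> homog i" and g: "g \<in> homog j"
  have gf: "g * f \<in> homog (i + j)" using homog_mult[OF g f] by (simp only: add.commute)
  then show "sbr f g \<in> homog (i + j)"
    unfolding sbr_hom_eq[OF f g] by (intro homog_tpow_mult homog_diff homog_cst_mult homog_mult[OF f g] gf)
qed

lemma sbr_anti:
  assumes "f \<in> homog i" "g \<in> homog j"
  shows "sbr f g = - (cst (sg (i * j)) * sbr g f)"
  by (cases i; cases j) (simp_all add: sbr_hom_eq[OF assms] sbr_hom_eq[OF assms(2,1)] algebra_simps)

lemma sbr_leibniz:
  assumes "f \<in> homog i" "g \<in> homog j" "h \<in> homog r"
  shows "sbr f (g * h) = sbr f g * h + cst (sg (i * j)) * (g * sbr f h)"
proof -
  have "sbr f (g * h) = tpow (- 1) * (f * (g * h) - cst (sg (i * (j + r))) * (g * h * f))"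
    by (rule sbr_hom_eq[OF assms(1) homog_mult[OF assms(2,3)]])
  then show ?thesis unfolding sbr_hom_eq[OF assms(1,2)] sbr_hom_eq[OF assms(1,3)]
    by (cases i; cases j; cases r) (simp_all add: algebra_simps tpow_pull)
qed

text \<open>Once the central factors \<open>1/t\<close> are pulled out, this is the Jacobi identity
  of the supercommutator, an identity of the associative product in each of the eight parity
  cases.\<close>

lemma sbr_jacobi:
  assumes f: "f \<in> homog i" and g: "g \<in> homog j" and h: "h \<in> homog r"
  shows "sbr f (sbr g h) = sbr (sbr f g) h + cst (sg (i * j)) * sbr g (sbr f h)"
proof -
  define c where "c = (\<lambda>i j (f :: ('a, 'b) laurent) g. f * g - cst (sg (i * j)) * (g * f))"
  have sbr: "sbr f g = tpow (- 1) * c i j f g" if "f \<in> homog i" "g \<in> homog j"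
    for f g :: "('a, 'b) laurent" and i j
    unfolding c_def by (rule sbr_hom_eq[OF that])
  have pull: "c i j f (tpow n * g) = tpow n * c i j f g" "c i j (tpow n * f) g = tpow n * c i j f g"
    for f g i j n by (simp_all only: c_def tpow_pull[of _ n] mult.assoc right_diff_distrib)
  have "c i (j + r) f (c j r g h) = c (i + j) r (c i j f g) h + cst (sg (i * j)) * c j (i + r) g (c i r f h)"
    unfolding c_def by (cases i; cases j; cases r) (simp_all add: algebra_simps)
  then have "tpow (- 1) * (tpow (- 1) * c i (j + r) f (c j r g h)) = tpow (- 1) * (tpow (- 1) * c (i + j) r (c i j f g) h)
      + cst (sg (i * j)) * (tpow (- 1) * (tpow (- 1) * c j (i + r) g (c i r f h)))"
    by (simp only: tpow_pull[of "cst _"] distrib_left)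
  moreover have "sbr f (sbr g h) = tpow (- 1) * (tpow (- 1) * c i (j + r) f (c j r g h))"
    by (simp only: sbr[OF f sbr_hom[OF g h]], simp only: sbr[OF g h] pull)
  moreover have "sbr (sbr f g) h = tpow (- 1) * (tpow (- 1) * c (i + j) r (c i j f g) h)"
    by (simp only: sbr[OF sbr_hom[OF f g] h], simp only: sbr[OF f g] pull)
  moreover have "sbr g (sbr f h) = tpow (- 1) * (tpow (- 1) * c j (i + r) g (c i r f h))"
    by (simp only: sbr[OF g sbr_hom[OF f h]], simp only: sbr[OF f h] pull)
  ultimately show ?thesis by simp
qed

lemma sbr_one [simp]: "sbr f 1 = 0"
  by (simp add: sbr_def od_hom[OF homog_one])


subsection \<open>Linear extensions\<close>

text \<open>Linear maps out of \<open>D_X\<close> go to two targets, the Laurent algebra and the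
  Poisson algebra; in both, the field acts through a central copy of itself.\<close>

locale scalar_map =
  fixes \<kappa> :: "'k::field \<Rightarrow> 'r::{ring,monoid_mult}"
  assumes scalar_add: "\<kappa> (a + b) = \<kappa> a + \<kappa> b"
    and scalar_mult: "\<kappa> (a * b) = \<kappa> a * \<kappa> b"
    and scalar_one: "\<kappa> 1 = 1"
    and scalar_commute: "x * \<kappa> a = \<kappa> a * x"
begin

lemma scalar_zero: "\<kappa> 0 = 0"
  using scalar_add[of 0 0] by simp

lemma scalar_uminus: "\<kappa> (- a) = - \<kappa> a"
  using scalar_add[of "- a" a] by (simp add: scalar_zero eq_neg_iff_add_eq_0)

lemma scalar_diff: "\<kappa> (a - b) = \<kappa> a - \<kappa> b"
  using scalar_add[of a "- b"] by (simp add: scalar_uminus)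

lemma scalar_pull: "x * (\<kappa> a * y) = \<kappa> a * (x * y)"
  by (metis scalar_commute mult.assoc)

definition lext :: "('x nword \<Rightarrow> 'r) \<Rightarrow> ('x, 'k) free_alg \<Rightarrow> 'r" where
  "lext h p = (\<Sum>w\<in>Poly_Mapping.keys p. \<kappa> (Poly_Mapping.lookup p w) * h w)"

lemma lext_superset:
  assumes "finite A" "Poly_Mapping.keys p \<subseteq> A"
  shows "lext h p = (\<Sum>w\<in>A. \<kappa> (Poly_Mapping.lookup p w) * h w)"
  unfolding lext_def using assms
  by (intro sum.mono_neutral_left) (auto simp: in_keys_iff scalar_zero)

lemma lext_add: "lext h (p + q) = lext h p + lext h q"
proof -
  let ?A = "Poly_Mapping.keys p \<union> Poly_Mapping.keys q"
  have "Poly_Mapping.keys (p + q) \<subseteq> ?A" by (rule Poly_Mapping.keys_add)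
  then show ?thesis
    by (simp add: lext_superset[of ?A] lookup_add scalar_add distrib_right sum.distrib)
qed

lemma lext_scale: "lext h (scale c p) = \<kappa> c * lext h p"
proof -
  have "Poly_Mapping.keys (scale c p) \<subseteq> Poly_Mapping.keys p"
    by (auto simp: in_keys_iff lookup_scale)
  then show ?thesis
    by (simp add: lext_superset[of "Poly_Mapping.keys p"] lookup_scale scalar_mult sum_distrib_left mult.assoc)
qed

lemma lext_zero: "lext h 0 = 0"
  by (simp add: lext_def)

lemma lext_uminus: "lext h (- p) = - lext h p"
  using lext_add[of h p "- p"] by (simp add: lext_zero eq_neg_iff_add_eq_0 add.commute)

lemma lext_diff: "lext h (p - q) = lext h p - lext h q"
  using lext_add[of h p "- q"] by (simp add: lext_uminus)

lemma lext_word: "lext h (word w) = h w"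
  by (simp add: lext_def word_def scalar_one)

end

lemma free_alg_induct [case_names word add scale]:
  assumes "\<And>w. P (word w)" "\<And>p q. P p \<Longrightarrow> P q \<Longrightarrow> P (p + q)" "\<And>c p. P p \<Longrightarrow> P (scale c p)"
  shows "P p"
proof -
  have "P (scale 0 (word One))" by (intro assms)
  moreover have "scale 0 (word One) = 0" by simp
  ultimately have "P 0" by simp
  then have "FA.subspace (Collect P)" using assms(2,3) by (auto simp: FA.subspace_def)
  then have "FA.span (range word) \<subseteq> Collect P" using assms(1) by (intro FA.span_minimal) auto
  then show ?thesis using free_alg_in_span_UNIV by blast
qed

interpretation CS: scalar_map "cst :: 'k::field \<Rightarrow> ('y, 'k) laurent"
  by unfold_locales (simp, rule cst_mult, simp, rule cst_commute)

subsection \<open>Evaluation of Lie words\<close>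

primrec lie_eval :: "('x \<Rightarrow> bit) \<Rightarrow> 'x nword \<Rightarrow> ('x option, 'k::field) laurent" where
  "lie_eval par One = letter (None, 0)"
| "lie_eval par (Gen x) = letter (Some x, par x)"
| "lie_eval par (Mul u v) = lie_eval par u * lie_eval par v"
| "lie_eval par (Br u v) = sbr (lie_eval par u) (lie_eval par v)"

lemma lie_eval_hom: "lie_eval par w \<in> homog (parity par w)"
proof (induct w)
  case One
  show ?case using homog_letter[of "(None, 0)"] by simp
next
  case (Gen x)
  show ?case using homog_letter[of "(Some x, par x)"] by simp
next
  case (Mul u v)
  then show ?case unfolding lie_eval.simps parity.simps by (rule homog_mult)
next
  case (Br u v)
  then show ?case unfolding lie_eval.simps parity.simps by (rule sbr_hom)
qed

lemma lext_lie_eval_br: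
  "CS.lext (lie_eval par) (br p q) = sbr (CS.lext (lie_eval par) p) (CS.lext (lie_eval par) q)"
proof (induct p rule: free_alg_induct)
  case (word u)
  show ?case
    by (induct q rule: free_alg_induct)
      (simp_all add: br_simps CS.lext_word CS.lext_add CS.lext_scale sbr_add sbr_cst)
qed (simp_all add: br_simps CS.lext_add CS.lext_scale sbr_add sbr_cst)

text \<open>The second use of the rewriting: here the Lie identities hold exactly after evaluation,
  so the neglected subspace is the kernel of the evaluation in every degree.\<close>

lemma lie_eval_bracket:
  fixes par :: "'x::{finite,linorder} \<Rightarrow> bit"
  assumes "u \<in> M_words par" "v \<in> M_words par"
  shows "(lie_eval par (Br u v) :: ('x option, 'k::field_char_0) laurent) \<in>
    CV.span (lie_eval par ` {w \<in> M_words par. deg w = deg u + deg v})"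
proof -
  let ?E = "CS.lext (lie_eval par) :: ('x, 'k) free_alg \<Rightarrow> _"
  let ?N = "\<lambda>_. {p. ?E p = 0} :: ('x, 'k) free_alg set"
  have main: "(word (Br u v) :: ('x, 'k) free_alg) \<in> hall_span par ?N n (\<lambda>_. True)"
    if "u \<in> M_words par" "v \<in> M_words par" "deg u + deg v = n" for u v n
    using that
  proof (induct n arbitrary: u v rule: less_induct)
    case (less n)
    interpret hall_step par ?N n
    proof
      show "FA.subspace (?N m)" for m
        by (auto simp: FA.subspace_def CS.lext_zero CS.lext_add CS.lext_scale)
      show "word (Br a b) + scale (sg (parity par a * parity par b)) (word (Br b a)) \<in> ?N n" for a b
        unfolding mem_Collect_eq CS.lext_word CS.lext_add CS.lext_scale lie_eval.simps
        by (subst sbr_anti[OF lie_eval_hom[of par a] lie_eval_hom[of par b]]) (rule left_minus)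
      show "word (Br a (Br b c)) - word (Br (Br a b) c)
          - scale (sg (parity par a * parity par b)) (word (Br b (Br a c))) \<in> ?N n" for a b c
        unfolding mem_Collect_eq CS.lext_word CS.lext_diff CS.lext_scale lie_eval.simps
        by (subst sbr_jacobi[OF lie_eval_hom[of par a] lie_eval_hom[of par b] lie_eval_hom[of par c]])
          (simp only: add_diff_cancel_left' diff_self)
      show "word (Br a b) \<in> hall_span par ?N (deg a + deg b) (\<lambda>_. True)"
        if "a \<in> M_words par" "b \<in> M_words par" "deg a + deg b < n" for a b
        using less.hyps[OF that(3,1,2) refl] .
      show "br p (word v) \<in> ?N n" "br (word v) p \<in> ?N n" if "p \<in> ?N m" for p m v
        using that sbr_add[of 0 0] sbr_add(2)[of _ 0 0] by (simp_all add: lext_lie_eval_br)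
    qed
    show ?case using less.prems by (rule bracket_in_hall_span)
  qed
  let ?S = "CV.span (lie_eval par ` {w \<in> M_words par. deg w = deg u + deg v}) :: ('x option, 'k) laurent set"
  have "hall_span par ?N (deg u + deg v) (\<lambda>_. True) \<subseteq> {p. ?E p \<in> ?S}"
    unfolding hall_span_def
  proof (rule FA.span_minimal)
    show "FA.subspace {p. ?E p \<in> ?S}"
      by (auto simp: FA.subspace_def CS.lext_zero CS.lext_add CS.lext_scale
          intro: CV.span_add CV.span_scale CV.span_zero)
  qed (auto simp: CS.lext_word intro: CV.span_zero CV.span_base)
  then have "?E (word (Br u v)) \<in> ?S" using main[OF assms refl] by blast
  then show ?thesis by (simp add: CS.lext_word)
qed

definition lie_prod :: "('x \<Rightarrow> bit) \<Rightarrow> 'x nword list \<Rightarrow> ('x option, 'k::field) laurent" where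
  "lie_prod par ws = prod_list (map (lie_eval par) ws)"

lemma lie_prod_simps [simp]:
  "lie_prod par [] = 1" "lie_prod par (w # ws) = lie_eval par w * lie_prod par ws"
  "lie_prod par (vs @ ws) = lie_prod par vs * lie_prod par ws"
  by (simp_all add: lie_prod_def)

lemma lie_prod_hom: "lie_prod par ws \<in> homog (sum_list (map (parity par) ws))"
proof (induct ws)
  case (Cons w ws)
  then show ?case using homog_mult[OF lie_eval_hom[of par w] Cons]
    by (simp only: lie_prod_simps list.map sum_list.Cons)
qed simp

subsection \<open>Ordered products span\<close>

text \<open>The power of \<open>t\<close> fills up the exponent to \<open>n\<close>, so all these
  elements are homogeneous of exponent \<open>n\<close> in \<open>t\<close> and of word length
  \<open>d\<close>; \<open>m\<close> bounds the number of factors.\<close>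

definition ord_prods :: "('x::linorder \<Rightarrow> bit) \<Rightarrow> nat \<Rightarrow> nat \<Rightarrow> nat \<Rightarrow> ('x option, 'k::field) laurent set" where
  "ord_prods par n m d = (\<lambda>vs. tpow (int n - int (length vs)) * lie_prod par vs) `
    {vs \<in> sorted_M par. total_deg vs = d \<and> length vs < m}"

text \<open>The spanning half of a Poincare-Birkhoff-Witt argument: exchanging two neighbours costs
  \<open>t\<close> times a product in which their bracket replaces them, hence one with fewer
  factors, to which the induction applies.\<close>

lemma lie_prod_in_span:
  fixes par :: "'x::{finite,linorder} \<Rightarrow> bit"
  assumes "set ws \<subseteq> M_words par"
  shows "(lie_prod par ws :: ('x option, 'k::field_char_0) laurent) \<in>
    CV.span (ord_prods par (length ws) (Suc (length ws)) (total_deg ws))"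
  using assms
proof (induct "length ws" arbitrary: ws rule: less_induct)
  case less
  let ?n = "length ws" and ?d = "total_deg ws"
  let ?N = "CV.span (ord_prods par ?n ?n ?d) :: ('x option, 'k) laurent set"
  let ?f = "lie_prod par :: _ \<Rightarrow> ('x option, 'k) laurent"
  have shorter: "tpow 1 * ?f vs \<in> ?N" if vs: "set vs \<subseteq> M_words par" "Suc (length vs) = ?n" "total_deg vs = ?d" for vs
  proof -
    have "?f vs \<in> CV.span (ord_prods par (length vs) (Suc (length vs)) ?d)"
      using less.hyps[of vs] vs by simp
    then show ?thesis
    proof (rule span_image_subset[OF _ CV.subspace_span])
      fix a :: "('x option, 'k) laurent" assume "a \<in> ord_prods par (length vs) (Suc (length vs)) ?d"
      then obtain us where us: "us \<in> sorted_M par" "total_deg us = ?d" "length us < ?n"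
        "a = tpow (int (length vs) - int (length us)) * ?f us"
        using vs(2) by (auto simp: ord_prods_def)
      have "tpow 1 * a = tpow (int ?n - int (length us)) * ?f us"
        unfolding us(4) tpow_add_assoc by (simp add: vs(2)[symmetric] add_diff_eq)
      then show "tpow 1 * a \<in> ?N" using us
        by (intro CV.span_base) (auto simp: ord_prods_def)
    qed (simp_all add: algebra_simps cst_pull)
  qed
  have swap: "?f (xs @ a # b # ys) - cst (sg (parity par a * parity par b)) * ?f (xs @ b # a # ys) \<in> ?N"
    if "set (xs @ a # b # ys) \<subseteq> M_words par" "mset (xs @ a # b # ys) = mset ws" for xs a b ys
  proof -
    have len: "length (xs @ a # b # ys) = ?n" using mset_eq_length[OF that(2)] .
    have deg: "total_deg (xs @ a # b # ys) = ?d" using total_deg_mset[OF that(2)] .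
    have s: "lie_eval par a * lie_eval par b - cst (sg (parity par a * parity par b)) * (lie_eval par b * lie_eval par a)
        = (tpow 1 * lie_eval par (Br a b) :: ('x option, 'k) laurent)"
      unfolding lie_eval.simps sbr_hom_eq[OF lie_eval_hom lie_eval_hom] tpow_add_assoc by simp
    have "?f (xs @ a # b # ys) - cst (sg (parity par a * parity par b)) * ?f (xs @ b # a # ys)
        = ?f xs * (lie_eval par a * lie_eval par b - cst (sg (parity par a * parity par b)) * (lie_eval par b * lie_eval par a)) * ?f ys"
      by (simp add: algebra_simps cst_pull)
    also have "\<dots> = tpow 1 * (?f xs * (lie_eval par (Br a b) * ?f ys))"
      unfolding s by (simp add: tpow_pull mult.assoc)
    also have "\<dots> \<in> ?N"
    proof (rule span_image_subset[where h = "\<lambda>g. tpow 1 * (?f xs * (g * ?f ys))"])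
      show "(lie_eval par (Br a b) :: ('x option, 'k) laurent) \<in> CV.span (lie_eval par ` {w \<in> M_words par. deg w = deg a + deg b})"
        using that by (intro lie_eval_bracket) auto
      fix g :: "('x option, 'k) laurent" assume "g \<in> lie_eval par ` {w \<in> M_words par. deg w = deg a + deg b}"
      then obtain w where w: "w \<in> M_words par" "deg w = deg a + deg b" "g = lie_eval par w" by auto
      have "tpow 1 * ?f (xs @ w # ys) \<in> ?N"
        using that w len deg by (intro shorter) auto
      then show "tpow 1 * (?f xs * (g * ?f ys)) \<in> ?N" using w by simp
    qed (simp_all add: algebra_simps cst_pull)
    finally show ?thesis .
  qed
  have sorted: "?f ws \<in> ?N \<or> (\<exists>vs\<in>sorted_M par. mset vs = mset ws \<and> (?f ws - ?f vs \<in> ?N \<or> ?f ws + ?f vs \<in> ?N))"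
  proof (rule sort_M_words)
    show "?f (xs @ a # b # ys) - ?f (xs @ b # a # ys) \<in> ?N \<or> ?f (xs @ a # b # ys) + ?f (xs @ b # a # ys) \<in> ?N"
      if xs: "set (xs @ a # b # ys) \<subseteq> M_words par" "mset (xs @ a # b # ys) = mset ws" for xs ys a b
    proof -
      obtain s :: 'k where "s = 1 \<or> s = - 1" "?f (xs @ a # b # ys) - cst s * ?f (xs @ b # a # ys) \<in> ?N"
        using swap[OF xs] sg_cases by blast
      then show ?thesis by (elim disjE) (simp_all only: cst_simps, simp_all)
    qed
    show "?f (xs @ a # a # ys) \<in> ?N"
      if "set (xs @ a # a # ys) \<subseteq> M_words par" "mset (xs @ a # a # ys) = mset ws" "parity par a = 1" for xs ys a
    proof -
      have "?f (xs @ a # a # ys) - cst (- 1) * ?f (xs @ a # a # ys) \<in> ?N"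
        using swap[OF that(1,2)] that(3) by simp
      then have "cst (1 / 2) * (?f (xs @ a # a # ys) - cst (- 1) * ?f (xs @ a # a # ys)) \<in> ?N"
        by (rule CV.span_scale)
      moreover have "cst (1 / 2) * (f - cst (- 1) * f) = f" for f :: "('x option, 'k) laurent"
        by (rule poly_mapping_eqI) (simp only: lookup_minus lookup_cst_mult, simp)
      ultimately show ?thesis by simp
    qed
  qed (use less.prems in \<open>auto intro: CV.span_zero CV.span_add CV.span_neg\<close>)
  have sub: "?N \<subseteq> CV.span (ord_prods par ?n (Suc ?n) ?d)"
    by (rule CV.span_mono) (auto simp: ord_prods_def)
  have sorted_mem: "?f vs \<in> CV.span (ord_prods par ?n (Suc ?n) ?d)" if "vs \<in> sorted_M par" "mset vs = mset ws" for vs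
    using that mset_eq_length[OF that(2)] total_deg_mset[OF that(2)]
    by (intro CV.span_base) (auto simp: ord_prods_def intro!: image_eqI[of _ _ vs])
  from sorted show ?case
  proof (elim disjE bexE conjE)
    assume "?f ws \<in> ?N"
    then show ?case using sub by blast
  next
    fix vs assume vs: "vs \<in> sorted_M par" "mset vs = mset ws"
    {
      assume "?f ws - ?f vs \<in> ?N"
      then show ?case using CV.span_add[OF subsetD[OF sub] sorted_mem[OF vs], of "?f ws - ?f vs"] by simp
    next
      assume "?f ws + ?f vs \<in> ?N"
      then show ?case using CV.span_diff[OF subsetD[OF sub] sorted_mem[OF vs], of "?f ws + ?f vs"] by simp
    }
  qed
qed


subsection \<open>Linear independence of ordered products\<close>

lemma independent_family:
  fixes f :: "'i \<Rightarrow> ('y, 'k::field) laurent"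
  shows "(inj_on f I \<and> CV.independent (f ` I)) \<longleftrightarrow>
    (\<forall>F c. finite F \<longrightarrow> F \<subseteq> I \<longrightarrow> (\<Sum>i\<in>F. cst (c i) * f i) = 0 \<longrightarrow> (\<forall>i\<in>F. c i = 0))"
    (is "?L \<longleftrightarrow> ?R")
proof
  assume L: ?L
  show ?R
  proof (intro allI impI ballI)
    fix F c i assume F: "finite F" "F \<subseteq> I" "(\<Sum>i\<in>F. cst (c i) * f i) = 0" and i: "i \<in> F"
    have inj: "inj_on f F" using L F(2) inj_on_subset by blast
    have "(\<Sum>v\<in>f ` F. cst (c (inv_into F f v)) * v) = 0"
      using F(3) by (subst sum.reindex[OF inj]) (simp add: inv_into_f_f[OF inj] cong: sum.cong)
    then have "c (inv_into F f (f i)) = 0"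
      using L F(1,2) i by (intro CV.independentD[of "f ` I" "f ` F"]) auto
    then show "c i = 0" using inv_into_f_f[OF inj i] by simp
  qed
next
  assume R: ?R
  have inj: "inj_on f I"
  proof (rule inj_onI, rule ccontr)
    fix i j assume ij: "i \<in> I" "j \<in> I" "f i = f j" "i \<noteq> j"
    have "(\<Sum>l\<in>{i, j}. cst (if l = i then 1 else - 1) * f l) = 0"
      using ij by simp
    then have "(if i = i then 1 else - 1 :: 'k) = 0"
      using R[rule_format, of "{i, j}" "\<lambda>l. if l = i then 1 else - 1" i] ij by blast
    then show False by simp
  qed
  have "\<not> CV.dependent (f ` I)"
  proof
    assume "CV.dependent (f ` I)"
    then obtain T u v where T: "finite T" "T \<subseteq> f ` I" "(\<Sum>v\<in>T. cst (u v) * v) = 0" "v \<in> T" "u v \<noteq> 0"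
      unfolding CV.dependent_explicit by blast
    obtain F where F: "F \<subseteq> I" "T = f ` F" using T(2) by (auto simp: subset_image_iff)
    have injF: "inj_on f F" using inj F(1) inj_on_subset by blast
    have "finite F" using T(1) F(2) injF finite_imageD by blast
    moreover have "(\<Sum>i\<in>F. cst (u (f i)) * f i) = 0"
      using T(3) unfolding F(2) by (subst (asm) sum.reindex[OF injF]) simp
    ultimately have "\<forall>i\<in>F. u (f i) = 0" using R[rule_format, of F "\<lambda>i. u (f i)"] F(1) by blast
    then show False using T(4,5) F(2) by auto
  qed
  then show ?L using inj by simp
qed

lemma independent_familyD:
  assumes "inj_on f I \<and> CV.independent (f ` I)"
    and "finite F" "F \<subseteq> I" "(\<Sum>i\<in>F. cst (c i) * f i) = 0" "i \<in> F"
  shows "c i = 0"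
  using assms(1)[unfolded independent_family, rule_format, OF assms(2-5)] .

text \<open>Among the letters \<open>(a, i)\<close> these are the ones with the parity prescribed by
  \<open>par\<close>.\<close>

definition coherent :: "('x \<Rightarrow> bit) \<Rightarrow> 'x option \<Rightarrow> 'x option \<times> bit" where
  "coherent par a = (a, case a of None \<Rightarrow> 0 | Some x \<Rightarrow> par x)"

lemma lie_eval_letter_word: "lie_eval par (letter_word a) = letter (coherent par a)"
  by (simp add: letter_word_def coherent_def split: option.split)

lemma letter_word_M: "letter_word a \<in> M_words par"
  by (simp add: letter_word_def M_words_iff split: option.split)

lemma deg_letter_word [simp]: "deg (letter_word a) = 1"
  by (simp add: letter_word_def split: option.split)

lemma lie_prod_letters:
  "lie_prod par (map letter_word as) = Poly_Mapping.single (int (length as), map (coherent par) as) 1"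
proof (induct as)
  case Nil
  then show ?case by (simp flip: zero_key del: zero_list_def)
next
  case (Cons a as)
  then show ?case by (simp add: lie_eval_letter_word letter_def mult_single)
qed

lemma total_deg_letters: "total_deg (map letter_word as) = length as"
  by (induct as) simp_all

lemma length_le_total_deg: "length ws \<le> total_deg ws"
proof (induct ws)
  case (Cons w ws)
  then show ?case using deg_pos[of w] by (simp del: deg_pos)
qed simp

text \<open>
  There are at most as many ordered products of degree \<open>n\<close> as words of length \<open>n\<close>, and they span
  the space of these words.
\<close>

lemma ord_prods_independent_deg:
  fixes par :: "'x::{finite,linorder} \<Rightarrow> bit" and n :: nat
  defines "b \<equiv> \<lambda>vs. tpow (int n - int (length vs)) * (lie_prod par vs :: ('x option, 'k::field_char_0) laurent)"
  defines "E \<equiv> {vs \<in> sorted_M par. total_deg vs = n}"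
  shows "inj_on b E \<and> CV.independent (b ` E)"
proof -
  let ?W = "{as :: 'x option list. length as = n}"
  define a where "a = (\<lambda>as. Poly_Mapping.single (int n, map (coherent par) as) 1 :: ('x option, 'k) laurent)"
  have finW: "finite ?W" using finite_lists_length_eq[of "UNIV :: 'x option set" n] by simp
  obtain \<phi> :: "'x nword list \<Rightarrow> 'x option list"
    where \<phi>: "inj_on \<phi> (sorted_M par)" "\<forall>ws\<in>sorted_M par. length (\<phi> ws) = total_deg ws"
    using sorted_M_inj[of par] by blast
  have injE: "inj_on \<phi> E" and subE: "\<phi> ` E \<subseteq> ?W"
    using \<phi> unfolding E_def by (auto intro: inj_on_subset)
  have finE: "finite E" using finite_imageD[OF finite_subset[OF subE finW] injE] .
  have cardE: "card E \<le> card ?W" by (rule card_inj_on_le[OF injE subE finW])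
  have inj_coh: "inj (coherent par)" by (auto simp: inj_def coherent_def)
  have "inj_on a ?W \<and> CV.independent (a ` ?W)"
    unfolding independent_family
  proof (intro allI impI ballI)
    fix F c as assume F: "finite F" "F \<subseteq> ?W" "(\<Sum>as\<in>F. cst (c as) * a as) = 0" "as \<in> F"
    have "0 = Poly_Mapping.lookup (\<Sum>as\<in>F. cst (c as) * a as) (int n, map (coherent par) as)"
      using F(3) by simp
    also have "\<dots> = (\<Sum>bs\<in>F. if bs = as then c as else 0)"
      unfolding lookup_sum
    proof (rule sum.cong[OF refl])
      fix bs
      have "map (coherent par) bs = map (coherent par) as \<longleftrightarrow> bs = as"
        using inj_coh by (metis inj_map_eq_map)
      then show "Poly_Mapping.lookup (cst (c bs) * a bs) (int n, map (coherent par) as) = (if bs = as then c as else 0)"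
        by (auto simp: lookup_cst_mult a_def lookup_single when_def)
    qed
    finally show "c as = 0" using F(1,4) by simp
  qed
  then have cardA: "card (a ` ?W) = card ?W" and indA: "CV.independent (a ` ?W)"
    by (simp_all add: card_image)
  have span: "a ` ?W \<subseteq> CV.span (b ` E)"
  proof
    fix x assume "x \<in> a ` ?W"
    then obtain as where as: "length as = n" "x = a as" by auto
    have "(lie_prod par (map letter_word as) :: ('x option, 'k) laurent) \<in> CV.span (ord_prods par n (Suc n) n)"
      using lie_prod_in_span[of "map letter_word as" par] as letter_word_M[of _ par]
      by (auto simp: total_deg_letters)
    moreover have "ord_prods par n (Suc n) n \<subseteq> b ` E"
      by (auto simp: ord_prods_def b_def E_def)
    ultimately have "(lie_prod par (map letter_word as) :: ('x option, 'k) laurent) \<in> CV.span (b ` E)"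
      using CV.span_mono by blast
    then show "x \<in> CV.span (b ` E)" using as by (simp add: lie_prod_letters a_def)
  qed
  have finB: "finite (b ` E)" using finE by simp
  have le: "card ?W \<le> card T" if "finite T" "a ` ?W \<subseteq> CV.span T" for T
    using CV.independent_span_bound[OF that(1) indA that(2)] cardA by simp
  \<comment> \<open>The number of words, the size of the image and the size of \<open>E\<close>
    bound each other in a circle, so all are equal and \<open>b\<close> is injective. A dependent
    member of the image could be dropped, leaving too few elements to span.\<close>
  have "card (b ` E) = card E"
    using le[OF finB span] cardE card_image_le[OF finE, of b] by simp
  then have "inj_on b E" by (rule eq_card_imp_inj_on[OF finE])
  moreover have "CV.independent (b ` E)"
  proof (rule ccontr)
    assume "\<not> CV.independent (b ` E)"
    then obtain x where x: "x \<in> b ` E" "x \<in> CV.span (b ` E - {x})"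
      unfolding CV.dependent_def by blast
    have "CV.span (insert x (b ` E - {x})) = CV.span (b ` E - {x})" using x(2) by (rule CV.span_redundant)
    then have "a ` ?W \<subseteq> CV.span (b ` E - {x})" using span x(1) by (simp add: insert_absorb)
    then have "card ?W \<le> card (b ` E - {x})" using finB by (intro le) auto
    also have "\<dots> < card (b ` E)" using finB x(1) by (rule card_Diff1_less)
    finally show False using card_image_le[OF finE, of b] cardE by simp
  qed
  ultimately show ?thesis by blast
qed

section \<open>Bigrading by the exponent of t and the word length\<close>

definition bigraded :: "int \<Rightarrow> nat \<Rightarrow> ('y, 'k::field) laurent set" where
  "bigraded m d = {f. \<forall>k\<in>Poly_Mapping.keys f. fst k = m \<and> length (snd k) = d}"

lemma bigraded_lookup:
  "f \<in> bigraded m d \<longleftrightarrow> (\<forall>k. \<not> (fst k = m \<and> length (snd k) = d) \<longrightarrow> Poly_Mapping.lookup f k = 0)"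
  unfolding bigraded_def Ball_def in_keys_iff mem_Collect_eq by blast

lemma bigraded_mult:
  assumes "f \<in> bigraded m d" "g \<in> bigraded m' d'" shows "f * g \<in> bigraded (m + m') (d + d')"
  unfolding bigraded_def
proof (intro CollectI ballI)
  fix k assume "k \<in> Poly_Mapping.keys (f * g)"
  then obtain a b where "k = a + b" "a \<in> Poly_Mapping.keys f" "b \<in> Poly_Mapping.keys g"
    using keys_mult[of f g] by blast
  then show "fst k = m + m' \<and> length (snd k) = d + d'"
    using assms by (auto simp: bigraded_def)
qed

lemma bigraded_od: "f \<in> bigraded m d \<Longrightarrow> od f \<in> bigraded m d"
  by (auto simp: bigraded_lookup lookup_od)

lemma bigraded_tpow: "f \<in> bigraded m d \<Longrightarrow> tpow n * f \<in> bigraded (n + m) d"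
  using bigraded_mult[of "tpow n" n 0 f m d] by (simp add: bigraded_def[of n] tpow_def)

lemma bigraded_sbr:
  assumes "f \<in> bigraded m d" "g \<in> bigraded m' d'" shows "sbr f g \<in> bigraded (m + m' - 1) (d + d')"
proof -
  have "f * g - g * f + (od g * od f + od g * od f) \<in> bigraded (m + m') (d + d')"
    using bigraded_mult[OF assms] bigraded_mult[OF assms(2,1)]
      bigraded_mult[OF bigraded_od[OF assms(2)] bigraded_od[OF assms(1)]]
    by (simp add: bigraded_lookup lookup_add lookup_minus add.commute)
  from bigraded_tpow[OF this, of "- 1"] show ?thesis by (simp add: sbr_def)
qed

lemma bigraded_lie_eval: "mulfree w \<Longrightarrow> lie_eval par w \<in> bigraded 1 (deg w)"
proof (induct w)
  case (Br u v)
  then show ?case using bigraded_sbr[of "lie_eval par u" 1 "deg u" "lie_eval par v" 1 "deg v"] by simp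
qed (simp_all add: bigraded_def letter_def)

lemma bigraded_lie_prod:
  "set ws \<subseteq> M_words par \<Longrightarrow> lie_prod par ws \<in> bigraded (int (length ws)) (total_deg ws)"
proof (induct ws)
  case Nil
  then show ?case by (simp add: bigraded_def)
next
  case (Cons w ws)
  then have w: "mulfree w" "set ws \<subseteq> M_words par" by (auto intro: M_words_mulfree)
  show ?case using bigraded_mult[OF bigraded_lie_eval[OF w(1), of par] Cons.hyps[OF w(2)]] by simp
qed

text \<open>A relation splits into components of fixed exponent of \<open>t\<close> and fixed word
  length. Within one component the power of \<open>t\<close> is forced by the number of factors, and
  a common shift by a power of \<open>t\<close> turns it into a relation as in
  \<open>ord_prods_independent_deg\<close>.\<close>

theorem ord_prods_independent:
  fixes par :: "'x::{finite,linorder} \<Rightarrow> bit"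
  defines "f \<equiv> \<lambda>(a, vs). tpow a * (lie_prod par vs :: ('x option, 'k::field_char_0) laurent)"
  shows "inj_on f (UNIV \<times> sorted_M par) \<and> CV.independent (f ` (UNIV \<times> sorted_M par))"
  unfolding independent_family
proof (intro allI impI ballI)
  fix F c i assume F: "finite F" "F \<subseteq> UNIV \<times> sorted_M par" "(\<Sum>i\<in>F. cst (c i) * f i) = 0" "i \<in> F"
  have f: "f (a, vs) \<in> bigraded (a + int (length vs)) (total_deg vs)" if "(a, vs) \<in> F" for a vs
  proof -
    have "set vs \<subseteq> M_words par" using that F(2) by (auto simp: sorted_M_def)
    from bigraded_tpow[OF bigraded_lie_prod[OF this], of a] show ?thesis by (simp add: f_def)
  qed
  obtain a0 us where i: "i = (a0, us)" by (cases i)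
  let ?m = "a0 + int (length us)" and ?n = "total_deg us"
  let ?G = "{(a, vs) \<in> F. a + int (length vs) = ?m \<and> total_deg vs = ?n}"
  have G: "(\<Sum>i\<in>?G. cst (c i) * f i) = 0"
  proof (rule poly_mapping_eqI)
    fix k
    have "Poly_Mapping.lookup (\<Sum>i\<in>?G. cst (c i) * f i) k = 0"
    proof (cases "fst k = ?m \<and> length (snd k) = ?n")
      case True
      have "Poly_Mapping.lookup (\<Sum>i\<in>?G. cst (c i) * f i) k = Poly_Mapping.lookup (\<Sum>i\<in>F. cst (c i) * f i) k"
        unfolding lookup_sum
      proof (rule sum.mono_neutral_left[OF F(1)])
        show "\<forall>i\<in>F - ?G. Poly_Mapping.lookup (cst (c i) * f i) k = 0"
        proof
          fix j assume j: "j \<in> F - ?G"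
          obtain a vs where jj: "j = (a, vs)" by (cases j)
          have "\<not> (fst k = a + int (length vs) \<and> length (snd k) = total_deg vs)" using j jj True by auto
          then have "Poly_Mapping.lookup (f (a, vs)) k = 0"
            using f[of a vs] j jj unfolding bigraded_lookup by blast
          then show "Poly_Mapping.lookup (cst (c j) * f j) k = 0" unfolding jj lookup_cst_mult by simp
        qed
      qed auto
      then show ?thesis using F(3) by simp
    next
      case False
      have "Poly_Mapping.lookup (cst (c j) * f j) k = 0" if j: "j \<in> ?G" for j
      proof -
        obtain a vs where jj: "j = (a, vs)" by (cases j)
        have "\<not> (fst k = a + int (length vs) \<and> length (snd k) = total_deg vs)" using j jj False by auto
        then have "Poly_Mapping.lookup (f (a, vs)) k = 0"
          using f[of a vs] j jj unfolding bigraded_lookup by blast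
        then show ?thesis unfolding jj lookup_cst_mult by simp
      qed
      then show ?thesis unfolding lookup_sum by (intro sum.neutral) blast
    qed
    then show "Poly_Mapping.lookup (\<Sum>i\<in>?G. cst (c i) * f i) k = Poly_Mapping.lookup 0 k" by simp
  qed
  define b where "b = (\<lambda>vs. tpow (int ?n - int (length vs)) * (lie_prod par vs :: ('x option, 'k) laurent))"
  let ?V = "snd ` ?G"
  have inj: "inj_on snd ?G" by (auto simp: inj_on_def)
  have b: "tpow (int ?n - ?m) * f j = b (snd j)" if "j \<in> ?G" for j
  proof -
    obtain a vs where jj: "j = (a, vs)" by (cases j)
    have "a = ?m - int (length vs)" using that jj by auto
    then show ?thesis using jj by (simp add: f_def b_def tpow_add_assoc)
  qed
  have "0 = tpow (int ?n - ?m) * (\<Sum>j\<in>?G. cst (c j) * f j)" using G by simp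
  also have "\<dots> = (\<Sum>j\<in>?G. cst (c j) * b (snd j))"
    unfolding sum_distrib_left by (intro sum.cong refl) (simp add: cst_pull b)
  also have "\<dots> = (\<Sum>vs\<in>?V. cst (c (?m - int (length vs), vs)) * b vs)"
  proof (subst sum.reindex[OF inj], rule sum.cong[OF refl])
    fix j assume "j \<in> ?G"
    then have "(?m - int (length (snd j)), snd j) = j" by (cases j) auto
    then show "cst (c j) * b (snd j) = ((\<lambda>vs. cst (c (?m - int (length vs), vs)) * b vs) \<circ> snd) j" by simp
  qed
  finally have sum: "(\<Sum>vs\<in>?V. cst (c (?m - int (length vs), vs)) * b vs) = 0" by simp
  have "finite ?G" using F(1) by (rule rev_finite_subset) auto
  then have "finite ?V" by simp
  moreover have "?V \<subseteq> {vs \<in> sorted_M par. total_deg vs = ?n}" using F(2) by auto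
  moreover have "us \<in> ?V" using F(4) i by force
  ultimately have "c (?m - int (length us), us) = 0"
    using sum[unfolded b_def]
    by (intro independent_familyD[OF ord_prods_independent_deg[of ?n par],
          where c = "\<lambda>vs. c (?m - int (length vs), vs)"])
  then show "c i = 0" using i by simp
qed

subsection \<open>The Rees algebra\<close>

text \<open>Closure under \<open>sbr\<close>, with its division by \<open>t\<close>, is imposed
  outright. That this adds no negative powers of \<open>t\<close> to products of Lie words is the
  content of \<open>proj_rees\<close>.\<close>

inductive_set rees :: "('y, 'k::field) laurent set" where
  one: "1 \<in> rees"
| tpow: "tpow 1 \<in> rees"
| letter: "letter l \<in> rees"
| add: "f \<in> rees \<Longrightarrow> g \<in> rees \<Longrightarrow> f + g \<in> rees"
| cst: "f \<in> rees \<Longrightarrow> cst c * f \<in> rees"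
| mult: "f \<in> rees \<Longrightarrow> g \<in> rees \<Longrightarrow> f * g \<in> rees"
| sbr: "f \<in> rees \<Longrightarrow> g \<in> rees \<Longrightarrow> sbr f g \<in> rees"

lemma rees_zero: "0 \<in> rees"
  using rees.cst[OF rees.one, of 0] by simp

lemma rees_uminus: "f \<in> rees \<Longrightarrow> - f \<in> rees"
  using rees.cst[of f "- 1"] by simp

lemma rees_diff: "f \<in> rees \<Longrightarrow> g \<in> rees \<Longrightarrow> f - g \<in> rees"
  using rees.add[OF _ rees_uminus, of f g] by simp

lemma rees_lie_eval: "lie_eval par w \<in> rees"
  by (induct w) (auto intro: rees.intros)

lemma rees_lie_prod: "lie_prod par ws \<in> rees"
  by (induct ws) (auto intro: rees.intros rees_lie_eval)

text \<open>The Rees algebra involves all letters; the projection kills those with the wrong parity.\<close>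

definition proj :: "('x \<Rightarrow> bit) \<Rightarrow> ('x option, 'k::field) laurent \<Rightarrow> ('x option, 'k) laurent" where
  "proj par f = Poly_Mapping.mapp (\<lambda>k c. if set (snd k) \<subseteq> range (coherent par) then c else 0) f"

lemma lookup_proj:
  "Poly_Mapping.lookup (proj par f) k = (if set (snd k) \<subseteq> range (coherent par) then Poly_Mapping.lookup f k else 0)"
  by (simp add: proj_def lookup_mapp when_def in_keys_iff)

lemma proj_add: "proj par (f + g) = proj par f + proj par g"
  by (rule poly_mapping_eqI) (simp add: lookup_proj lookup_add)

lemma proj_diff: "proj par (f - g) = proj par f - proj par g"
  by (rule poly_mapping_eqI) (simp add: lookup_proj lookup_minus)

lemma proj_cst: "proj par (cst c * f) = cst c * proj par f"
  by (rule poly_mapping_eqI) (simp add: lookup_proj lookup_cst_mult)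

lemma proj_od: "proj par (od f) = od (proj par f)"
  by (rule poly_mapping_eqI) (simp add: lookup_proj lookup_od)

lemma proj_single:
  "proj par (Poly_Mapping.single k c) = (if set (snd k) \<subseteq> range (coherent par) then Poly_Mapping.single k c else 0)"
  by (rule poly_mapping_eqI) (auto simp: lookup_proj lookup_single when_def)

lemma proj_zero: "proj par 0 = 0"
  by (rule poly_mapping_eqI) (simp add: lookup_proj)

lemma proj_mult: "proj par (f * g) = proj par f * proj par g"
proof (induct f rule: poly_mapping_single_induct)
  case (single k c)
  show ?case
  proof (induct g rule: poly_mapping_single_induct)
    case (single l d)
    have "set (snd (k + l)) = set (snd k) \<union> set (snd l)" by (cases k; cases l) simp
    then show ?case by (simp add: mult_single proj_single)
  qed (simp_all add: proj_zero proj_add distrib_left)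
qed (simp_all add: proj_zero proj_add distrib_right)

lemma proj_tpow: "proj par (tpow n) = tpow n"
  by (simp add: tpow_def proj_single)

lemma proj_sbr: "proj par (sbr f g) = sbr (proj par f) (proj par g)"
  by (simp add: sbr_def proj_mult proj_tpow proj_add proj_diff proj_od)

lemma proj_one: "proj par 1 = 1"
  using proj_tpow[of par 0] by simp

lemma proj_letter: "proj par (letter l) = (if l \<in> range (coherent par) then letter l else 0)"
  by (simp add: letter_def proj_single)

lemma proj_lie_eval: "proj par (lie_eval par w) = lie_eval par w"
proof (induct w)
  case One
  have "(None, 0) = coherent par None" by (simp add: coherent_def)
  then show ?case by (simp only: lie_eval.simps proj_letter) simp
next
  case (Gen x)
  have "(Some x, par x) = coherent par (Some x)" by (simp add: coherent_def)
  then show ?case by (simp only: lie_eval.simps proj_letter) simp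
qed (simp_all add: proj_mult proj_sbr)

lemma proj_lie_prod: "proj par (lie_prod par ws) = lie_prod par ws"
  by (induct ws) (simp_all add: proj_one proj_mult proj_lie_eval)

section \<open>An upper bound for the Rees algebra\<close>

lemma tpow_mult_tpow: "(tpow i * f) * (tpow j * g) = tpow (i + j) * (f * g)"
  by (simp only: mult.assoc tpow_pull[of f] tpow_add_assoc)

definition prods :: "('x::linorder \<Rightarrow> bit) \<Rightarrow> ('x option, 'k::field) laurent set" where
  "prods par = {tpow (int j) * lie_prod par ws | j ws. set ws \<subseteq> M_words par}"

lemma prods_span_mult:
  fixes f g :: "('x::linorder option, 'k::field) laurent"
  assumes "f \<in> CV.span (prods par)" "g \<in> CV.span (prods par)"
  shows "f * g \<in> CV.span (prods par)"
proof (rule span_image_subset[OF assms(1) CV.subspace_span])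
  fix a :: "('x option, 'k) laurent" assume "a \<in> prods par"
  then obtain i vs where a: "a = tpow (int i) * lie_prod par vs" "set vs \<subseteq> M_words par"
    by (auto simp: prods_def)
  show "a * g \<in> CV.span (prods par)"
  proof (rule span_image_subset[OF assms(2) CV.subspace_span])
    fix b :: "('x option, 'k) laurent" assume "b \<in> prods par"
    then obtain j ws where b: "b = tpow (int j) * lie_prod par ws" "set ws \<subseteq> M_words par"
      by (auto simp: prods_def)
    have "a * b = tpow (int (i + j)) * lie_prod par (vs @ ws)"
      unfolding a b by (simp add: tpow_mult_tpow)
    then show "a * b \<in> CV.span (prods par)" using a b
      by (intro CV.span_base) (auto simp: prods_def intro!: exI[of _ "i + j"] exI[of _ "vs @ ws"])
  qed (simp_all add: algebra_simps cst_pull)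
qed (simp_all add: algebra_simps)

lemma prods_span_lie_prod: "set ws \<subseteq> M_words par \<Longrightarrow> lie_prod par ws \<in> CV.span (prods par)"
  by (intro CV.span_base) (auto simp: prods_def intro!: exI[of _ 0] exI[of _ ws])

lemma prods_span_lie_eval: "w \<in> M_words par \<Longrightarrow> lie_eval par w \<in> CV.span (prods par)"
  using prods_span_lie_prod[of "[w]" par] by simp

lemma prods_span_sbr_prod:
  assumes "f \<in> homog i" "\<And>w. w \<in> set ws \<Longrightarrow> sbr f (lie_eval par w) \<in> CV.span (prods par)" "set ws \<subseteq> M_words par"
  shows "sbr f (lie_prod par ws) \<in> CV.span (prods par)"
  using assms(2,3)
proof (induct ws)
  case Nil
  then show ?case by (simp add: CV.span_zero)
next
  case (Cons w ws)
  then show ?case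
    unfolding lie_prod_simps sbr_leibniz[OF assms(1) lie_eval_hom lie_prod_hom]
    by (intro CV.span_add CV.span_scale prods_span_mult prods_span_lie_prod prods_span_lie_eval) auto
qed

lemma prods_span_sbr:
  fixes par :: "'x::{finite,linorder} \<Rightarrow> bit" and f g :: "('x option, 'k::field_char_0) laurent"
  assumes "f \<in> CV.span (prods par)" "g \<in> CV.span (prods par)"
  shows "sbr f g \<in> CV.span (prods par)"
proof -
  let ?S = "CV.span (prods par) :: ('x option, 'k) laurent set"
  have 0: "sbr (lie_eval par u) (lie_eval par v) \<in> ?S" if "u \<in> M_words par" "v \<in> M_words par" for u v
  proof -
    have "lie_eval par (Br u v) \<in> ?S"
      using lie_eval_bracket[OF that, where 'k = 'k]
      by (rule subsetD[OF CV.span_minimal, rotated -1]) (auto intro: prods_span_lie_eval)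
    then show ?thesis by simp
  qed
  have 1: "sbr (lie_eval par u) (lie_prod par ws) \<in> ?S" if "u \<in> M_words par" "set ws \<subseteq> M_words par" for u ws
    using that by (intro prods_span_sbr_prod[OF lie_eval_hom] 0) auto
  have 2: "sbr (lie_prod par vs) (lie_prod par ws) \<in> ?S" if "set vs \<subseteq> M_words par" "set ws \<subseteq> M_words par" for vs ws
  proof (rule prods_span_sbr_prod[OF lie_prod_hom _ that(2)])
    fix w assume "w \<in> set ws"
    then have "sbr (lie_eval par w) (lie_prod par vs) \<in> ?S" using that by (intro 1) auto
    then show "sbr (lie_prod par vs) (lie_eval par w) \<in> ?S"
      by (subst sbr_anti[OF lie_prod_hom lie_eval_hom]) (intro CV.span_neg CV.span_scale)
  qed
  show ?thesis
  proof (rule span_image_subset[OF assms(1) CV.subspace_span])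
    fix a :: "('x option, 'k) laurent" assume "a \<in> prods par"
    then obtain i vs where a: "a = tpow (int i) * lie_prod par vs" "set vs \<subseteq> M_words par"
      by (auto simp: prods_def)
    show "sbr a g \<in> ?S"
    proof (rule span_image_subset[OF assms(2) CV.subspace_span])
      fix b :: "('x option, 'k) laurent" assume "b \<in> prods par"
      then obtain j ws where b: "b = tpow (int j) * lie_prod par ws" "set ws \<subseteq> M_words par"
        by (auto simp: prods_def)
      have t: "tpow (int l) \<in> ?S" for l
      proof -
        have "tpow (int l) * lie_prod par [] \<in> (prods par :: ('x option, 'k) laurent set)"
          unfolding prods_def by (intro CollectI exI[of _ l] exI[of _ "[]"]) simp
        from CV.span_base[OF this] show ?thesis by simp
      qed
      have "sbr a b = tpow (int i) * (tpow (int j) * sbr (lie_prod par vs) (lie_prod par ws))"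
        unfolding a b by (simp only: sbr_tpow tpow_add_assoc add.commute)
      then show "sbr a b \<in> ?S" using a b by (simp add: prods_span_mult t 2)
    qed (simp_all add: sbr_add sbr_cst)
  qed (simp_all add: sbr_add sbr_cst)
qed

text \<open>The span of nonnegative powers of \<open>t\<close> times products of words of
  \<open>M\<close> is closed under \<open>sbr\<close> by the Leibniz rule and
  \<open>lie_eval_bracket\<close>. The projection is there because such products involve coherent
  letters only.\<close>

lemma proj_rees:
  fixes par :: "'x::{finite,linorder} \<Rightarrow> bit" and r :: "('x option, 'k::field_char_0) laurent"
  assumes "r \<in> rees"
  shows "proj par r \<in> CV.span (prods par)"
  using assms
proof induct
  case one
  then show ?case using prods_span_lie_prod[of "[]" par] by (simp add: proj_one)
next
  case tpow
  have "tpow 1 * lie_prod par [] \<in> (prods par :: ('x option, 'k) laurent set)"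
    unfolding prods_def by (intro CollectI exI[of _ 1] exI[of _ "[]"]) simp
  then show ?case using CV.span_base by (fastforce simp: proj_tpow)
next
  case (letter l)
  then show ?case
    using prods_span_lie_eval[OF letter_word_M[of _ par]]
    by (auto simp: proj_letter lie_eval_letter_word CV.span_zero)
next
  case (cst f c)
  then show ?case unfolding proj_cst by (intro CV.span_scale)
qed (auto simp: proj_add proj_mult proj_sbr intro: CV.span_add prods_span_mult prods_span_sbr)

text \<open>Independence modulo \<open>t\<close>. By \<open>proj_rees\<close> and
  \<open>lie_prod_in_span\<close> the projection of \<open>t * r\<close> is a combination of ordered
  products with strictly positive powers of \<open>t\<close>, whereas the left-hand side has power
  0; \<open>ord_prods_independent\<close> separates them.\<close>

theorem ord_prods_independent_rees:
  fixes par :: "'x::{finite,linorder} \<Rightarrow> bit" and c :: "'x nword list \<Rightarrow> 'k::field_char_0"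
  assumes "finite F" "F \<subseteq> sorted_M par" "r \<in> rees" "(\<Sum>vs\<in>F. cst (c vs) * lie_prod par vs) = tpow 1 * r"
    and us: "us \<in> F"
  shows "c us = 0"
proof (rule ccontr)
  assume ne: "c us \<noteq> 0"
  define f where "f = (\<lambda>(a, vs). tpow a * (lie_prod par vs :: ('x option, 'k) laurent))"
  let ?I = "UNIV \<times> sorted_M par"
  have ind: "inj_on f ?I" "CV.independent (f ` ?I)"
    using ord_prods_independent[of par, where 'k = 'k] unfolding f_def by blast+
  let ?S = "CV.span (f ` ?I - {f (0, us)})"
  have f_ne: "f (a, vs) \<in> ?S" if "vs \<in> sorted_M par" "(a, vs) \<noteq> (0, us)" for a vs
    using that inj_onD[OF ind(1), of "(a, vs)" "(0, us)"] us assms(2) by (intro CV.span_base) auto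
  have proj_sum: "proj par (\<Sum>vs\<in>F. cst (c vs) * lie_prod par vs) = (\<Sum>vs\<in>F. cst (c vs) * lie_prod par vs)"
    using assms(1) by induct (simp_all add: proj_zero proj_add proj_cst proj_lie_prod)
  have "tpow 1 * g \<in> ?S" if "g \<in> CV.span (prods par)" for g
  proof (rule span_image_subset[OF that CV.subspace_span])
    fix a :: "('x option, 'k) laurent" assume "a \<in> prods par"
    then obtain j ws where a: "a = tpow (int j) * lie_prod par ws" "set ws \<subseteq> M_words par"
      by (auto simp: prods_def)
    show "tpow 1 * a \<in> ?S" unfolding a
    proof (rule span_image_subset[OF lie_prod_in_span[OF a(2)] CV.subspace_span])
      fix b :: "('x option, 'k) laurent"
      assume "b \<in> ord_prods par (length ws) (Suc (length ws)) (total_deg ws)"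
      then obtain vs where vs: "vs \<in> sorted_M par" "length vs \<le> length ws"
        "b = tpow (int (length ws) - int (length vs)) * lie_prod par vs"
        by (auto simp: ord_prods_def)
      have "tpow 1 * (tpow (int j) * b) = f (1 + (int j + (int (length ws) - int (length vs))), vs)"
        unfolding vs f_def by (simp add: tpow_add_assoc)
      then show "tpow 1 * (tpow (int j) * b) \<in> ?S" using f_ne vs by simp
    qed (simp_all add: algebra_simps cst_pull)
  qed (simp_all add: algebra_simps cst_pull)
  from this[OF proj_rees[OF assms(3), of par]]
  have r: "(\<Sum>vs\<in>F. cst (c vs) * lie_prod par vs) \<in> ?S"
    using proj_sum unfolding assms(4) by (simp add: proj_mult proj_tpow)
  have s1: "(\<Sum>vs\<in>F. cst (c vs) * lie_prod par vs) =
    cst (c us) * lie_prod par us + (\<Sum>vs\<in>F - {us}. cst (c vs) * lie_prod par vs)"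
    using assms(1) us by (rule sum.remove)
  have s2: "(\<Sum>vs\<in>F - {us}. cst (c vs) * lie_prod par vs) \<in> ?S"
  proof (intro CV.span_sum CV.span_scale)
    fix vs assume "vs \<in> F - {us}"
    then show "lie_prod par vs \<in> ?S" using f_ne[of vs 0] assms(2) by (auto simp: f_def)
  qed
  have "cst (c us) * lie_prod par us \<in> ?S"
    using CV.span_diff[OF r s2] unfolding s1 by simp
  then have "cst (1 / c us) * (cst (c us) * lie_prod par us) \<in> ?S" by (rule CV.span_scale)
  then have "f (0, us) \<in> ?S" using ne by (simp add: f_def flip: mult.assoc cst_mult)
  moreover have "f (0, us) \<in> f ` ?I" using us assms(2) by auto
  ultimately show False using ind(2) unfolding CV.dependent_def by blast
qed


subsection \<open>The associated Poisson superalgebra\<close>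

definition rees_ideal :: "('y, 'k::field) laurent set" where
  "rees_ideal = (*) (tpow 1) ` rees"

lemma rees_idealI: "f \<in> rees \<Longrightarrow> tpow 1 * f \<in> rees_ideal"
  by (simp add: rees_ideal_def)

lemma rees_idealE: assumes "f \<in> rees_ideal" obtains g where "g \<in> rees" "f = tpow 1 * g"
  using assms by (auto simp: rees_ideal_def)

lemma rees_ideal_zero: "0 \<in> rees_ideal"
  using rees_idealI[OF rees_zero] by simp

lemma rees_ideal_add: "f \<in> rees_ideal \<Longrightarrow> g \<in> rees_ideal \<Longrightarrow> f + g \<in> rees_ideal"
  using rees_idealI[OF rees.add] by (auto simp: distrib_left elim!: rees_idealE)

lemma rees_ideal_uminus: "f \<in> rees_ideal \<Longrightarrow> - f \<in> rees_ideal"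
  using rees_idealI[OF rees_uminus] by (auto elim!: rees_idealE)

lemma rees_ideal_mult:
  assumes "f \<in> rees_ideal" "g \<in> rees" shows "f * g \<in> rees_ideal" "g * f \<in> rees_ideal"
  using assms rees_idealI[OF rees.mult] by (auto simp: mult.assoc tpow_pull elim!: rees_idealE)

text \<open>\<open>sbr\<close> is linear over \<open>t\<close>, so it descends to the quotient by
  \<open>t\<close>.\<close>

lemma rees_ideal_sbr:
  assumes "f \<in> rees_ideal" "g \<in> rees" shows "sbr f g \<in> rees_ideal" "sbr g f \<in> rees_ideal"
  using assms rees_idealI[OF rees.sbr] by (auto simp: sbr_tpow elim!: rees_idealE)

definition poisson_rel :: "('y, 'k::field) laurent \<Rightarrow> ('y, 'k) laurent \<Rightarrow> bool" where
  "poisson_rel f g \<longleftrightarrow> f \<in> rees \<and> g \<in> rees \<and> f - g \<in> rees_ideal"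

lemma poisson_rel_refl: "poisson_rel f f \<longleftrightarrow> f \<in> rees"
  by (simp add: poisson_rel_def rees_ideal_zero)

quotient_type (overloaded) ('y, 'k) poisson = "('y, 'k::field) laurent" / partial: poisson_rel
proof (rule part_equivpI)
  show "\<exists>f :: ('y, 'k) laurent. poisson_rel f f" using rees_zero by (auto simp: poisson_rel_refl)
  show "symp (poisson_rel :: ('y, 'k) laurent \<Rightarrow> _)"
  proof (rule sympI)
    fix f g :: "('y, 'k) laurent" assume "poisson_rel f g"
    then show "poisson_rel g f" using rees_ideal_uminus[of "f - g"] by (simp add: poisson_rel_def)
  qed
  show "transp (poisson_rel :: ('y, 'k) laurent \<Rightarrow> _)"
  proof (rule transpI)
    fix f g h :: "('y, 'k) laurent" assume "poisson_rel f g" "poisson_rel g h"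
    then show "poisson_rel f h" using rees_ideal_add[of "f - g" "g - h"] by (simp add: poisson_rel_def)
  qed
qed

lemma poisson_rel_add: "poisson_rel f g \<Longrightarrow> poisson_rel f' g' \<Longrightarrow> poisson_rel (f + f') (g + g')"
  using rees_ideal_add[of "f - g" "f' - g'"] by (auto simp: poisson_rel_def algebra_simps intro: rees.add)

lemma poisson_rel_uminus: "poisson_rel f g \<Longrightarrow> poisson_rel (- f) (- g)"
  using rees_ideal_uminus[of "f - g"] by (auto simp: poisson_rel_def intro: rees_uminus)

lemma poisson_rel_mult:
  assumes "poisson_rel f g" "poisson_rel f' g'" shows "poisson_rel (f * f') (g * g')"
proof -
  have "(f - g) * f' + g * (f' - g') \<in> rees_ideal"
    using assms by (intro rees_ideal_add rees_ideal_mult) (auto simp: poisson_rel_def)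
  then show ?thesis using assms by (auto simp: poisson_rel_def algebra_simps intro: rees.mult)
qed

lemma poisson_rel_sbr:
  assumes "poisson_rel f g" "poisson_rel f' g'" shows "poisson_rel (sbr f f') (sbr g g')"
proof -
  have d: "sbr (f - g) f' = sbr f f' - sbr g f'" "sbr g (f' - g') = sbr g f' - sbr g g'"
    using sbr_add(1)[of "f - g" g f'] sbr_add(2)[of g "f' - g'" g'] by (simp_all add: algebra_simps)
  have "sbr (f - g) f' + sbr g (f' - g') \<in> rees_ideal"
    using assms by (intro rees_ideal_add rees_ideal_sbr) (auto simp: poisson_rel_def)
  then show ?thesis using assms unfolding d by (auto simp: poisson_rel_def intro: rees.sbr)
qed

lemma rees_cst: "cst c \<in> rees"
  using rees.cst[OF rees.one, of c] by simp

instantiation poisson :: (type, field) "{ring,monoid_mult}"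
begin
lift_definition zero_poisson :: "('a, 'b) poisson" is 0 by (simp add: poisson_rel_refl rees_zero)
lift_definition one_poisson :: "('a, 'b) poisson" is 1 by (simp add: poisson_rel_refl rees.one)
lift_definition plus_poisson :: "('a, 'b) poisson \<Rightarrow> ('a, 'b) poisson \<Rightarrow> ('a, 'b) poisson" is "(+)"
  by (rule poisson_rel_add)
lift_definition uminus_poisson :: "('a, 'b) poisson \<Rightarrow> ('a, 'b) poisson" is uminus
  by (rule poisson_rel_uminus)
lift_definition minus_poisson :: "('a, 'b) poisson \<Rightarrow> ('a, 'b) poisson \<Rightarrow> ('a, 'b) poisson" is "(-)"
  using poisson_rel_add[OF _ poisson_rel_uminus] by fastforce
lift_definition times_poisson :: "('a, 'b) poisson \<Rightarrow> ('a, 'b) poisson \<Rightarrow> ('a, 'b) poisson" is "(*)"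
  by (rule poisson_rel_mult)
instance
proof
  fix a b c :: "('a, 'b) poisson"
  note closed = rees.add rees.mult rees_uminus rees_diff rees.one rees_zero
  show "a + b + c = a + (b + c)"
    by transfer (simp add: poisson_rel_refl add.assoc closed)
  show "a + b = b + a"
    by transfer (simp add: poisson_rel_refl add.commute closed)
  show "0 + a = a"
    by transfer simp
  show "- a + a = 0"
    by transfer (simp add: poisson_rel_refl closed)
  show "a - b = a + - b"
    by transfer (simp add: poisson_rel_refl closed)
  show "a * b * c = a * (b * c)"
    by transfer (simp add: poisson_rel_refl mult.assoc closed)
  show "(a + b) * c = a * c + b * c"
    by transfer (simp add: poisson_rel_refl distrib_right closed)
  show "a * (b + c) = a * b + a * c"
    by transfer (simp add: poisson_rel_refl distrib_left closed)
  show "1 * a = a" "a * 1 = a"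
    by (transfer, simp)+
qed
end

lift_definition pbr :: "('y, 'k::field) poisson \<Rightarrow> ('y, 'k) poisson \<Rightarrow> ('y, 'k) poisson" is sbr
  by (rule poisson_rel_sbr)

lift_definition pconst :: "'k::field \<Rightarrow> ('y, 'k) poisson" is cst
  by (simp add: poisson_rel_refl rees_cst)

abbreviation "symbol \<equiv> abs_poisson"

lemma symbol_simps:
  assumes "f \<in> rees" "g \<in> rees"
  shows "symbol (f + g) = symbol f + symbol g" "symbol (f - g) = symbol f - symbol g"
    "symbol (- f) = - symbol f" "symbol (f * g) = symbol f * symbol g"
    "symbol (sbr f g) = pbr (symbol f) (symbol g)"
  using assms
  by (simp_all add: plus_poisson.abs_eq minus_poisson.abs_eq uminus_poisson.abs_eq times_poisson.abs_eq
      pbr.abs_eq poisson_rel_refl)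

lemma symbol_cst: "symbol (cst c) = pconst c"
  by (simp add: pconst.abs_eq)

lemma symbol_eq_iff: "f \<in> rees \<Longrightarrow> g \<in> rees \<Longrightarrow> symbol f = symbol g \<longleftrightarrow> f - g \<in> rees_ideal"
  using Quotient_rel_abs[OF Quotient_poisson, of f g] Quotient_rel[OF Quotient_poisson, of f g]
  by (auto simp: poisson_rel_def rees_ideal_zero)

lemma poisson_cases: obtains f where "f \<in> rees" "x = symbol f"
  using that[of "rep_poisson x"] Quotient_rep_reflp[OF Quotient_poisson, of x]
    Quotient_abs_rep[OF Quotient_poisson, of x] by (simp add: poisson_rel_refl)

section \<open>Homogeneous elements and the Poisson identities\<close>

definition phom :: "bit \<Rightarrow> ('y, 'k::field) poisson set" where
  "phom i = symbol ` (rees \<inter> homog i)"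

lemma phomE: assumes "x \<in> phom i" obtains f where "f \<in> rees" "f \<in> homog i" "x = symbol f"
  using assms by (auto simp: phom_def)

lemma phomI: "f \<in> rees \<Longrightarrow> f \<in> homog i \<Longrightarrow> symbol f \<in> phom i"
  by (auto simp: phom_def)

interpretation PS: scalar_map "pconst :: 'k::field \<Rightarrow> ('y, 'k) poisson"
proof
  fix a b :: 'k and x :: "('y, 'k) poisson"
  show "pconst (a + b) = pconst a + (pconst b :: ('y, 'k) poisson)"
    by transfer (simp add: poisson_rel_refl rees_cst rees.add)
  show "pconst (a * b) = pconst a * (pconst b :: ('y, 'k) poisson)"
    by transfer (simp only: cst_mult poisson_rel_refl rees_cst rees.mult)
  show "pconst 1 = (1 :: ('y, 'k) poisson)"
    by transfer (simp add: poisson_rel_refl rees.one)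
  show "x * pconst a = pconst a * x"
    by transfer (subst cst_commute, simp add: poisson_rel_refl rees.cst)
qed

text \<open>
  Multiplication by scalars and by the even element \<open>e\<close> are opaque functions, so that they can be
  moved to the front of a product by terminating rewrite rules.
\<close>

definition psc :: "'k::field \<Rightarrow> ('y, 'k) poisson \<Rightarrow> ('y, 'k) poisson" where
  "psc c x = pconst c * x"

definition unit_letter :: "('x option, 'k::field) poisson" where
  "unit_letter = symbol (letter (None, 0))"

definition emul :: "('x option, 'k::field) poisson \<Rightarrow> ('x option, 'k) poisson" where
  "emul x = unit_letter * x"

definition der :: "('x option, 'k::field) poisson \<Rightarrow> ('x option, 'k) poisson" where
  "der x = pbr x unit_letter"

lemma unit_letter_phom: "unit_letter \<in> phom 0"
  using phomI[OF rees.letter homog_letter, of "(None, 0)"] by (simp add: unit_letter_def)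

lemma psc_simps [simp]:
  "psc c (x + y) = psc c x + psc c y" "psc c (x - y) = psc c x - psc c y" "psc c (- x) = - psc c x"
  "psc (c + d) x = psc c x + psc d x" "psc (- c) x = - psc c x" "psc (c - d) x = psc c x - psc d x"
  "psc 1 x = x" "psc 0 x = 0" "psc c 0 = 0" "psc c (psc d x) = psc (c * d) x"
  "psc c x * y = psc c (x * y)"
  by (simp_all add: psc_def distrib_left distrib_right right_diff_distrib left_diff_distrib PS.scalar_add
      PS.scalar_uminus PS.scalar_diff PS.scalar_one PS.scalar_zero PS.scalar_mult mult.assoc)

lemma mult_psc [simp]: "x * psc c y = psc c (x * y)"
  unfolding psc_def by (rule PS.scalar_pull)

lemma phom_psc [intro]: "x \<in> phom i \<Longrightarrow> psc c x \<in> phom i"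
  by (elim phomE) (auto simp: psc_def symbol_cst[symmetric] rees_cst rees.cst
      simp flip: symbol_simps(4) intro!: phomI)

lemma phom_add [intro]: "x \<in> phom i \<Longrightarrow> y \<in> phom i \<Longrightarrow> x + y \<in> phom i"
  by (elim phomE) (auto simp flip: symbol_simps(1) intro!: phomI rees.add)

lemma phom_diff [intro]: "x \<in> phom i \<Longrightarrow> y \<in> phom i \<Longrightarrow> x - y \<in> phom i"
  by (elim phomE) (auto simp flip: symbol_simps(2) intro!: phomI rees_diff)

lemma phom_mult [intro]:
  assumes "x \<in> phom i" "y \<in> phom j" shows "x * y \<in> phom (i + j)"
  using assms
proof (elim phomE)
  fix f g assume fg: "f \<in> rees" "f \<in> homog i" "x = symbol f" "g \<in> rees" "g \<in> homog j" "y = symbol g"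
  have "symbol (f * g) \<in> phom (i + j)" by (intro phomI rees.mult homog_mult fg)
  then show ?thesis unfolding symbol_simps(4)[OF fg(1,4)] fg(3,6) .
qed

lemma phom_pbr [intro]:
  assumes "x \<in> phom i" "y \<in> phom j" shows "pbr x y \<in> phom (i + j)"
  using assms
proof (elim phomE)
  fix f g assume fg: "f \<in> rees" "f \<in> homog i" "x = symbol f" "g \<in> rees" "g \<in> homog j" "y = symbol g"
  have "symbol (sbr f g) \<in> phom (i + j)" by (intro phomI rees.sbr sbr_hom fg)
  then show ?thesis unfolding symbol_simps(5)[OF fg(1,4)] fg(3,6) .
qed

lemma phom_der [intro]: "x \<in> phom i \<Longrightarrow> der x \<in> phom i"
  using phom_pbr[OF _ unit_letter_phom, of x i] unfolding der_def add_0_right .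

lemma phom_emul [intro]: "x \<in> phom i \<Longrightarrow> emul x \<in> phom i"
  using phom_mult[OF unit_letter_phom, of x i] unfolding emul_def add_0 .

lemma pbr_add: "pbr (x + x') y = pbr x y + pbr x' y" "pbr x (y + y') = pbr x y + pbr x y'"
  by (transfer, simp add: sbr_add poisson_rel_refl rees.add rees.sbr)+

lemma pbr_psc: "pbr (psc c x) y = psc c (pbr x y)" "pbr x (psc c y) = psc c (pbr x y)"
  unfolding psc_def by (transfer, simp add: sbr_cst poisson_rel_refl rees.cst rees.sbr)+

lemma pbr_uminus: "pbr (- x) y = - pbr x y" "pbr x (- y) = - pbr x y"
  using pbr_psc(1)[of "- 1" x y] pbr_psc(2)[of x "- 1" y] by simp_all

lemma pbr_diff: "pbr (x - x') y = pbr x y - pbr x' y" "pbr x (y - y') = pbr x y - pbr x y'"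
  using pbr_add(1)[of x "- x'" y] pbr_add(2)[of x y "- y'"] by (simp_all add: pbr_uminus)

text \<open>The supercommutator is \<open>t\<close> times \<open>sbr\<close>, and \<open>sbr\<close>
  stays inside the Rees algebra; so it vanishes in the quotient.\<close>

lemma pmult_commute:
  assumes "x \<in> phom i" "y \<in> phom j"
  shows "x * y = psc (sg (i * j)) (y * x)"
  using assms
proof (elim phomE)
  fix f g assume fg: "f \<in> rees" "f \<in> homog i" "x = symbol f" "g \<in> rees" "g \<in> homog j" "y = symbol g"
  have "f * g - cst (sg (i * j)) * (g * f) = tpow 1 * sbr f g"
    unfolding sbr_hom_eq[OF fg(2,5)] tpow_add_assoc by simp
  then have "symbol (f * g) = symbol (cst (sg (i * j)) * (g * f))"
    using fg rees_idealI[OF rees.sbr[of f g]] by (subst symbol_eq_iff) (auto intro: rees.mult rees.cst rees_uminus)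
  then show ?thesis using fg by (simp add: psc_def symbol_simps symbol_cst rees_cst rees.mult rees.cst)
qed

lemma pbr_anti:
  assumes "x \<in> phom i" "y \<in> phom j"
  shows "pbr x y = - psc (sg (i * j)) (pbr y x)"
  using assms
proof (elim phomE)
  fix f g assume fg: "f \<in> rees" "f \<in> homog i" "x = symbol f" "g \<in> rees" "g \<in> homog j" "y = symbol g"
  have "symbol (sbr f g) = symbol (- (cst (sg (i * j)) * sbr g f))"
    by (subst sbr_anti[OF fg(2,5)]) (rule refl)
  then show ?thesis using fg by (simp add: psc_def symbol_simps symbol_cst rees_cst rees.sbr rees.cst)
qed

lemma pbr_leibniz:
  assumes "x \<in> phom i" "y \<in> phom j" "z \<in> phom r"
  shows "pbr x (y * z) = pbr x y * z + psc (sg (i * j)) (y * pbr x z)"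
  using assms
proof (elim phomE)
  fix f g h assume fg: "f \<in> rees" "f \<in> homog i" "x = symbol f" "g \<in> rees" "g \<in> homog j" "y = symbol g"
    "h \<in> rees" "h \<in> homog r" "z = symbol h"
  have "symbol (sbr f (g * h)) = symbol (sbr f g * h + cst (sg (i * j)) * (g * sbr f h))"
    by (subst sbr_leibniz[OF fg(2,5,8)]) (rule refl)
  then show ?thesis using fg
    by (simp add: psc_def symbol_simps symbol_cst rees_cst rees.sbr rees.cst rees.mult)
qed

lemma pbr_jacobi:
  assumes "x \<in> phom i" "y \<in> phom j" "z \<in> phom r"
  shows "pbr x (pbr y z) = pbr (pbr x y) z + psc (sg (i * j)) (pbr y (pbr x z))"
  using assms
proof (elim phomE)
  fix f g h assume fg: "f \<in> rees" "f \<in> homog i" "x = symbol f" "g \<in> rees" "g \<in> homog j" "y = symbol g"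
    "h \<in> rees" "h \<in> homog r" "z = symbol h"
  have "symbol (sbr f (sbr g h)) = symbol (sbr (sbr f g) h + cst (sg (i * j)) * sbr g (sbr f h))"
    by (subst sbr_jacobi[OF fg(2,5,8)]) (rule refl)
  then show ?thesis using fg
    by (simp add: psc_def symbol_simps symbol_cst rees_cst rees.sbr rees.cst)
qed

lemma der_unit: "der unit_letter = 0"
proof -
  have "sbr (letter (None, 0)) (letter (None, 0)) = (0 :: ('a option, 'b) laurent)"
    using sbr_hom_eq[OF homog_letter homog_letter, of "(None, 0)" "(None, 0)"] by simp
  then show ?thesis unfolding der_def unit_letter_def
    by (simp add: zero_poisson.abs_eq rees.letter flip: symbol_simps(5))
qed


subsection \<open>The Jordan bracket of a graded Poisson superalgebra\<close>

lemma unit_letter_commute: "x * unit_letter = unit_letter * x"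
proof -
  obtain f where f: "f \<in> rees" "x = symbol f" by (rule poisson_cases)
  have "f * letter (None, 0) - letter (None, 0) * f = tpow 1 * sbr f (letter (None, 0))"
    by (simp add: sbr_def tpow_add_assoc od_hom[OF homog_letter])
  then have "symbol (f * letter (None, 0)) = symbol (letter (None, 0) * f)"
    using f rees_idealI[OF rees.sbr[OF f(1) rees.letter]]
    by (subst symbol_eq_iff) (auto intro: rees.mult rees.letter)
  then show ?thesis using f by (simp add: unit_letter_def symbol_simps rees.letter)
qed

lemma emul_simps [simp]:
  "emul (x + y) = emul x + emul y" "emul (x - y) = emul x - emul y" "emul (- x) = - emul x"
  "emul 0 = 0" "emul x * y = emul (x * y)"
  by (simp_all add: emul_def algebra_simps)

lemma emul_psc [simp]: "emul (psc c x) = psc c (emul x)"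
  by (simp add: emul_def)

lemma mult_emul [simp]: "x * emul y = emul (x * y)"
  by (metis emul_def mult.assoc unit_letter_commute)

lemma der_simps [simp]:
  "der (x + y) = der x + der y" "der (x - y) = der x - der y" "der (- x) = - der x"
  "der (psc c x) = psc c (der x)"
  by (simp_all add: der_def pbr_add pbr_diff pbr_uminus pbr_psc)

lemma pbr_unit_letter:
  assumes "x \<in> phom i" shows "pbr unit_letter x = - der x"
  using pbr_anti[OF unit_letter_phom assms] by (simp add: der_def)

lemma der_mult:
  assumes "x \<in> phom i" "y \<in> phom j" shows "der (x * y) = der x * y + x * der y"
  using pbr_leibniz[OF unit_letter_phom assms] pbr_unit_letter[OF phom_mult[OF assms]]
    pbr_unit_letter[OF assms(1)] pbr_unit_letter[OF assms(2)] by (simp add: algebra_simps)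

lemma der_emul:
  assumes "x \<in> phom i" shows "der (emul x) = emul (der x)"
  using der_mult[OF unit_letter_phom assms] by (simp add: emul_def der_unit)

lemma der_pbr:
  assumes "x \<in> phom i" "y \<in> phom j" shows "der (pbr x y) = pbr (der x) y + pbr x (der y)"
  using pbr_jacobi[OF unit_letter_phom assms] pbr_unit_letter[OF phom_pbr[OF assms]]
    pbr_unit_letter[OF assms(1)] pbr_unit_letter[OF assms(2)]
  by (simp add: pbr_uminus algebra_simps)

lemma pbr_emul_right:
  assumes "x \<in> phom i" "y \<in> phom j" shows "pbr x (emul y) = der x * y + emul (pbr x y)"
  using pbr_leibniz[OF assms(1) unit_letter_phom assms(2)] by (simp add: emul_def der_def)

lemma pbr_emul_left:
  assumes "x \<in> phom i" "y \<in> phom j" shows "pbr (emul x) y = emul (pbr x y) - x * der y"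
proof -
  have "pbr (emul x) y = - psc (sg (i * j)) (der y * x + emul (pbr y x))"
    unfolding pbr_anti[OF phom_emul[OF assms(1)] assms(2)] pbr_emul_right[OF assms(2,1)] ..
  then show ?thesis
    unfolding pbr_anti[OF assms] pmult_commute[OF assms(1) phom_der[OF assms(2)]]
    by simp
qed

text \<open>
  The weights \<open>p\<close> and \<open>q\<close> are \<open>2m - 1\<close> and \<open>2n - 1\<close> for \<open>x\<close> and \<open>y\<close> of degrees \<open>m\<close> and \<open>n\<close>. In the
  localisation at \<open>e\<close>, put \<open>a = x e\<^sup>-\<^sup>m\<close> and \<open>b = y e\<^sup>-\<^sup>n\<close>: then this is, up to a power of \<open>e\<close>, the
  Jordan bracket \<open>2 [a, b] + a [b, 1] - [a, 1] b\<close> for the contact bracket \<open>[a, b] = {a e, b e} / e\<close>.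
\<close>

definition jbr :: "'k::field \<Rightarrow> 'k \<Rightarrow> ('x option, 'k) poisson \<Rightarrow> ('x option, 'k) poisson \<Rightarrow> ('x option, 'k) poisson" where
  "jbr p q x y = psc 2 (emul (pbr x y)) + psc p (x * der y) - psc q (der x * y)"

lemma jbr_add: "jbr p q (x + x') y = jbr p q x y + jbr p q x' y" "jbr p q x (y + y') = jbr p q x y + jbr p q x y'"
  by (simp_all add: jbr_def pbr_add algebra_simps)

lemma jbr_psc: "jbr p q (psc c x) y = psc c (jbr p q x y)" "jbr p q x (psc c y) = psc c (jbr p q x y)"
  by (simp_all add: jbr_def pbr_psc mult.commute)

lemma jbr_phom:
  assumes "x \<in> phom i" "y \<in> phom j" shows "jbr p q x y \<in> phom (i + j)"
  unfolding jbr_def by (intro phom_diff phom_add phom_psc phom_emul phom_pbr phom_mult phom_der assms)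

text \<open>Multiplication by \<open>e\<close> raises the degree by 1 and the weight by 2; the
  change of weight cancels the term \<open>der x * y\<close> from the Leibniz rule. Thus the bracket
  may be taken at any common degree, as if \<open>e\<close> were 1.\<close>

lemma jbr_emul_right:
  assumes "x \<in> phom i" "y \<in> phom j" shows "jbr p (q + 2) x (emul y) = emul (jbr p q x y)"
  by (simp add: jbr_def pbr_emul_right[OF assms] der_emul[OF assms(2)] algebra_simps)

lemma jbr_emul_left:
  assumes "x \<in> phom i" "y \<in> phom j" shows "jbr (p + 2) q (emul x) y = emul (jbr p q x y)"
  by (simp add: jbr_def pbr_emul_left[OF assms] der_emul[OF assms(1)] algebra_simps)

lemma jbr_unit: "jbr p 1 x unit_letter = psc 1 (emul (der x))"
proof -
  have "psc 2 (emul (der x)) - emul (der x) = psc (2 - 1) (emul (der x))" unfolding psc_simps by simp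
  moreover have "x * der unit_letter = 0" by (simp add: der_unit)
  moreover have "der x * unit_letter = emul (der x)" by (simp add: emul_def unit_letter_commute)
  ultimately show ?thesis by (simp add: jbr_def flip: der_def)
qed

lemma pswap:
  assumes "x \<in> phom i" "y \<in> phom j"
  shows "y * x = psc (sg (i * j)) (x * y)" "y * (x * w) = psc (sg (i * j)) (x * (y * w))"
proof -
  show 1: "y * x = psc (sg (i * j)) (x * y)"
    using pmult_commute[OF assms(2,1)] by (simp only: mult.commute)
  show "y * (x * w) = psc (sg (i * j)) (x * (y * w))"
    unfolding mult.assoc[symmetric] 1 psc_simps ..
qed

lemma jbr_anti:
  assumes "x \<in> phom i" "y \<in> phom j"
  shows "jbr p q x y = - psc (sg (i * j)) (jbr q p y x)"
  unfolding jbr_def pbr_anti[OF assms] pswap[OF phom_der[OF assms(1)] assms(2)] pswap[OF assms(1) phom_der[OF assms(2)]]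
  by (cases i; cases j) simp_all

text \<open>The element \<open>D(x)\<close> is represented by \<open>e * der x\<close>, of degree
  one more than \<open>x\<close>; the remaining terms therefore carry an extra \<open>e\<close>. The
  weight of the product \<open>y * z\<close> is \<open>q + m + 1\<close>, because its degree is the
  sum of the degrees.\<close>

lemma jbr_leibniz:
  assumes x: "x \<in> phom i" and y: "y \<in> phom j" and z: "z \<in> phom r"
  shows "emul (jbr p (q + m + 1) x (y * z)) = emul (jbr p q x y * z)
    + psc (sg (i * j)) (emul (y * jbr p m x z)) - emul (der x * y * z)"
proof -
  note d = phom_der[OF x] phom_der[OF y] phom_der[OF z]
  have "jbr p (q + m + 1) x (y * z) = jbr p q x y * z + psc (sg (i * j)) (y * jbr p m x z) - der x * y * z"
    unfolding jbr_def
    by (cases i; cases j; simp add: pbr_leibniz[OF x y z] der_mult[OF y z] pswap[OF x y] pswap[OF d(1) y]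
        algebra_simps)
  then show ?thesis by simp
qed

lemma jbr_jbr_expand:
  assumes x: "x \<in> phom i" and y: "y \<in> phom j" and z: "z \<in> phom r"
  shows "jbr p t x (jbr q m y z) =
    psc 2 (emul (psc 2 (der x * pbr y z + emul (pbr x (pbr y z)))
      + psc q (pbr x y * der z + psc (sg (i * j)) (y * pbr x (der z)))
      - psc m (pbr x (der y) * z + psc (sg (i * j)) (der y * pbr x z))))
    + psc p (x * (psc 2 (emul (pbr (der y) z + pbr y (der z)))
      + psc q (der y * der z + y * der (der z)) - psc m (der (der y) * z + der y * der z)))
    - psc t (der x * (psc 2 (emul (pbr y z)) + psc q (y * der z) - psc m (der y * z)))"
proof -
  note d = phom_der[OF x] phom_der[OF y] phom_der[OF z]
  let ?Y = "jbr q m y z"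
  have 1: "pbr x ?Y = psc 2 (der x * pbr y z + emul (pbr x (pbr y z)))
      + psc q (pbr x y * der z + psc (sg (i * j)) (y * pbr x (der z)))
      - psc m (pbr x (der y) * z + psc (sg (i * j)) (der y * pbr x z))"
    unfolding jbr_def pbr_add pbr_diff pbr_psc pbr_emul_right[OF x phom_pbr[OF y z]]
      pbr_leibniz[OF x y d(3)] pbr_leibniz[OF x d(2) z] ..
  have 2: "der ?Y = psc 2 (emul (pbr (der y) z + pbr y (der z)))
      + psc q (der y * der z + y * der (der z)) - psc m (der (der y) * z + der y * der z)"
    unfolding jbr_def der_simps der_emul[OF phom_pbr[OF y z]] der_pbr[OF y z] der_mult[OF y d(3)]
      der_mult[OF d(2) z] ..
  show ?thesis
    unfolding jbr_def[of p t x ?Y] 1 2 unfolding jbr_def ..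
qed

lemma jbr_jacobi:
  assumes x: "x \<in> phom i" and y: "y \<in> phom j" and z: "z \<in> phom r"
  shows "emul (jbr p (q + m + 1) x (jbr q m y z)) = emul (jbr (p + q + 1) m (jbr p q x y) z)
    + psc (sg (i * j)) (emul (jbr q (p + m + 1) y (jbr p m x z)))
    + emul (der x) * jbr q m y z
    + psc (sg (i * (j + r))) (emul (der y) * jbr m p z x)
    + psc (sg (r * (i + j))) (emul (der z) * jbr p q x y)"
proof -
  note dx = phom_der[OF x] and dy = phom_der[OF y] and dz = phom_der[OF z]
  note ddx = phom_der[OF dx] and ddy = phom_der[OF dy] and ddz = phom_der[OF dz]
  note pxy = phom_pbr[OF x y] and pxz = phom_pbr[OF x z] and pyz = phom_pbr[OF y z]
  note swaps = pswap[OF x y] pswap[OF x z] pswap[OF y z]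
    pswap[OF dx y] pswap[OF dx z] pswap[OF dy z] pswap[OF x dy] pswap[OF x dz] pswap[OF y dz]
    pswap[OF dx dy] pswap[OF dx dz] pswap[OF dy dz]
    pswap[OF ddx y] pswap[OF ddx z] pswap[OF ddy z] pswap[OF x ddy] pswap[OF x ddz] pswap[OF y ddz]
    pswap[OF dz pxy] pswap[OF z phom_pbr[OF x dy]] pswap[OF z phom_pbr[OF dx y]]
    pswap[OF dy pxz] pswap[OF y phom_pbr[OF x dz]] pswap[OF y phom_pbr[OF dx z]]
    pswap[OF dx pyz] pswap[OF x phom_pbr[OF y dz]] pswap[OF x phom_pbr[OF dy z]]
  note antis = pbr_anti[OF z x] pbr_anti[OF z y] pbr_anti[OF y x] pbr_anti[OF z dx] pbr_anti[OF z dy]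
    pbr_anti[OF y dx] pbr_anti[OF dz x] pbr_anti[OF dz y] pbr_anti[OF dy x]
    pbr_anti[OF phom_pbr[OF x y] z]
  have four: "psc 4 w = psc 2 w + psc 2 w" for w :: "('a option, 'b) poisson"
    using psc_simps(4)[of 2 2 w] by simp
  \<comment> \<open>The term \<open>{{x, y}, z}\<close> is rewritten by antisymmetry as
    \<open>{z, {x, y}}\<close>, so that all three nested brackets are instances of
    \<open>jbr_jbr_expand\<close>. What is left are linear combinations of products, which
    \<open>swaps\<close> and \<open>antis\<close> bring into a common order.\<close>
  have "jbr p (q + m + 1) x (jbr q m y z) = - psc (sg ((i + j) * r)) (jbr m (p + q + 1) z (jbr p q x y))
    + psc (sg (i * j)) (jbr q (p + m + 1) y (jbr p m x z))
    + der x * jbr q m y z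
    + psc (sg (i * (j + r))) (der y * jbr m p z x)
    + psc (sg (r * (i + j))) (der z * jbr p q x y)"
    unfolding jbr_jbr_expand[OF x y z] jbr_jbr_expand[OF y x z] jbr_jbr_expand[OF z x y]
    unfolding jbr_def pbr_jacobi[OF x y z] antis
    by (cases i; cases j; cases r; simp add: swaps four algebra_simps)
  then have "emul (jbr p (q + m + 1) x (jbr q m y z)) = emul (- psc (sg ((i + j) * r)) (jbr m (p + q + 1) z (jbr p q x y))
    + psc (sg (i * j)) (jbr q (p + m + 1) y (jbr p m x z))
    + der x * jbr q m y z
    + psc (sg (i * (j + r))) (der y * jbr m p z x)
    + psc (sg (r * (i + j))) (der z * jbr p q x y))" by (rule arg_cong)
  then show ?thesis unfolding jbr_anti[OF jbr_phom[OF x y] z, of "p + q + 1" m] by simp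
qed


section \<open>A representation of the free Jordan brackets\<close>

definition weight :: "'x nword \<Rightarrow> 'k::field" where
  "weight w = 2 * of_nat (deg w) - 1"

lemma weight_simps:
  "weight One = 1" "weight (Mul u v) = weight u + weight v + 1" "weight (Br u v) = weight u + weight v + 1"
  by (simp_all add: weight_def algebra_simps)

primrec jeval :: "('x \<Rightarrow> bit) \<Rightarrow> 'x nword \<Rightarrow> ('x option, 'k::field) poisson" where
  "jeval par One = unit_letter"
| "jeval par (Gen x) = symbol (letter (Some x, par x))"
| "jeval par (Mul u v) = jeval par u * jeval par v"
| "jeval par (Br u v) = jbr (weight u) (weight v) (jeval par u) (jeval par v)"

lemma jeval_phom: "jeval par w \<in> phom (parity par w)"
proof (induct w)
  case One
  show ?case using unit_letter_phom by simp
next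
  case (Gen x)
  show ?case using phomI[OF rees.letter homog_letter, of "(Some x, par x)"] by simp
next
  case (Mul u v)
  then show ?case unfolding jeval.simps parity.simps by (rule phom_mult)
next
  case (Br u v)
  then show ?case unfolding jeval.simps parity.simps by (rule jbr_phom)
qed

abbreviation epow :: "nat \<Rightarrow> ('x option, 'k::field) poisson \<Rightarrow> ('x option, 'k) poisson" where
  "epow n \<equiv> emul ^^ n"

lemma epow_simps:
  "epow n (x + y) = epow n x + epow n y" "epow n (psc c x) = psc c (epow n x)" "epow n 0 = 0"
  "epow n x * y = epow n (x * y)" "x * epow n y = epow n (x * y)"
  by (induct n) simp_all

lemma epow_phom: "x \<in> phom i \<Longrightarrow> epow n x \<in> phom i"
  by (induct n) (auto intro: phom_emul)

lemma jbr_epow_right: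
  assumes "x \<in> phom i" "y \<in> phom j"
  shows "jbr p (q + 2 * of_nat n) x (epow n y) = epow n (jbr p q x y)"
proof (induct n)
  case (Suc n)
  have "jbr p (q + 2 * of_nat n + 2) x (emul (epow n y)) = emul (jbr p (q + 2 * of_nat n) x (epow n y))"
    by (rule jbr_emul_right[OF assms(1) epow_phom[OF assms(2)]])
  then show ?case using Suc by (simp add: algebra_simps)
qed simp

lemma jbr_epow_left:
  assumes "x \<in> phom i" "y \<in> phom j"
  shows "jbr (p + 2 * of_nat n) q (epow n x) y = epow n (jbr p q x y)"
proof (induct n)
  case (Suc n)
  have "jbr (p + 2 * of_nat n + 2) q (emul (epow n x)) y = emul (jbr (p + 2 * of_nat n) q (epow n x) y)"
    by (rule jbr_emul_left[OF epow_phom[OF assms(1)] assms(2)])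
  then show ?case using Suc by (simp add: algebra_simps)
qed simp

section \<open>Homogenization by powers of e\<close>

definition deg_le :: "nat \<Rightarrow> ('x, 'k::field) free_alg set" where
  "deg_le N = {p. \<forall>w\<in>Poly_Mapping.keys p. deg w \<le> N}"

lemma deg_le_lookup: "p \<in> deg_le N \<longleftrightarrow> (\<forall>w. N < deg w \<longrightarrow> Poly_Mapping.lookup p w = 0)"
  unfolding deg_le_def Ball_def in_keys_iff mem_Collect_eq by (metis not_less)

lemma subspace_deg_le: "FA.subspace (deg_le N)"
  by (auto simp: FA.subspace_def deg_le_lookup lookup_add lookup_scale)

lemma deg_le_word: "deg w \<le> N \<Longrightarrow> word w \<in> deg_le N"
  by (simp add: deg_le_def word_def)

lemma deg_le_mono: "p \<in> deg_le N \<Longrightarrow> N \<le> N' \<Longrightarrow> p \<in> deg_le N'"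
  by (auto simp: deg_le_def)

text \<open>The subtraction is truncated, so the result is the intended one only on
  \<open>deg_le N\<close>.\<close>

definition homogenize :: "('x \<Rightarrow> bit) \<Rightarrow> nat \<Rightarrow> ('x, 'k::field) free_alg \<Rightarrow> ('x option, 'k) poisson" where
  "homogenize par N = PS.lext (\<lambda>w. epow (N - deg w) (jeval par w))"

lemma homogenize_simps:
  "homogenize par N (p + q) = homogenize par N p + homogenize par N q" "homogenize par N (p - q) = homogenize par N p - homogenize par N q"
  "homogenize par N (- p) = - homogenize par N p"
  "homogenize par N (scale c p) = psc c (homogenize par N p)" "homogenize par N (word w) = epow (N - deg w) (jeval par w)"
  "homogenize par N 0 = 0"
  by (simp_all add: homogenize_def PS.lext_add PS.lext_diff PS.lext_uminus PS.lext_scale PS.lext_word PS.lext_zero psc_def)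

lemma homogenize_linear:
  assumes "\<And>x y. F (x + y) = F x + F y" "\<And>c x. F (psc c x) = psc c (F x)"
    and "\<And>p q. G (p + q) = G p + G q" "\<And>c p. G (scale c p) = scale c (G p)"
    and "\<And>w. w \<in> Poly_Mapping.keys p \<Longrightarrow> homogenize par M (G (word w)) = F (homogenize par N (word w))"
  shows "homogenize par M (G p) = F (homogenize par N p)"
proof -
  have F0: "F 0 = 0" and G0: "G 0 = 0" using assms(1)[of 0 0] assms(3)[of 0 0] by simp_all
  have "homogenize par M (G (\<Sum>w\<in>K. scale (Poly_Mapping.lookup p w) (word w))) =
      F (homogenize par N (\<Sum>w\<in>K. scale (Poly_Mapping.lookup p w) (word w)))"
    if "finite K" "K \<subseteq> Poly_Mapping.keys p" for K
    using that by (induct K) (simp_all add: F0 G0 assms homogenize_simps)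
  from this[OF _ subset_refl] show ?thesis by (simp flip: free_alg_eq_sum)
qed

lemma homogenize_raise:
  assumes "p \<in> deg_le N"
  shows "homogenize par (N + k) p = epow k (homogenize par N p)"
proof (rule homogenize_linear[where G = "\<lambda>p. p"])
  fix w assume "w \<in> Poly_Mapping.keys p"
  then have "N + k - deg w = k + (N - deg w)" using assms by (auto simp: deg_le_def)
  then show "homogenize par (N + k) (word w) = epow k (homogenize par N (word w))"
    by (simp add: homogenize_simps funpow_add)
qed (simp_all add: epow_simps)

text \<open>Plays the part of the kernel of the evaluation modulo \<open>e - 1\<close>, without
  forming that quotient: vanishing in one degree persists in all larger ones by
  \<open>null_raise\<close>.\<close>

definition null :: "('x \<Rightarrow> bit) \<Rightarrow> ('x, 'k::field) free_alg set" where
  "null par = {p. \<exists>N. p \<in> deg_le N \<and> homogenize par N p = 0}"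

lemma nullI: "p \<in> deg_le N \<Longrightarrow> homogenize par N p = 0 \<Longrightarrow> p \<in> null par"
  by (auto simp: null_def)

lemma null_raise:
  assumes "p \<in> deg_le N" "homogenize par N p = 0" "N \<le> M" shows "p \<in> deg_le M" "homogenize par M p = 0"
  using deg_le_mono[OF assms(1,3)] homogenize_raise[OF assms(1), of par "M - N"] assms(2,3)
  by (simp_all add: epow_simps)

lemma subspace_null:
  fixes par :: "'x \<Rightarrow> bit"
  shows "FA.subspace (null par :: ('x, 'k::field) free_alg set)"
  unfolding FA.subspace_def
proof (intro conjI ballI allI)
  show "0 \<in> null par" using FA.subspace_0[OF subspace_deg_le] by (intro nullI) (auto simp: homogenize_simps)
  fix p q :: "('x, 'k) free_alg" and c assume "p \<in> null par"
  then obtain N where p: "p \<in> deg_le N" "homogenize par N p = 0" by (auto simp: null_def)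
  show "scale c p \<in> null par"
    using FA.subspace_scale[OF subspace_deg_le p(1)] p(2) by (intro nullI) (auto simp: homogenize_simps)
  assume "q \<in> null par"
  then obtain M where q: "q \<in> deg_le M" "homogenize par M q = 0" by (auto simp: null_def)
  show "p + q \<in> null par"
    using null_raise[OF p, of "max N M"] null_raise[OF q, of "max N M"]
    by (intro nullI[of _ "max N M"] FA.subspace_add[OF subspace_deg_le]) (auto simp: homogenize_simps)
qed

text \<open>Here \<open>G\<close> is the product or bracket with a fixed word, \<open>g\<close> its
  effect on words and \<open>F\<close> its counterpart on the Poisson side. \<open>F\<close> may
  depend on \<open>N\<close>, since an element homogenized to degree \<open>N\<close> enters a
  bracket with weight \<open>2 * N - 1\<close>.\<close>

lemma null_closed:
  fixes par :: "'x \<Rightarrow> bit" and p :: "('x, 'k::field) free_alg" and F :: "nat \<Rightarrow> ('x option, 'k) poisson \<Rightarrow> ('x option, 'k) poisson"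
  assumes p: "p \<in> null par" and G: "\<And>p q. G (p + q) = G p + G q" "\<And>c p. G (scale c p) = scale c (G p)"
    and F: "\<And>N x y. F N (x + y) = F N x + F N y" "\<And>N c x. F N (psc c x) = psc c (F N x)"
    and word: "\<And>w. G (word w) = word (g w)" "\<And>w. deg (g w) = d + deg w"
    and jeval: "\<And>w N. deg w \<le> N \<Longrightarrow>
      F N (epow (N - deg w) (jeval par w)) = epow (N - deg w) (jeval par (g w))"
  shows "G p \<in> null par"
proof -
  obtain N where N: "p \<in> deg_le N" "homogenize par N p = 0" using p by (auto simp: null_def)
  have G0: "G 0 = 0" using G(1)[of 0 0] by simp
  have le: "G (\<Sum>w\<in>K. scale (Poly_Mapping.lookup p w) (word w)) \<in> deg_le (d + N)"
    if "finite K" "K \<subseteq> Poly_Mapping.keys p" for K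
    using that
  proof (induct K)
    case empty
    then show ?case using FA.subspace_0[OF subspace_deg_le] by (simp add: G0)
  next
    case (insert w K)
    then have "deg (g w) \<le> d + N" using N(1) word(2) by (auto simp: deg_le_def)
    then show ?case using insert
      by (simp add: G word FA.subspace_add[OF subspace_deg_le] FA.subspace_scale[OF subspace_deg_le] deg_le_word)
  qed
  have "G p \<in> deg_le (d + N)" using le[OF _ subset_refl] by (simp flip: free_alg_eq_sum)
  moreover have "homogenize par (d + N) (G p) = F N (homogenize par N p)"
  proof (rule homogenize_linear[OF F G])
    fix w assume "w \<in> Poly_Mapping.keys p"
    then have "deg w \<le> N" using N(1) by (auto simp: deg_le_def)
    then show "homogenize par (d + N) (G (word w)) = F N (homogenize par N (word w))"
      using jeval by (simp add: word homogenize_simps)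
  qed
  moreover have "F N 0 = 0" using F(1)[of N 0 0] by simp
  ultimately show ?thesis using N(2) by (intro nullI) auto
qed

lemma weight_raise: "deg w \<le> N \<Longrightarrow> 2 * of_nat N - 1 = weight w + 2 * of_nat (N - deg w)"
  by (simp add: weight_def of_nat_diff algebra_simps)

lemma null_word:
  assumes p: "p \<in> null par"
  shows "mul (word u) p \<in> null par" "mul p (word u) \<in> null par"
    "br (word u) p \<in> null par" "br p (word u) \<in> null par"
proof -
  have right: "jbr (weight u) (2 * of_nat N - 1) (jeval par u) (epow (N - deg w) (jeval par w)) =
      epow (N - deg w) (jeval par (Br u w))"
    and left: "jbr (2 * of_nat N - 1) (weight u) (epow (N - deg w) (jeval par w)) (jeval par u) =
      epow (N - deg w) (jeval par (Br w u))" if "deg w \<le> N" for w N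
    unfolding weight_raise[OF that] jbr_epow_right[OF jeval_phom jeval_phom]
      jbr_epow_left[OF jeval_phom jeval_phom] jeval.simps by (rule refl)+
  show "mul (word u) p \<in> null par"
    by (rule null_closed[OF p, where g = "Mul u" and d = "deg u" and F = "\<lambda>N x. jeval par u * x"])
      (simp_all add: mul_simps epow_simps distrib_left)
  show "mul p (word u) \<in> null par"
    by (rule null_closed[OF p, where g = "\<lambda>w. Mul w u" and d = "deg u" and F = "\<lambda>N x. x * jeval par u"])
      (simp_all add: mul_simps epow_simps distrib_right)
  show "br (word u) p \<in> null par"
    by (rule null_closed[OF p, where g = "Br u" and d = "deg u"
          and F = "\<lambda>N x. jbr (weight u) (2 * of_nat N - 1) (jeval par u) x"])
      (simp_all add: br_simps jbr_add jbr_psc right del: jeval.simps)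
  show "br p (word u) \<in> null par"
    by (rule null_closed[OF p, where g = "\<lambda>w. Br w u" and d = "deg u"
          and F = "\<lambda>N x. jbr (2 * of_nat N - 1) (weight u) x (jeval par u)"])
      (simp_all add: br_simps jbr_add jbr_psc left del: jeval.simps)
qed

lemma null_ideal:
  assumes "p \<in> null par"
  shows "mul a p \<in> null par" "mul p a \<in> null par" "br a p \<in> null par" "br p a \<in> null par"
  by (induct a rule: free_alg_induct;
      simp add: mul_simps br_simps null_word[OF assms] FA.subspace_add[OF subspace_null] FA.subspace_scale[OF subspace_null])+

section \<open>The defining relations become null\<close>

lemma homogeneous_extend:
  assumes "a \<in> homogeneous par s" "FA.subspace S"
    and "\<And>p q. L (p + q) = L p + L q" "\<And>c p. L (scale c p) = scale c (L p)"
    and "\<And>w. parity par w = s \<Longrightarrow> L (word w) \<in> S"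
  shows "L a \<in> S"
proof -
  have "L 0 = 0" using assms(3)[of 0 0] by simp
  then have "FA.subspace {p. L p \<in> S}" using assms(2-4) by (auto simp: FA.subspace_def)
  then have "FA.span (word ` Poly_Mapping.keys a) \<subseteq> {p. L p \<in> S}"
    using assms(1,5) by (intro FA.span_minimal) (auto simp: homogeneous_def)
  then show ?thesis using free_alg_in_span by blast
qed

lemma free_extend:
  assumes "FA.subspace S" "\<And>p q. L (p + q) = L p + L q" "\<And>c p. L (scale c p) = scale c (L p)"
    and "\<And>w. L (word w) \<in> S"
  shows "L a \<in> S"
  by (induct a rule: free_alg_induct)
    (simp_all add: assms FA.subspace_add[OF assms(1)] FA.subspace_scale[OF assms(1)])

lemmas deg_le_closed = FA.subspace_add[OF subspace_deg_le] FA.subspace_diff[OF subspace_deg_le]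
  FA.subspace_scale[OF subspace_deg_le] FA.subspace_neg[OF subspace_deg_le] deg_le_word

lemma jbr_weight_unit: "jbr (weight a) 1 x unit_letter = emul (der x)"
  using jbr_unit[of "weight a" x] by simp

lemma null_relations:
  assumes "p \<in> JB_relations par" shows "p \<in> null par"
  using assms
proof induct
  case (assoc a b c)
  let ?L = "\<lambda>a b c. mul (mul a b) c - mul a (mul b c)"
  have 0: "?L (word u) (word v) (word w) \<in> null par" for u v w
    unfolding mul_simps
    by (rule nullI[of _ "deg u + deg v + deg w"]) (auto intro!: deg_le_closed simp: homogenize_simps mult.assoc)
  have 1: "?L (word u) (word v) c \<in> null par" for u v
    by (rule free_extend[where L = "?L (word u) (word v)", OF subspace_null _ _ 0]) (simp_all add: mul_simps algebra_simps)
  have 2: "?L (word u) b c \<in> null par" for u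
    by (rule free_extend[where L = "\<lambda>b. ?L (word u) b c", OF subspace_null _ _ 1]) (simp_all add: mul_simps algebra_simps)
  show ?case
    by (rule free_extend[where L = "\<lambda>a. ?L a b c", OF subspace_null _ _ 2]) (simp_all add: mul_simps algebra_simps)
next
  case (unit a)
  let ?L = "\<lambda>a. mul (word One) a - a"
  have 0: "mul (word One) (word w) - word w \<in> null par" for w
    unfolding mul_simps
    by (rule nullI[of _ "1 + deg w"]) (auto intro!: deg_le_closed simp: homogenize_simps emul_def)
  show ?case
    by (rule free_extend[where L = "?L", OF subspace_null _ _ 0]) (simp_all add: mul_simps algebra_simps)
next
  case (supercomm a s b t)
  let ?L = "\<lambda>a b. mul a b - scale (sg (s * t)) (mul b a)"
  have 0: "mul (word u) (word v) - scale (sg (s * t)) (mul (word v) (word u)) \<in> null par"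
    if "parity par u = s" "parity par v = t" for u v
    unfolding mul_simps
    by (rule nullI[of _ "deg u + deg v"])
      (use pmult_commute[OF jeval_phom jeval_phom, of par u par v] that in
        \<open>auto intro!: deg_le_closed simp: homogenize_simps\<close>)
  have 1: "mul (word u) b - scale (sg (s * t)) (mul b (word u)) \<in> null par" if "parity par u = s" for u
    by (rule homogeneous_extend[where L = "?L (word u)", OF supercomm(2) subspace_null _ _ 0[OF that]])
      (simp_all add: mul_simps algebra_simps)
  show ?case
    by (rule homogeneous_extend[where L = "\<lambda>a. ?L a b", OF supercomm(1) subspace_null _ _ 1])
      (simp_all add: mul_simps algebra_simps)
next
  case (superanticomm a s b t)
  let ?L = "\<lambda>a b. br a b - (- scale (sg (s * t)) (br b a))"
  have 0: "br (word u) (word v) - (- scale (sg (s * t)) (br (word v) (word u))) \<in> null par"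
    if "parity par u = s" "parity par v = t" for u v
    unfolding br_simps
    by (rule nullI[of _ "deg u + deg v"])
      (use jbr_anti[OF jeval_phom jeval_phom, of "weight u" "weight v" par u par v] that in
        \<open>auto intro!: deg_le_closed simp: homogenize_simps\<close>)
  have 1: "br (word u) b - (- scale (sg (s * t)) (br b (word u))) \<in> null par" if "parity par u = s" for u
    by (rule homogeneous_extend[where L = "?L (word u)", OF superanticomm(2) subspace_null _ _ 0[OF that]])
      (simp_all add: br_simps algebra_simps)
  show ?case
    by (rule homogeneous_extend[where L = "\<lambda>a. ?L a b", OF superanticomm(1) subspace_null _ _ 1])
      (simp_all add: br_simps algebra_simps)
next
  case (leibniz a s b t c r)
  let ?L = "\<lambda>a b c. br a (mul b c) -
       (mul (br a b) c + scale (sg (s * t)) (mul b (br a c)) - mul (mul (D_op a) b) c)"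
  \<comment> \<open>The common degree exceeds that of the three words by 1, because the term with
    \<open>D\<close> contains the additional letter \<open>1\<close>.\<close>
  have 0: "?L (word u) (word v) (word w) \<in> null par"
    if "parity par u = s" "parity par v = t" "parity par w = r" for u v w
    unfolding br_simps mul_simps D_op_def
    by (rule nullI[of _ "deg u + deg v + deg w + 1"])
      (use jbr_leibniz[OF jeval_phom jeval_phom jeval_phom, of "weight u" "weight v" "weight w" par u par v par w] that in
        \<open>auto intro!: deg_le_closed simp: homogenize_simps weight_simps jbr_weight_unit mult.assoc\<close>)
  have 1: "?L (word u) (word v) c \<in> null par" if "parity par u = s" "parity par v = t" for u v
    by (rule homogeneous_extend[where L = "?L (word u) (word v)", OF leibniz(3) subspace_null _ _ 0[OF that]])
      (simp_all add: br_simps mul_simps D_op_def algebra_simps)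
  have 2: "?L (word u) b c \<in> null par" if "parity par u = s" for u
    by (rule homogeneous_extend[where L = "\<lambda>b. ?L (word u) b c", OF leibniz(2) subspace_null _ _ 1[OF that]])
      (simp_all add: br_simps mul_simps D_op_def algebra_simps)
  show ?case
    by (rule homogeneous_extend[where L = "\<lambda>a. ?L a b c", OF leibniz(1) subspace_null _ _ 2])
      (simp_all add: br_simps mul_simps D_op_def algebra_simps)
next
  case (jacobi a s b t c r)
  let ?L = "\<lambda>a b c. br a (br b c) -
       (br (br a b) c + scale (sg (s * t)) (br b (br a c)) + mul (D_op a) (br b c)
        + scale (sg (s * (t + r))) (mul (D_op b) (br c a))
        + scale (sg (r * (s + t))) (mul (D_op c) (br a b)))"
  have 0: "?L (word u) (word v) (word w) \<in> null par"
    if "parity par u = s" "parity par v = t" "parity par w = r" for u v w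
    unfolding br_simps mul_simps D_op_def
    by (rule nullI[of _ "deg u + deg v + deg w + 1"])
      (use jbr_jacobi[OF jeval_phom jeval_phom jeval_phom, of "weight u" "weight v" "weight w" par u par v par w] that in
        \<open>auto intro!: deg_le_closed simp: homogenize_simps weight_simps jbr_weight_unit\<close>)
  have 1: "?L (word u) (word v) c \<in> null par" if "parity par u = s" "parity par v = t" for u v
    by (rule homogeneous_extend[where L = "?L (word u) (word v)", OF jacobi(3) subspace_null _ _ 0[OF that]])
      (simp_all add: br_simps mul_simps D_op_def algebra_simps)
  have 2: "?L (word u) b c \<in> null par" if "parity par u = s" for u
    by (rule homogeneous_extend[where L = "\<lambda>b. ?L (word u) b c", OF jacobi(2) subspace_null _ _ 1[OF that]])
      (simp_all add: br_simps mul_simps D_op_def algebra_simps)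
  show ?case
    by (rule homogeneous_extend[where L = "\<lambda>a. ?L a b c", OF jacobi(1) subspace_null _ _ 2])
      (simp_all add: br_simps mul_simps D_op_def algebra_simps)
qed

theorem JB_ideal_null: "p \<in> JB_ideal par \<Longrightarrow> p \<in> null par"
  by (induct rule: JB_ideal.induct)
    (auto intro: null_relations null_ideal FA.subspace_0[OF subspace_null] FA.subspace_add[OF subspace_null]
      FA.subspace_scale[OF subspace_null])


section \<open>Linear independence of the ordered monomials\<close>

interpretation PV: vector_space "psc :: 'k::field \<Rightarrow> ('y, 'k) poisson \<Rightarrow> ('y, 'k) poisson"
  by unfold_locales simp_all

lemma poisson_span_image:
  assumes "x \<in> PV.span A" "PV.subspace S" "\<And>x y. h (x + y) = h x + h y" "\<And>c x. h (psc c x) = psc c (h x)"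
    "\<And>a. a \<in> A \<Longrightarrow> h a \<in> S"
  shows "h x \<in> S"
proof -
  have "h 0 = 0" using assms(3)[of 0 0] by simp
  then have "PV.subspace {x. h x \<in> S}" using assms(2-4) by (auto simp: PV.subspace_def)
  then have "PV.span A \<subseteq> {x. h x \<in> S}" by (rule PV.span_minimal[rotated]) (use assms(5) in auto)
  then show ?thesis using assms(1) by blast
qed

definition lie_symbol :: "('x \<Rightarrow> bit) \<Rightarrow> 'x nword \<Rightarrow> ('x option, 'k::field) poisson" where
  "lie_symbol par w = symbol (lie_eval par w)"

definition prod_symbol :: "('x \<Rightarrow> bit) \<Rightarrow> 'x nword list \<Rightarrow> ('x option, 'k::field) poisson" where
  "prod_symbol par ws = symbol (lie_prod par ws)"

lemma prod_symbol_simps [simp]: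
  "prod_symbol par [] = 1" "prod_symbol par (w # ws) = lie_symbol par w * prod_symbol par ws"
  "prod_symbol par (vs @ ws) = prod_symbol par vs * prod_symbol par ws"
  by (simp_all add: prod_symbol_def lie_symbol_def one_poisson.abs_eq symbol_simps rees_lie_eval rees_lie_prod)

lemma lie_symbol_One: "lie_symbol par One = unit_letter"
  by (simp add: lie_symbol_def unit_letter_def)

lemma lie_symbol_Br: "lie_symbol par (Br u v) = pbr (lie_symbol par u) (lie_symbol par v)"
  by (simp add: lie_symbol_def symbol_simps rees_lie_eval)

lemma lie_symbol_phom: "lie_symbol par w \<in> phom (parity par w)"
  unfolding lie_symbol_def by (intro phomI rees_lie_eval lie_eval_hom)

lemma prod_symbol_phom: "prod_symbol par ws \<in> phom (sum_list (map (parity par) ws))"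
  unfolding prod_symbol_def by (intro phomI rees_lie_prod lie_prod_hom)

lemma prod_symbol_independent:
  fixes par :: "'x::{finite,linorder} \<Rightarrow> bit" and c :: "'x nword list \<Rightarrow> 'k::field_char_0"
  assumes F: "finite F" "F \<subseteq> sorted_M par" and sum: "(\<Sum>vs\<in>F. psc (c vs) (prod_symbol par vs)) = 0" and "us \<in> F"
  shows "c us = 0"
proof -
  let ?f = "\<lambda>F. \<Sum>vs\<in>F. cst (c vs) * (lie_prod par vs :: ('x option, 'k) laurent)"
  have "?f F \<in> rees \<and> symbol (?f F) = (\<Sum>vs\<in>F. psc (c vs) (prod_symbol par vs))"
    using F(1)
    by induct (simp_all add: rees_zero zero_poisson.abs_eq rees.add rees.cst rees_lie_prod rees_cst symbol_simps
        symbol_cst psc_def prod_symbol_def)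
  then have "?f F - 0 \<in> rees_ideal"
    using sum symbol_eq_iff[OF _ rees_zero, of "?f F"] by (simp add: zero_poisson.abs_eq)
  then obtain r where "r \<in> rees" "?f F = tpow 1 * r" by (auto elim: rees_idealE)
  then show ?thesis using ord_prods_independent_rees[OF F] \<open>us \<in> F\<close> by blast
qed

lemma prod_symbol_notin_span:
  fixes par :: "'x::{finite,linorder} \<Rightarrow> bit"
  assumes us: "us \<in> sorted_M par"
  shows "(prod_symbol par us :: ('x option, 'k::field_char_0) poisson) \<notin>
    PV.span (prod_symbol par ` (sorted_M par - {us}))"
proof
  assume "(prod_symbol par us :: ('x option, 'k) poisson) \<in> PV.span (prod_symbol par ` (sorted_M par - {us}))"
  then obtain T and r :: "('x option, 'k) poisson \<Rightarrow> 'k" where T: "finite T"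
      "T \<subseteq> prod_symbol par ` (sorted_M par - {us})" "prod_symbol par us = (\<Sum>a\<in>T. psc (r a) a)"
    unfolding PV.span_explicit by blast
  then obtain F where F: "F \<subseteq> sorted_M par - {us}" "inj_on (prod_symbol par :: _ \<Rightarrow> ('x option, 'k) poisson) F"
      "T = prod_symbol par ` F"
    by (auto simp: subset_image_inj)
  have fin: "finite F" using T(1) F(2,3) finite_imageD by blast
  let ?c = "\<lambda>vs. if vs = us then - 1 else r (prod_symbol par vs)"
  have notin: "us \<notin> F" using F(1) by blast
  have "(\<Sum>vs\<in>F. psc (?c vs) (prod_symbol par vs)) = (\<Sum>vs\<in>F. psc (r (prod_symbol par vs)) (prod_symbol par vs))"
    using notin by (intro sum.cong) auto
  also have "\<dots> = prod_symbol par us"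
    unfolding T(3) F(3) by (subst sum.reindex[OF F(2)]) simp
  finally have "(\<Sum>vs\<in>insert us F. psc (?c vs) (prod_symbol par vs)) = (0 :: ('x option, 'k) poisson)"
    using fin notin by simp
  then have "?c us = 0"
    using fin F(1) us by (intro prod_symbol_independent[of "insert us F" par ?c]) auto
  then show False by simp
qed

section \<open>The filtration by the number of factors other than e\<close>

definition proper_length :: "'x nword list \<Rightarrow> nat" where
  "proper_length ws = length (filter (\<lambda>w. w \<noteq> One) ws)"

lemma proper_length_simps [simp]:
  "proper_length [] = 0" "proper_length (w # ws) = (if w = One then 0 else 1) + proper_length ws"
  "proper_length (vs @ ws) = proper_length vs + proper_length ws"
  by (simp_all add: proper_length_def)

text \<open>
  Modulo \<open>e - 1\<close>, the subspace \<open>aug par r\<close> is the \<open>r\<close>-th power of the augmentation ideal.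
\<close>

definition aug :: "('x::linorder \<Rightarrow> bit) \<Rightarrow> nat \<Rightarrow> ('x option, 'k::field) poisson set" where
  "aug par r = PV.span {prod_symbol par ws | ws. set ws \<subseteq> M_words par \<and> r \<le> proper_length ws}"

lemma subspace_aug: "PV.subspace (aug par r)"
  by (simp add: aug_def)

lemmas aug_closed = PV.subspace_add[OF subspace_aug] PV.subspace_diff[OF subspace_aug]
  PV.subspace_scale[OF subspace_aug] PV.subspace_neg[OF subspace_aug] PV.subspace_0[OF subspace_aug]

lemma aug_prod: "set ws \<subseteq> M_words par \<Longrightarrow> r \<le> proper_length ws \<Longrightarrow>
    (prod_symbol par ws :: ('x::linorder option, 'k::field) poisson) \<in> aug par r"
  unfolding aug_def by (intro PV.span_base) blast

lemma aug_mono: "x \<in> aug par r \<Longrightarrow> s \<le> r \<Longrightarrow> x \<in> aug par s"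
  unfolding aug_def by (erule subsetD[OF PV.span_mono, rotated]) auto

lemma aug_linear:
  fixes x :: "('x::linorder option, 'k::field) poisson"
  assumes "x \<in> aug par r" "PV.subspace S" "\<And>x y. h (x + y) = h x + h y" "\<And>c x. h (psc c x) = psc c (h x)"
    "\<And>ws. set ws \<subseteq> M_words par \<Longrightarrow> r \<le> proper_length ws \<Longrightarrow> h (prod_symbol par ws) \<in> S"
  shows "h x \<in> S"
  using assms(1) unfolding aug_def by (rule poisson_span_image[OF _ assms(2-4)]) (use assms(5) in blast)

lemma aug_mult:
  fixes x y :: "('x::linorder option, 'k::field) poisson"
  assumes "x \<in> aug par r" "y \<in> aug par s" shows "x * y \<in> aug par (r + s)"
proof (rule aug_linear[OF assms(1) subspace_aug])
  fix vs assume vs: "set vs \<subseteq> M_words par" "r \<le> proper_length vs"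
  show "prod_symbol par vs * y \<in> aug par (r + s)"
  proof (rule aug_linear[OF assms(2) subspace_aug])
    fix ws assume "set ws \<subseteq> M_words par" "s \<le> proper_length ws"
    then show "prod_symbol par vs * prod_symbol par ws \<in> (aug par (r + s) :: ('x option, 'k) poisson set)"
      using vs aug_prod[of "vs @ ws" par "r + s", where 'k = 'k] by simp
  qed (simp_all add: distrib_left)
qed (simp_all add: distrib_right)

lemma aug_lie_symbol:
  "w \<in> M_words par \<Longrightarrow>
    (lie_symbol par w :: ('x::linorder option, 'k::field) poisson) \<in> aug par (if w = One then 0 else 1)"
  using aug_prod[of "[w]" par "if w = One then 0 else 1"] by simp

lemma aug_emul:
  fixes x :: "('x::linorder option, 'k::field) poisson"
  assumes "x \<in> aug par r" shows "emul x \<in> aug par r"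
proof -
  have "One \<in> M_words par" by (simp add: M_words_iff)
  from aug_mult[OF aug_lie_symbol[OF this] assms] show ?thesis
    by (simp add: emul_def lie_symbol_One)
qed

lemma aug_epow: "x \<in> aug par r \<Longrightarrow> epow n x \<in> aug par r"
  by (induct n) (auto intro: aug_emul)

text \<open>A bracket of two words has degree at least 2, so it is a combination of Lie words
  different from \<open>e\<close>, even if one argument is \<open>e\<close> itself.\<close>

lemma aug_bracket_words:
  fixes par :: "'x::{finite,linorder} \<Rightarrow> bit"
  assumes "u \<in> M_words par" "v \<in> M_words par"
  shows "pbr (lie_symbol par u) (lie_symbol par v) \<in> (aug par 1 :: ('x option, 'k::field_char_0) poisson set)"
proof -
  let ?S = "{f :: ('x option, 'k) laurent. f \<in> rees \<and> symbol f \<in> aug par 1}"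
  have "CV.subspace ?S"
    by (auto simp: CV.subspace_def rees_zero rees.add rees.cst symbol_simps rees_cst symbol_cst aug_closed
        simp flip: zero_poisson.abs_eq psc_def)
  then have "CV.span (lie_eval par ` {w \<in> M_words par. deg w = deg u + deg v}) \<subseteq> ?S"
  proof (rule CV.span_minimal[rotated], safe)
    fix w assume w: "w \<in> M_words par" "deg w = deg u + deg v"
    have "deg w \<noteq> 1" using w(2) deg_add_gt(1)[of u v] by linarith
    then have "w \<noteq> One" by auto
    then show "symbol (lie_eval par w) \<in> (aug par 1 :: ('x option, 'k) poisson set)"
      using aug_lie_symbol[OF w(1), where 'k = 'k] by (simp add: lie_symbol_def)
  qed (rule rees_lie_eval)
  then show ?thesis using lie_eval_bracket[OF assms, where 'k = 'k] unfolding lie_symbol_Br[symmetric]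
    by (auto simp: lie_symbol_def)
qed

lemma aug_bracket_word_prod:
  fixes par :: "'x::{finite,linorder} \<Rightarrow> bit"
  assumes "u \<in> M_words par" "set ws \<subseteq> M_words par"
  shows "pbr (lie_symbol par u) (prod_symbol par ws) \<in>
    (aug par (proper_length ws) :: ('x option, 'k::field_char_0) poisson set)"
  using assms(2)
proof (induct ws)
  case Nil
  have "pbr (lie_symbol par u) 1 = (0 :: ('x option, 'k) poisson)"
    unfolding lie_symbol_def one_poisson.abs_eq zero_poisson.abs_eq
    by (simp add: symbol_simps(5)[OF rees_lie_eval rees.one, symmetric])
  then show ?case by (simp add: aug_closed)
next
  case (Cons w ws)
  have w: "w \<in> M_words par" "set ws \<subseteq> M_words par" using Cons.prems by auto
  have "pbr (lie_symbol par u) (lie_symbol par w) * prod_symbol par ws \<in> (aug par (1 + proper_length ws) :: ('x option, 'k) poisson set)"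
    using assms(1) w by (intro aug_mult aug_bracket_words aug_prod) auto
  moreover have "lie_symbol par w * pbr (lie_symbol par u) (prod_symbol par ws) \<in>
      (aug par ((if w = One then 0 else 1) + proper_length ws) :: ('x option, 'k) poisson set)"
    using w by (intro aug_mult aug_lie_symbol Cons.hyps)
  ultimately show ?case
    unfolding prod_symbol_simps pbr_leibniz[OF lie_symbol_phom lie_symbol_phom prod_symbol_phom]
    by (intro aug_closed) (auto elim!: aug_mono)
qed

lemma aug_der:
  fixes par :: "'x::{finite,linorder} \<Rightarrow> bit" and x :: "('x option, 'k::field_char_0) poisson"
  assumes "x \<in> aug par r" shows "der x \<in> aug par r"
proof (rule aug_linear[OF assms subspace_aug])
  fix ws assume ws: "set ws \<subseteq> M_words par" "r \<le> proper_length ws"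
  have "One \<in> M_words par" by (simp add: M_words_iff)
  from aug_bracket_word_prod[OF this ws(1), where 'k = 'k]
  have "- der (prod_symbol par ws) \<in> (aug par (proper_length ws) :: ('x option, 'k) poisson set)"
    by (simp add: lie_symbol_One pbr_unit_letter[OF prod_symbol_phom])
  then have "- (- der (prod_symbol par ws)) \<in> (aug par (proper_length ws) :: ('x option, 'k) poisson set)"
    by (rule aug_closed)
  then show "der (prod_symbol par ws) \<in> (aug par r :: ('x option, 'k) poisson set)"
    using ws(2) by (simp add: aug_mono)
qed simp_all

text \<open>A bracket merges two factors into one proper factor, so at most one proper factor is
  lost. If one of the two merged factors is \<open>e\<close>, none is lost, as in
  \<open>aug_der\<close>.\<close>

lemma aug_pbr:
  fixes par :: "'x::{finite,linorder} \<Rightarrow> bit" and x y :: "('x option, 'k::field_char_0) poisson"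
  assumes "x \<in> aug par r" "y \<in> aug par s" shows "pbr x y \<in> aug par (r + s - 1)"
proof -
  let ?A = "aug par :: nat \<Rightarrow> ('x option, 'k) poisson set"
  have main: "pbr (prod_symbol par vs) (prod_symbol par ws) \<in> ?A (proper_length vs + proper_length ws - 1)"
    if "set vs \<subseteq> M_words par" "set ws \<subseteq> M_words par" for vs ws
    using that(2)
  proof (induct ws)
    case Nil
    have "pbr (prod_symbol par vs) 1 = (0 :: ('x option, 'k) poisson)"
      unfolding prod_symbol_def one_poisson.abs_eq zero_poisson.abs_eq
      by (simp add: symbol_simps(5)[OF rees_lie_prod rees.one, symmetric])
    then show ?case by (simp add: aug_closed)
  next
    case (Cons w ws)
    have w: "w \<in> M_words par" "set ws \<subseteq> M_words par" using Cons.prems by auto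
    have "pbr (prod_symbol par vs) (lie_symbol par w) \<in> ?A (proper_length vs)"
      unfolding pbr_anti[OF prod_symbol_phom lie_symbol_phom]
      by (intro aug_closed aug_bracket_word_prod w that)
    then have "pbr (prod_symbol par vs) (lie_symbol par w) * prod_symbol par ws \<in> ?A (proper_length vs + proper_length ws)"
      using w by (intro aug_mult aug_prod) auto
    moreover have "lie_symbol par w * pbr (prod_symbol par vs) (prod_symbol par ws) \<in>
        ?A ((if w = One then 0 else 1) + (proper_length vs + proper_length ws - 1))"
      using w by (intro aug_mult aug_lie_symbol Cons.hyps)
    ultimately show ?case
      unfolding prod_symbol_simps pbr_leibniz[OF prod_symbol_phom lie_symbol_phom prod_symbol_phom]
      by (intro aug_closed) (auto elim!: aug_mono)
  qed
  show ?thesis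
  proof (rule aug_linear[OF assms(1) subspace_aug])
    fix vs assume vs: "set vs \<subseteq> M_words par" "r \<le> proper_length vs"
    show "pbr (prod_symbol par vs) y \<in> ?A (r + s - 1)"
    proof (rule aug_linear[OF assms(2) subspace_aug])
      fix ws assume "set ws \<subseteq> M_words par" "s \<le> proper_length ws"
      then show "pbr (prod_symbol par vs) (prod_symbol par ws) \<in> ?A (r + s - 1)"
        using vs by (intro aug_mono[OF main]) auto
    qed (simp_all add: pbr_add pbr_psc)
  qed (simp_all add: pbr_add pbr_psc)
qed

text \<open>In the quotient by \<open>t\<close> neighbours supercommute exactly, so sorting needs no
  corrections, unlike in \<open>lie_prod_in_span\<close>, and the number of proper factors is
  preserved.\<close>

lemma prod_symbol_sorted:
  fixes par :: "'x::linorder \<Rightarrow> bit"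
  assumes "set ws \<subseteq> M_words par"
  shows "(prod_symbol par ws :: ('x option, 'k::field_char_0) poisson) \<in>
    PV.span (prod_symbol par ` {vs \<in> sorted_M par. proper_length vs = proper_length ws})"
proof -
  let ?f = "prod_symbol par :: _ \<Rightarrow> ('x option, 'k) poisson"
  have swap: "?f (xs @ a # b # ys) = psc (sg (parity par a * parity par b)) (?f (xs @ b # a # ys))" for xs a b ys
  proof -
    have "?f (xs @ a # b # ys) = ?f xs * (lie_symbol par a * lie_symbol par b * ?f ys)"
      by (simp add: mult.assoc)
    also have "\<dots> = psc (sg (parity par a * parity par b)) (?f (xs @ b # a # ys))"
      unfolding pmult_commute[OF lie_symbol_phom[of par a] lie_symbol_phom[of par b]] by (simp add: mult.assoc)
    finally show ?thesis .
  qed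
  have "?f ws \<in> {0} \<or> (\<exists>vs\<in>sorted_M par. mset vs = mset ws \<and> (?f ws - ?f vs \<in> {0} \<or> ?f ws + ?f vs \<in> {0}))"
  proof (rule sort_M_words)
    show "?f (xs @ a # b # ys) - ?f (xs @ b # a # ys) \<in> {0} \<or> ?f (xs @ a # b # ys) + ?f (xs @ b # a # ys) \<in> {0}"
      for xs ys a b
    proof -
      obtain s :: 'k where "s = 1 \<or> s = - 1" "?f (xs @ a # b # ys) = psc s (?f (xs @ b # a # ys))"
        using swap[of xs a b ys] sg_cases by blast
      then show ?thesis by (elim disjE) (simp_all del: prod_symbol_simps)
    qed
    show "?f (xs @ a # a # ys) \<in> {0}" if "parity par a = 1" for xs ys a
    proof -
      let ?x = "?f (xs @ a # a # ys)"
      have "?x = - ?x" using swap[of xs a a ys] that by simp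
      then have "?x + ?x = 0" by (metis add.right_inverse)
      then have "psc (1 / 2) (?x + ?x) = 0" by simp
      moreover have "psc (1 / 2) (?x + ?x) = psc (1 / 2 + 1 / 2) ?x" by (simp only: psc_simps)
      ultimately show ?thesis by simp
    qed
  qed (use assms in auto)
  then show ?thesis
  proof (elim disjE bexE conjE)
    assume "?f ws \<in> {0}" then show ?thesis by (simp add: PV.span_zero)
  next
    fix vs assume vs: "vs \<in> sorted_M par" "mset vs = mset ws"
    have "proper_length vs = proper_length ws"
      unfolding proper_length_def using vs(2) by (metis mset_filter size_mset)
    with vs(1) have v: "?f vs \<in> PV.span (?f ` {vs \<in> sorted_M par. proper_length vs = proper_length ws})"
      by (intro PV.span_base) blast
    {
      assume "?f ws - ?f vs \<in> {0}"
      then show ?thesis using v by simp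
    next
      assume "?f ws + ?f vs \<in> {0}"
      then have "?f ws = - ?f vs" by (simp add: eq_neg_iff_add_eq_0)
      then show ?thesis using PV.span_neg[OF v] by simp
    }
  qed
qed

lemma aug_sorted:
  fixes par :: "'x::linorder \<Rightarrow> bit"
  assumes "x \<in> (aug par r :: ('x option, 'k::field_char_0) poisson set)"
  shows "x \<in> PV.span (prod_symbol par ` {vs \<in> sorted_M par. r \<le> proper_length vs})"
  using assms
proof (rule aug_linear[where h = "\<lambda>x. x"])
  fix ws assume "set ws \<subseteq> M_words par" "r \<le> proper_length ws"
  then show "(prod_symbol par ws :: ('x option, 'k) poisson) \<in>
      PV.span (prod_symbol par ` {vs \<in> sorted_M par. r \<le> proper_length vs})"
    by (intro subsetD[OF PV.span_mono prod_symbol_sorted]) auto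
qed simp_all


section \<open>Leading terms of evaluated words\<close>

lemma der_epow: "x \<in> phom i \<Longrightarrow> der (epow n x) = epow n (der x)"
  by (induct n) (simp_all add: der_emul[OF epow_phom])

text \<open>Moving a power of \<open>e\<close> out of a bracket costs terms in which
  \<open>der\<close> of one argument is multiplied by the other; these have two proper
  factors.\<close>

lemma pbr_epow_cong:
  fixes par :: "'x::{finite,linorder} \<Rightarrow> bit" and x y :: "('x option, 'k::field_char_0) poisson"
  assumes x: "x \<in> phom i" "x \<in> aug par 1" and y: "y \<in> phom j" "y \<in> aug par 1"
  shows "pbr (epow m x) (epow n y) - epow (m + n) (pbr x y) \<in> aug par 2"
proof -
  let ?A = "aug par 2 :: ('x option, 'k) poisson set"
  have two: "a * b \<in> ?A" if "a \<in> aug par 1" "b \<in> aug par 1" for a b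
    using aug_mult[OF that] by (simp add: numeral_2_eq_2)
  have right: "pbr x (epow n y) - epow n (pbr x y) \<in> ?A" for n
  proof (induct n)
    case (Suc n)
    have eq: "pbr x (epow (Suc n) y) - epow (Suc n) (pbr x y) =
        der x * epow n y + emul (pbr x (epow n y) - epow n (pbr x y))"
      using pbr_emul_right[OF x(1) epow_phom[OF y(1)], of n] by simp
    show ?case unfolding eq using x y
      by (intro aug_closed(1) two aug_der aug_epow aug_emul[OF Suc])
  qed (simp add: aug_closed)
  show ?thesis
  proof (induct m)
    case 0
    then show ?case using right by simp
  next
    case (Suc m)
    have eq: "pbr (epow (Suc m) x) (epow n y) - epow (Suc m + n) (pbr x y) =
        emul (pbr (epow m x) (epow n y) - epow (m + n) (pbr x y)) - epow m x * der (epow n y)"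
      using pbr_emul_left[OF epow_phom[OF x(1)] epow_phom[OF y(1)], of m n] by simp
    show ?case unfolding eq using x y
      by (intro aug_closed(2) two aug_der aug_epow aug_emul[OF Suc])
  qed
qed

text \<open>Of the three terms of \<open>jbr\<close>, the two with \<open>der\<close> are products
  of two proper factors, so only \<open>2 e {x, y}\<close> counts: the coefficient of a bracket is
  twice the product of those of its factors. A bracket with the letter \<open>1\<close> evaluates to
  \<open>e * der x\<close> and keeps the coefficient.\<close>

lemma jeval_leading:
  fixes par :: "'x::{finite,linorder} \<Rightarrow> bit"
  assumes "w \<in> M_words par" "w \<noteq> One"
  shows "\<exists>c. c \<noteq> 0 \<and> jeval par w - psc c (epow (deg w - 1) (lie_symbol par w)) \<in>
    (aug par 2 :: ('x option, 'k::field_char_0) poisson set)"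
  using assms
proof (induct w)
  case (Gen x)
  show ?case by (intro exI[of _ 1]) (simp add: lie_symbol_def aug_closed)
next
  case (Mul u v)
  then show ?case by (auto simp: M_words_iff)
next
  case (Br u v)
  let ?A = "aug par :: nat \<Rightarrow> ('x option, 'k) poisson set"
  have M: "u \<in> M_words par" "v \<in> M_words par" using Br.prems(1) by (auto simp: M_words_iff)
  \<comment> \<open>The letter \<open>1\<close> is the least word and is even, so it is neither a
    left factor of a good word nor the root of a square.\<close>
  have "u \<noteq> One"
  proof
    assume "u = One"
    then have "v \<prec> One \<or> v = One \<and> parity par One = 1" using Br.prems(1) by (auto simp: M_words_iff)
    then show False using One_least[OF M_words_mulfree[OF M(2)]] word_less_trans[of v One v]
        M_words_mulfree[OF M(2)] by (cases "v = One") auto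
  qed
  then obtain c q where c: "c \<noteq> 0" "q \<in> ?A 2" "jeval par u = psc c (epow (deg u - 1) (lie_symbol par u)) + q"
    using Br.hyps(1)[OF M(1)] by (metis add_diff_cancel_left' diff_add_cancel add.commute)
  have u1: "lie_symbol par u \<in> ?A 1" using aug_lie_symbol[OF M(1), where 'k = 'k] \<open>u \<noteq> One\<close> by simp
  have ju: "jeval par u \<in> ?A 1" unfolding c(3)
    using u1 aug_mono[OF c(2)] by (auto intro!: aug_closed aug_epow)
  show ?case
  proof (cases "v = One")
    case True
    obtain n where n: "deg u = Suc n" using deg_pos[of u] by (cases "deg u") auto
    have d: "der (lie_symbol par u) = lie_symbol par (Br u v)"
      by (simp add: True lie_symbol_Br lie_symbol_One der_def)
    have "jeval par (Br u v) - psc c (epow (deg (Br u v) - 1) (lie_symbol par (Br u v))) = emul (der q)"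
      unfolding d[symmetric] unfolding True jeval.simps weight_simps jbr_weight_unit c(3)
      by (simp add: n der_epow[OF lie_symbol_phom])
    then show ?thesis using c aug_emul[OF aug_der[OF c(2)]] by auto
  next
    case False
    then obtain d r where d: "d \<noteq> 0" "r \<in> ?A 2" "jeval par v = psc d (epow (deg v - 1) (lie_symbol par v)) + r"
      using Br.hyps(2)[OF M(2)] by (metis add_diff_cancel_left' diff_add_cancel add.commute)
    have v1: "lie_symbol par v \<in> ?A 1" using aug_lie_symbol[OF M(2), where 'k = 'k] False by simp
    have jv: "jeval par v \<in> ?A 1" unfolding d(3)
      using v1 aug_mono[OF d(2)] by (auto intro!: aug_closed aug_epow)
    let ?a = "deg u - 1" and ?b = "deg v - 1"
    let ?B = "epow (?a + ?b) (lie_symbol par (Br u v)) :: ('x option, 'k) poisson"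
    have two: "x * y \<in> ?A 2" if "x \<in> ?A 1" "y \<in> ?A 1" for x y
      using aug_mult[OF that] by (simp add: numeral_2_eq_2)
    have cong: "pbr (epow ?a (lie_symbol par u)) (epow ?b (lie_symbol par v)) - ?B \<in> ?A 2"
      unfolding lie_symbol_Br by (rule pbr_epow_cong[OF lie_symbol_phom u1 lie_symbol_phom v1])
    have qr: "pbr q (psc d (epow ?b (lie_symbol par v)) + r) \<in> ?A 2"
      using aug_pbr[OF c(2) jv] unfolding d(3) by (simp add: numeral_2_eq_2)
    have ur: "pbr (epow ?a (lie_symbol par u)) r \<in> ?A 2"
      using aug_pbr[OF aug_epow[OF u1] d(2), of ?a] by (simp add: numeral_2_eq_2)
    have eq: "pbr (jeval par u) (jeval par v) - psc (c * d) ?B =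
        psc (c * d) (pbr (epow ?a (lie_symbol par u)) (epow ?b (lie_symbol par v)) - ?B)
        + psc c (pbr (epow ?a (lie_symbol par u)) r) + pbr q (psc d (epow ?b (lie_symbol par v)) + r)"
      unfolding c(3) d(3) by (simp add: pbr_add pbr_psc)
    have P: "pbr (jeval par u) (jeval par v) - psc (c * d) ?B \<in> ?A 2"
      unfolding eq by (intro aug_closed(1,3) cong qr ur)
    have deg: "deg (Br u v) - 1 = Suc (?a + ?b)" using deg_pos[of u] deg_pos[of v] by (simp del: deg_pos)
    have eq2: "jeval par (Br u v) - psc (2 * (c * d)) (epow (deg (Br u v) - 1) (lie_symbol par (Br u v))) =
        psc 2 (emul (pbr (jeval par u) (jeval par v) - psc (c * d) ?B))
        + psc (weight u) (jeval par u * der (jeval par v)) - psc (weight v) (der (jeval par u) * jeval par v)"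
      unfolding deg jeval.simps jbr_def by simp
    have "jeval par (Br u v) - psc (2 * (c * d)) (epow (deg (Br u v) - 1) (lie_symbol par (Br u v))) \<in> ?A 2"
      unfolding eq2 by (intro aug_closed(1-3) aug_emul two aug_der P ju jv)
    then show ?thesis using c(1) d(1) by (intro exI[of _ "2 * (c * d)"] conjI) simp_all
  qed
qed simp

definition jeval_prod :: "('x \<Rightarrow> bit) \<Rightarrow> 'x nword list \<Rightarrow> ('x option, 'k::field) poisson" where
  "jeval_prod par ws = prod_list (map (jeval par) ws)"

lemma jeval_prod_simps [simp]:
  "jeval_prod par [] = 1" "jeval_prod par (w # ws) = jeval par w * jeval_prod par ws"
  "jeval_prod par (vs @ ws) = jeval_prod par vs * jeval_prod par ws"
  by (simp_all add: jeval_prod_def)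

lemma proper_length_proper: "One \<notin> set ws \<Longrightarrow> proper_length ws = length ws"
  by (induct ws) auto

lemma jeval_prod_leading:
  fixes par :: "'x::{finite,linorder} \<Rightarrow> bit"
  assumes "set ws \<subseteq> M_words par" "One \<notin> set ws"
  shows "\<exists>c. c \<noteq> 0 \<and> jeval_prod par ws - psc c (epow (total_deg ws - length ws) (prod_symbol par ws)) \<in>
    (aug par (Suc (length ws)) :: ('x option, 'k::field_char_0) poisson set)"
  using assms
proof (induct ws)
  case Nil
  show ?case by (intro exI[of _ 1]) (simp add: aug_closed)
next
  case (Cons w ws)
  let ?A = "aug par :: nat \<Rightarrow> ('x option, 'k) poisson set"
  have w: "w \<in> M_words par" "w \<noteq> One" "set ws \<subseteq> M_words par" "One \<notin> set ws" using Cons.prems by auto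
  let ?x = "epow (deg w - 1) (lie_symbol par w) :: ('x option, 'k) poisson"
  let ?y = "epow (total_deg ws - length ws) (prod_symbol par ws) :: ('x option, 'k) poisson"
  obtain c q where c: "c \<noteq> 0" "jeval par w - psc c ?x = q" "q \<in> ?A 2"
    using jeval_leading[OF w(1,2)] by blast
  obtain d r where d: "d \<noteq> 0" "jeval_prod par ws - psc d ?y = r" "r \<in> ?A (Suc (length ws))"
    using Cons.hyps[OF w(3,4)] by blast
  have eq: "jeval par w = psc c ?x + q" "jeval_prod par ws = psc d ?y + r"
    using c(2) d(2) by auto
  have x: "?x \<in> ?A 1" using aug_lie_symbol[OF w(1), where 'k = 'k] w(2) by (intro aug_epow) simp
  have y: "?y \<in> ?A (length ws)"
    using w(3) proper_length_proper[OF w(4)] by (intro aug_epow aug_prod) auto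
  have "total_deg (w # ws) - length (w # ws) = (total_deg ws - length ws) + (deg w - 1)"
    using deg_pos[of w] length_le_total_deg[of ws] by (simp del: deg_pos)
  then have xy: "?x * ?y = epow (total_deg (w # ws) - length (w # ws)) (prod_symbol par (w # ws))"
    by (simp add: epow_simps funpow_add)
  have "jeval_prod par (w # ws) - psc (c * d) (?x * ?y) = psc c (?x * r) + q * (psc d ?y + r)"
    by (simp add: eq distrib_left distrib_right)
  moreover have "?x * r \<in> ?A (Suc (length (w # ws)))"
    using aug_mult[OF x d(3)] by simp
  moreover have "q * (psc d ?y + r) \<in> ?A (Suc (length (w # ws)))"
  proof -
    have "psc d ?y + r \<in> ?A (length ws)" using y aug_mono[OF d(3)] by (intro aug_closed) auto
    from aug_mult[OF c(3) this] show ?thesis by simp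
  qed
  ultimately have "jeval_prod par (w # ws) - psc (c * d) (?x * ?y) \<in> ?A (Suc (length (w # ws)))"
    by (simp add: aug_closed)
  then show ?case using c(1) d(1) unfolding xy by (intro exI[of _ "c * d"]) simp
qed

lemma jeval_pow_word: "jeval par (pow_word e k) = emul (jeval_prod par (replicate k e))"
proof (induct k)
  case (Suc k)
  have comm: "jeval_prod par (replicate k e) * jeval par e = jeval_prod par (replicate (Suc k) e)"
    unfolding replicate_Suc replicate_append_same[symmetric] by simp
  show ?case by (simp only: pow_word.simps jeval.simps Suc emul_simps comm)
qed (simp add: emul_def)

lemma deg_pow_word: "deg (pow_word e k) = 1 + k * deg e"
  by (induct k) simp_all

lemma epow_emul: "epow n (emul x) = emul (epow n x)"
  by (induct n) simp_all

text \<open>Each \<open>pow_word\<close> and the final empty product contain one letter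
  \<open>1\<close>, which evaluates to \<open>e\<close>.\<close>

lemma jeval_mon_word: "jeval par (mon_word es) = epow (Suc (length es)) (jeval_prod par (expand es))"
proof (induct es)
  case (Cons p es)
  then show ?case by (cases p) (simp add: jeval_pow_word epow_simps epow_emul)
qed (simp add: emul_def)

lemma deg_mon_word: "deg (mon_word es) = Suc (length es) + total_deg (expand es)"
proof (induct es)
  case (Cons p es)
  have "total_deg (replicate k e) = k * deg e" for k and e :: "'a nword" by (induct k) simp_all
  with Cons show ?case by (cases p) (simp add: deg_pow_word)
qed simp

lemma prod_symbol_replicate_One: "prod_symbol par (replicate n One @ ws) = epow n (prod_symbol par ws)"
  by (induct n) (simp_all add: lie_symbol_One emul_def)

lemma replicate_One_sorted:
  fixes par :: "'x::linorder \<Rightarrow> bit"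
  assumes "ws \<in> sorted_M par" "One \<notin> set ws"
  shows "replicate n One @ ws \<in> sorted_M par"
proof -
  have "One \<prec> w" if "w \<in> set ws" for w
    using that assms by (intro One_least M_words_mulfree[of _ par]) (auto simp: sorted_M_def)
  moreover have "sorted_wrt (word_rel (\<lambda>a. parity par a = 1)) (replicate n One)"
    by (simp add: sorted_wrt_iff_nth_less word_rel_def)
  ultimately show ?thesis using assms
    by (auto simp: sorted_M_def sorted_wrt_append word_rel_def M_words_iff)
qed

theorem mon_words_independent:
  fixes par :: "'x::{finite,linorder} \<Rightarrow> bit" and c :: "('x nword \<times> nat) list \<Rightarrow> 'k::field_char_0"
  assumes F: "finite F" "F \<subseteq> monomial_exponents par"
    and ideal: "(\<Sum>es\<in>F. scale (c es) (word (mon_word es))) \<in> JB_ideal par"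
    and es0: "es0 \<in> F"
  shows "c es0 = 0"
proof (rule ccontr)
  assume "c es0 \<noteq> 0"
  let ?A = "aug par :: nat \<Rightarrow> ('x option, 'k) poisson set"
  let ?len = "\<lambda>es. length (expand es :: 'x nword list)"
  define G where "G = {es \<in> F. c es \<noteq> 0}"
  have G: "finite G" "es0 \<in> G" using F(1) es0 \<open>c es0 \<noteq> 0\<close> by (auto simp: G_def)
  define m where "m = Min (?len ` G)"
  have m: "m \<le> ?len es" if "es \<in> G" for es using that G(1) by (simp add: m_def)
  have "m \<in> ?len ` G" unfolding m_def using G by (intro Min_in) auto
  then obtain es1 where es1: "es1 \<in> G" "?len es1 = m" by auto
  obtain N0 where N0: "(\<Sum>es\<in>F. scale (c es) (word (mon_word es))) \<in> deg_le N0"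
    "homogenize par N0 (\<Sum>es\<in>F. scale (c es) (word (mon_word es))) = 0"
    using JB_ideal_null[OF ideal] by (auto simp: null_def)
  \<comment> \<open>Large enough for all differences \<open>N - deg (mon_word es)\<close> to be
    exact, and at least \<open>N0\<close>, so that the relation still vanishes in degree
    \<open>N\<close>.\<close>
  define N where "N = N0 + (\<Sum>es\<in>F. deg (mon_word es))"
  have degN: "deg (mon_word es) \<le> N" if "es \<in> F" for es
    using member_le_sum[OF that, of "\<lambda>es. deg (mon_word es)"] F(1) by (simp add: N_def)
  have sorted: "expand es \<in> sorted_M par" "One \<notin> set (expand es)" "set (expand es) \<subseteq> M_words par"
    if "es \<in> F" for es
    using expand_sorted[of es par] that F(2) by (auto simp: sorted_M_def)
  \<comment> \<open>For a monomial with the minimal number \<open>m\<close> of factors, the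
    homogenized leading term has the factor \<open>e\<close> exactly \<open>N - m\<close> times. As
    \<open>1\<close> is least and even, prepending these letters gives a sorted list again, to which
    the independence of the \<open>prod_symbol\<close> applies.\<close>
  define L where "L es = replicate (N - m) One @ expand es" for es :: "('x nword \<times> nat) list"
  have "\<exists>d. d \<noteq> 0 \<and> epow (N - deg (mon_word es)) (jeval par (mon_word es))
      - psc d (epow (N - ?len es) (prod_symbol par (expand es))) \<in> ?A (Suc (?len es))" if es: "es \<in> F" for es
  proof -
    obtain d where d: "d \<noteq> 0" "jeval_prod par (expand es)
        - psc d (epow (total_deg (expand es) - ?len es) (prod_symbol par (expand es))) \<in> ?A (Suc (?len es))"
      using jeval_prod_leading[OF sorted(3,2)[OF es]] by blast
    let ?n = "N - deg (mon_word es)"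
    have n: "N - ?len es = ?n + Suc (length es) + (total_deg (expand es) - ?len es)"
      using degN[OF es] length_le_total_deg[of "expand es"] by (simp add: deg_mon_word)
    have "epow (?n + Suc (length es)) (jeval_prod par (expand es)
        - psc d (epow (total_deg (expand es) - ?len es) (prod_symbol par (expand es)))) \<in> ?A (Suc (?len es))"
      using d(2) by (rule aug_epow)
    moreover have "epow k (x - y) = epow k x - epow k y" for k and x y :: "('x option, 'k) poisson"
      by (induct k) simp_all
    ultimately have "epow ?n (jeval par (mon_word es)) - psc d (epow (N - ?len es) (prod_symbol par (expand es)))
        \<in> ?A (Suc (?len es))"
      unfolding n jeval_mon_word by (simp only: funpow_add comp_apply epow_simps)
    then show ?thesis using d(1) by blast
  qed
  then obtain d where d: "d es \<noteq> 0" "epow (N - deg (mon_word es)) (jeval par (mon_word es))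
      - psc (d es) (epow (N - ?len es) (prod_symbol par (expand es))) \<in> ?A (Suc (?len es))"
    if "es \<in> F" for es by metis
  define H where "H = {es \<in> G. ?len es = m}"
  have H: "finite H" "H \<subseteq> G" "es1 \<in> H" using G(1) es1 by (auto simp: H_def)
  have lead: "psc (c es) (epow (N - deg (mon_word es)) (jeval par (mon_word es)))
      - (if es \<in> H then psc (c es * d es) (prod_symbol par (L es)) else 0) \<in> ?A (Suc m)" if "es \<in> G" for es
  proof -
    have F: "es \<in> F" using that by (simp add: G_def)
    let ?t = "epow (N - deg (mon_word es)) (jeval par (mon_word es)) :: ('x option, 'k) poisson"
    let ?p = "epow (N - ?len es) (prod_symbol par (expand es)) :: ('x option, 'k) poisson"
    have t: "psc (c es) (?t - psc (d es) ?p) \<in> ?A (Suc m)"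
      by (intro aug_closed(3) aug_mono[OF d(2)[OF F]]) (use m[OF that] in simp)
    show ?thesis
    proof (cases "es \<in> H")
      case True
      then have "?p = prod_symbol par (L es)" by (simp add: H_def L_def prod_symbol_replicate_One del: prod_symbol_simps)
      then show ?thesis using t True by simp
    next
      case False
      then have "Suc m \<le> ?len es" using m[OF that] that by (auto simp: H_def)
      then have "?p \<in> ?A (Suc m)"
        using sorted(2,3)[OF F] by (intro aug_epow aug_prod) (simp_all add: proper_length_proper)
      then have "psc (c es * d es) ?p \<in> ?A (Suc m)" by (rule aug_closed)
      from aug_closed(1)[OF t this] show ?thesis using False by simp
    qed
  qed
  have "0 = homogenize par N (\<Sum>es\<in>F. scale (c es) (word (mon_word es)))"
    using null_raise(2)[OF N0, of N] by (simp add: N_def)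
  also have "\<dots> = (\<Sum>es\<in>F. psc (c es) (epow (N - deg (mon_word es)) (jeval par (mon_word es))))"
    using F(1) by induct (simp_all add: homogenize_simps)
  also have "\<dots> = (\<Sum>es\<in>G. psc (c es) (epow (N - deg (mon_word es)) (jeval par (mon_word es))))"
    unfolding G_def by (rule sum.mono_neutral_right) (use F(1) in auto)
  finally have zero: "(\<Sum>es\<in>G. psc (c es) (epow (N - deg (mon_word es)) (jeval par (mon_word es)))) = 0" by simp
  have "(\<Sum>es\<in>G. psc (c es) (epow (N - deg (mon_word es)) (jeval par (mon_word es)))
      - (if es \<in> H then psc (c es * d es) (prod_symbol par (L es)) else 0)) \<in> ?A (Suc m)"
    by (intro PV.subspace_sum[OF subspace_aug] lead)
  then have "- (\<Sum>es\<in>G. if es \<in> H then psc (c es * d es) (prod_symbol par (L es)) else 0) \<in> ?A (Suc m)"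
    unfolding sum_subtractf zero by simp
  also have "(\<Sum>es\<in>G. if es \<in> H then psc (c es * d es) (prod_symbol par (L es)) else 0)
      = (\<Sum>es\<in>H. psc (c es * d es) (prod_symbol par (L es)) :: ('x option, 'k) poisson)"
    using H(2) G(1) by (simp add: sum.If_cases Int_absorb1 Int_commute)
  finally have "- (- (\<Sum>es\<in>H. psc (c es * d es) (prod_symbol par (L es)))) \<in> ?A (Suc m)"
    by (rule aug_closed(4))
  then have sumH: "(\<Sum>es\<in>H. psc (c es * d es) (prod_symbol par (L es))) \<in> ?A (Suc m)" by simp
  have HF: "es \<in> F" if "es \<in> H" for es using that H(2) by (auto simp: G_def)
  let ?S = "PV.span (prod_symbol par ` (sorted_M par - {L es1})) :: ('x option, 'k) poisson set"
  have L1: "proper_length (L es1) = m"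
    using es1 sorted(2)[OF HF[OF H(3)]] proper_length_proper[of "expand es1"]
    by (simp add: L_def) (simp add: proper_length_def)
  \<comment> \<open>The sum of the leading terms equals a combination of ordered products with more
    than \<open>m\<close> proper factors, hence of products other than that of
    \<open>L es1\<close>.\<close>
  have "(\<Sum>es\<in>H. psc (c es * d es) (prod_symbol par (L es))) \<in> ?S"
  proof (rule subsetD[OF PV.span_mono aug_sorted[OF sumH]])
    show "prod_symbol par ` {vs \<in> sorted_M par. Suc m \<le> proper_length vs} \<subseteq>
        (prod_symbol par ` (sorted_M par - {L es1}) :: ('x option, 'k) poisson set)"
      using L1 by auto
  qed
  moreover have "(\<Sum>es\<in>H - {es1}. psc (c es * d es) (prod_symbol par (L es))) \<in> ?S"
  proof (intro PV.span_sum PV.span_scale PV.span_base imageI)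
    fix es assume es: "es \<in> H - {es1}"
    have "L es \<in> sorted_M par"
      unfolding L_def using sorted[OF HF] es by (intro replicate_One_sorted) auto
    moreover have "L es \<noteq> L es1"
      using inj_onD[OF inj_expand[of par], of es es1] es F(2) HF H(3) by (auto simp: L_def)
    ultimately show "L es \<in> sorted_M par - {L es1}" by simp
  qed
  ultimately have "(\<Sum>es\<in>H. psc (c es * d es) (prod_symbol par (L es)))
      - (\<Sum>es\<in>H - {es1}. psc (c es * d es) (prod_symbol par (L es))) \<in> ?S"
    by (rule PV.span_diff)
  then have "psc (c es1 * d es1) (prod_symbol par (L es1)) \<in> ?S"
    unfolding sum.remove[OF H(1,3)] by simp
  then have "psc (1 / (c es1 * d es1)) (psc (c es1 * d es1) (prod_symbol par (L es1))) \<in> ?S"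
    by (rule PV.span_scale)
  moreover have "c es1 * d es1 \<noteq> 0" using d(1)[OF HF[OF H(3)]] es1(1) by (simp add: G_def)
  ultimately have "prod_symbol par (L es1) \<in> ?S" by simp
  moreover have "L es1 \<in> sorted_M par"
    unfolding L_def by (rule replicate_One_sorted[OF sorted(1,2)[OF HF[OF H(3)]]])
  ultimately show False using prod_symbol_notin_span by blast
qed

section \<open>The basis theorem\<close>

lemma JB_monomial_eq:
  "JB_monomial par es = JB_class par (word (mon_word es) :: ('x, 'k::field) free_alg)"
proof (induct es)
  case Nil
  show ?case by (simp add: JB_monomial_def JB_def)
next
  case (Cons p es)
  obtain e k where p: "p = (e, k)" by (cases p)
  have "JB_class par (word e :: ('x, 'k) free_alg) [^]\<^bsub>JB par\<^esub> k = JB_class par (word (pow_word e k))" for k :: nat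
  proof (induct k)
    case 0
    show ?case by (simp add: nat_pow_def JB_def)
  next
    case (Suc k)
    then show ?case by (simp add: nat_pow_def JB_mult_class mul_simps)
  qed
  with Cons show ?case by (simp add: p JB_monomial_def JB_mult_class mul_simps)
qed

lemma inj_JB_monomial:
  fixes par :: "'x::{finite,linorder} \<Rightarrow> bit"
  shows "inj_on (JB_monomial par :: _ \<Rightarrow> ('x, 'k::field_char_0) free_alg set) (monomial_exponents par)"
proof (rule inj_onI, rule ccontr)
  fix es fs :: "('x nword \<times> nat) list"
  assume mem: "es \<in> monomial_exponents par" "fs \<in> monomial_exponents par" and ne: "es \<noteq> fs"
    and eq: "JB_monomial par es = (JB_monomial par fs :: ('x, 'k) free_alg set)"
  let ?c = "\<lambda>gs. if gs = es then 1 else - 1 :: 'k"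
  have "(word (mon_word es) - word (mon_word fs) :: ('x, 'k) free_alg) \<in> JB_ideal par"
    using eq by (simp only: JB_monomial_eq JB_class_eq_iff)
  then have "(\<Sum>gs\<in>{es, fs}. scale (?c gs) (word (mon_word gs))) \<in> JB_ideal par"
    using ne by (simp add: scale_minus_one)
  then have "?c es = 0" using mem by (intro mon_words_independent[of "{es, fs}" par ?c]) auto
  then show False by simp
qed

text \<open>Since \<open>U_monomials\<close> is a set of classes, coincidences between monomials
  would be invisible in the first conjunct; the second excludes them.\<close>

theorem theorem5:
  fixes par :: "'x::{finite,linorder} \<Rightarrow> bit"
  shows "vectorspace.basis (class_ring :: 'k::field_char_0 ring) (JB par) (U_monomials par) \<and>
         inj_on (JB_monomial par :: _ \<Rightarrow> ('x, 'k) free_alg set) (monomial_exponents par)"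
proof
  show inj: "inj_on (JB_monomial par :: _ \<Rightarrow> ('x, 'k) free_alg set) (monomial_exponents par)"
    by (rule inj_JB_monomial)
  let ?J = "JB par :: ('k, ('x, 'k) free_alg set) bracket_module"
  let ?C = "JB_class par :: ('x, 'k) free_alg \<Rightarrow> _"
  let ?E = "monomial_exponents par"
  let ?U = "U_monomials par :: ('x, 'k) free_alg set set"
  interpret V: vectorspace "class_ring :: 'k ring" ?J by (rule vectorspace_JB)
  have UC: "?U \<subseteq> carrier ?J"
    by (auto simp: U_monomials_def JB_monomial_eq JB_class_carrier)
  \<comment> \<open>Transfers combinations in \<open>JB\<close> to representatives in
    \<open>D_X\<close>; the injectivity of \<open>JB_monomial\<close> allows the sum over a set of
    classes to be indexed by exponent lists.\<close>
  have lincomb: "V.lincomb a (JB_monomial par ` F) = ?C (\<Sum>es\<in>F. scale (a (JB_monomial par es)) (word (mon_word es)))"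
    if "finite F" "F \<subseteq> ?E" for a F
    using that
  proof induct
    case empty
    show ?case by (simp add: V.lincomb_def JB_zero)
  next
    case (insert es F)
    have notin: "JB_monomial par es \<notin> (JB_monomial par ` F :: ('x, 'k) free_alg set set)"
      using inj insert.hyps(2) insert.prems by (auto dest: inj_onD)
    have car: "a X \<odot>\<^bsub>?J\<^esub> X \<in> carrier ?J" if "X \<in> JB_monomial par ` insert es F" for X
      using that by (auto simp: JB_monomial_eq JB_smult_class JB_class_carrier)
    have "V.lincomb a (JB_monomial par ` insert es F) =
        (a (JB_monomial par es) \<odot>\<^bsub>?J\<^esub> JB_monomial par es) \<oplus>\<^bsub>?J\<^esub> V.lincomb a (JB_monomial par ` F)"
      unfolding V.lincomb_def image_insert using insert.hyps(1) notin car
      by (intro V.finsum_insert) auto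
    then show ?case using insert by (simp add: JB_monomial_eq JB_smult_class JB_add_class)
  qed
  have "V.lin_indpt ?U"
  proof
    assume "V.lin_dep ?U"
    then obtain A a X where A: "finite A" "A \<subseteq> ?U" "V.lincomb a A = \<zero>\<^bsub>?J\<^esub>" "X \<in> A" "a X \<noteq> 0"
      unfolding V.lin_dep_def by auto
    obtain F where F: "F \<subseteq> ?E" "A = JB_monomial par ` F"
      using A(2) unfolding U_monomials_def by (auto simp: subset_image_iff)
    have fin: "finite F" using A(1) F inj by (metis finite_imageD inj_on_subset)
    have "?C (\<Sum>es\<in>F. scale (a (JB_monomial par es)) (word (mon_word es))) = ?C 0"
      using A(3) unfolding F(2) lincomb[OF fin F(1)] JB_zero .
    then have "(\<Sum>es\<in>F. scale (a (JB_monomial par es)) (word (mon_word es))) \<in> JB_ideal par"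
      by (simp add: JB_class_eq_iff)
    moreover obtain es where "es \<in> F" "X = JB_monomial par es" using A(4) F(2) by blast
    ultimately show False
      using mon_words_independent[OF fin F(1), of "\<lambda>es. a (JB_monomial par es)" es] A(5) by simp
  qed
  moreover have "V.gen_set ?U"
  proof
    show "V.span ?U \<subseteq> carrier ?J" by (rule V.span_is_subset2[OF UC])
    interpret S: LinearCombinations.submodule class_ring "V.span ?U" ?J
      by (rule V.span_is_submodule[OF UC])
    have zero: "?C 0 \<in> V.span ?U" using S.zero_closed by (simp only: JB_zero)
    show "carrier ?J \<subseteq> V.span ?U"
    proof
      fix X assume "X \<in> carrier ?J"
      then obtain p where p: "X = ?C p" by (rule JB_carrierE)
      have "FA.subspace {p. ?C p \<in> V.span ?U}"
        unfolding FA.subspace_def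
      proof (intro conjI ballI allI; simp only: mem_Collect_eq)
        show "?C 0 \<in> V.span ?U" by (rule zero)
        show "?C (p + q) \<in> V.span ?U" if "?C p \<in> V.span ?U" "?C q \<in> V.span ?U" for p q
          using S.m_closed[OF that] by (simp only: JB_add_class)
        show "?C (scale c p) \<in> V.span ?U" if "?C p \<in> V.span ?U" for c p
          using S.smult_closed[OF _ that, of c] by (simp add: JB_smult_class)
      qed
      moreover have "?C q \<in> V.span ?U" if "q \<in> JB_ideal par" for q
      proof -
        have "?C q = ?C 0" using that by (simp add: JB_class_eq_iff)
        then show ?thesis using zero by simp
      qed
      moreover have "?C (word (mon_word es)) \<in> V.span ?U" if "es \<in> ?E" for es
        using V.in_own_span[OF UC] that by (auto simp: U_monomials_def simp flip: JB_monomial_eq)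
      ultimately have "FA.span (JB_ideal par \<union> (\<lambda>es. word (mon_word es)) ` ?E) \<subseteq> {p. ?C p \<in> V.span ?U}"
        by (intro FA.span_minimal) auto
      then show "X \<in> V.span ?U" using mon_words_span[of p par] p by blast
    qed
  qed
  ultimately show "vectorspace.basis class_ring ?J ?U"
    using UC by (simp add: V.basis_def)
qed

end
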